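(* Let $K$ be a field. Each of the Lie superalgebra $\mathbf Q$, the associative algebra $\mathbf A$, and the Poisson superalgebra without unit $\mathbf P^o$ (and, when $\operatorname{char}K\ne2$, the Jordan superalgebras without unit $\mathbf J^o$ and $\mathbf K^o$) decomposes as a direct sum of two locally nilpotent subalgebras: $$\mathbf Q=\mathbf Q_+\oplus\mathbf Q_-,\quad\mathbf A=\mathbf A_+\oplus\mathbf A_-,\quad\mathbf P^o=\mathbf P_+\oplus\mathbf P_-,\quad\mathbf J^o=\mathbf J_+\oplus\mathbf J_-,\quad\mathbf K^o=\mathbf K_+\oplus\mathbf K_-,$$ and for each of these algebras there are continuum many different such decompositions.
   Context: $\Lambda$ is the Grassmann algebra over $K$ on odd $x_0,x_1,\dots$ ($x_i$ acting by left multiplication), $\partial_i$ the superderivation with $\partial_i(x_j)=\delta_{ij}$, $v_i=\sum_{k\ge0}\big(\prod_{n=0}^{k-1}x_{i+3n}x_{i+3n+1}\big)\partial_{i+3k}$. $\mathbf Q$ is the Lie subsuperalgebra of $(\operatorname{End}\Lambda)^{(-)}$ generated by $v_0,v_1,v_2$ (closed under squares of odd elements in characteristic $2$); $\mathbf A$ is the associative subalgebra of $\operatorname{End}\Lambda$ generated by $v_0,v_1,v_2$. $H_\infty=\Lambda(x_i,y_i\mid i\ge0)$ (odd generators) with Poisson bracket $\{y_i,x_j\}=\delta_{ij}$, $\{x_i,x_j\}=\{y_i,y_j\}=0$; $\widetilde H$ its completion by formal sums $c\cdot1+\sum\lambda_{\alpha,\beta}x^\alpha y^\beta$ over monomials with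 $\beta\ne0$ and (largest index in $\alpha$) $<$ (largest index in $\beta$); $V_i=\sum_{k\ge0}\big(\prod_{n=0}^{k-1}x_{i+3n}x_{i+3n+1}\big)y_{i+3k}$; $\mathbf P$ is the smallest unital subalgebra of $\widetilde H$ containing $V_0,V_1,V_2$ closed under product, bracket and (in characteristic $2$) the formal square of odd elements ($m^{[2]}=0$ for odd monomials, $(f+g)^{[2]}=f^{[2]}+\{f,g\}+g^{[2]}$); $\mathbf P^o$ is the span of its elements without constant term (its ideal without unit). $\mathbf J=\mathrm{Kan}(\mathbf P)=\mathbf P\oplus\bar{\mathbf P}$ with $|\bar a|=1-|a|$ and $a\bullet b=ab$, $\bar a\bullet b=(-1)^{|b|}\overline{ab}$, $a\bullet\bar b=\overline{ab}$, $\bar a\bullet\bar b=(-1)^{|b|}\{a,b\}$; $\mathbf J^o=\mathbf P^o\oplus\bar{\mathbf P}$. $\mathbf K=K1\oplus\mathbf Q\oplus K\bar1\oplus\bar{\mathbf Q}$ with only nonzero products (besides the unit $1$) $\bar x\bullet\bar y=[x,y]$, $x\bullet\bar1=(-1)^{|x|}\bar1\bullet x=\bar x$; $\mathbf K^o=\mathbf Q\oplus K\bar1\oplus\bar{\mathbf Q}$. An algebra is locally nilpotent if every finitely generated subalgebra is nilpotent. *)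

theory Defs
  imports Complex_Main
begin

text \<open>Vectors over a field 'k are coefficient functions 'i => 'k on a basis 'i.\<close>

definition z0 :: "'i \<Rightarrow> 'k::field" where "z0 = (\<lambda>_. 0)"
definition vadd :: "('i \<Rightarrow> 'k::field) \<Rightarrow> ('i \<Rightarrow> 'k) \<Rightarrow> 'i \<Rightarrow> 'k" where
  "vadd a b = (\<lambda>i. a i + b i)"
definition vsub :: "('i \<Rightarrow> 'k::field) \<Rightarrow> ('i \<Rightarrow> 'k) \<Rightarrow> 'i \<Rightarrow> 'k" where
  "vsub a b = (\<lambda>i. a i - b i)"
definition vsc :: "'k::field \<Rightarrow> ('i \<Rightarrow> 'k) \<Rightarrow> 'i \<Rightarrow> 'k" where
  "vsc c a = (\<lambda>i. c * a i)"

definition lin_sub :: "('i \<Rightarrow> 'k::field) set \<Rightarrow> bool" where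
  "lin_sub S \<longleftrightarrow> z0 \<in> S \<and> (\<forall>a\<in>S. \<forall>b\<in>S. vadd a b \<in> S) \<and> (\<forall>c a. a \<in> S \<longrightarrow> vsc c a \<in> S)"

text \<open>A (super)algebra structure is given by: the projection pe onto the even part,
  a list of bilinear operations, and a square operation on odd elements
  (the square map is the zero map for algebras without squares).
  A subalgebra is a graded subspace closed under the operations and under squares of odd elements.\<close>

definition is_subalg ::
  "(('i \<Rightarrow> 'k::field) \<Rightarrow> ('i \<Rightarrow> 'k)) \<Rightarrow> (('i \<Rightarrow> 'k) \<Rightarrow> ('i \<Rightarrow> 'k) \<Rightarrow> ('i \<Rightarrow> 'k)) list
    \<Rightarrow> (('i \<Rightarrow> 'k) \<Rightarrow> ('i \<Rightarrow> 'k)) \<Rightarrow> ('i \<Rightarrow> 'k) set \<Rightarrow> bool" where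
  "is_subalg pe ops sq S \<longleftrightarrow> lin_sub S \<and> (\<forall>a\<in>S. pe a \<in> S)
     \<and> (\<forall>f\<in>set ops. \<forall>a\<in>S. \<forall>b\<in>S. f a b \<in> S)
     \<and> (\<forall>a\<in>S. pe a = z0 \<longrightarrow> sq a \<in> S)"

definition generated ::
  "(('i \<Rightarrow> 'k::field) \<Rightarrow> ('i \<Rightarrow> 'k)) \<Rightarrow> (('i \<Rightarrow> 'k) \<Rightarrow> ('i \<Rightarrow> 'k) \<Rightarrow> ('i \<Rightarrow> 'k)) list
    \<Rightarrow> (('i \<Rightarrow> 'k) \<Rightarrow> ('i \<Rightarrow> 'k)) \<Rightarrow> ('i \<Rightarrow> 'k) set \<Rightarrow> ('i \<Rightarrow> 'k) set" where
  "generated pe ops sq G = \<Inter>{S. is_subalg pe ops sq S \<and> G \<subseteq> S}"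

definition homog :: "(('i \<Rightarrow> 'k::field) \<Rightarrow> ('i \<Rightarrow> 'k)) \<Rightarrow> ('i \<Rightarrow> 'k) \<Rightarrow> bool" where
  "homog pe x \<longleftrightarrow> pe x = x \<or> pe x = z0"

text \<open>Monomials (all bracketings, with squares of odd monomials) in a set X of homogeneous
  elements, tagged with their degree and parity (True = odd).\<close>

inductive_set mons ::
  "(('i \<Rightarrow> 'k::field) \<Rightarrow> ('i \<Rightarrow> 'k)) \<Rightarrow> (('i \<Rightarrow> 'k) \<Rightarrow> ('i \<Rightarrow> 'k) \<Rightarrow> ('i \<Rightarrow> 'k)) list
    \<Rightarrow> (('i \<Rightarrow> 'k) \<Rightarrow> ('i \<Rightarrow> 'k)) \<Rightarrow> ('i \<Rightarrow> 'k) set \<Rightarrow> (('i \<Rightarrow> 'k) \<times> nat \<times> bool) set"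
  for pe ops sq X where
  mgen: "x \<in> X \<Longrightarrow> pe x = (if p then z0 else x) \<Longrightarrow> (x, 1, p) \<in> mons pe ops sq X"
| mop: "(a, m, p) \<in> mons pe ops sq X \<Longrightarrow> (b, n, q) \<in> mons pe ops sq X \<Longrightarrow> f \<in> set ops
         \<Longrightarrow> (f a b, m + n, p \<noteq> q) \<in> mons pe ops sq X"
| msq: "(a, m, True) \<in> mons pe ops sq X \<Longrightarrow> (sq a, 2 * m, False) \<in> mons pe ops sq X"

text \<open>Locally nilpotent: the subalgebra generated by any finite set (w.l.o.g. of homogeneous
  elements) is nilpotent, i.e. all products of degree at least N in the generators vanish.\<close>

definition loc_nilp ::
  "(('i \<Rightarrow> 'k::field) \<Rightarrow> ('i \<Rightarrow> 'k)) \<Rightarrow> (('i \<Rightarrow> 'k) \<Rightarrow> ('i \<Rightarrow> 'k) \<Rightarrow> ('i \<Rightarrow> 'k)) list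
    \<Rightarrow> (('i \<Rightarrow> 'k) \<Rightarrow> ('i \<Rightarrow> 'k)) \<Rightarrow> ('i \<Rightarrow> 'k) set \<Rightarrow> bool" where
  "loc_nilp pe ops sq L \<longleftrightarrow> (\<forall>X. finite X \<and> X \<subseteq> L \<and> (\<forall>x\<in>X. homog pe x) \<longrightarrow>
      (\<exists>N. \<forall>w n p. (w, n, p) \<in> mons pe ops sq X \<and> N \<le> n \<longrightarrow> w = z0))"

definition is_decomp ::
  "(('i \<Rightarrow> 'k::field) \<Rightarrow> ('i \<Rightarrow> 'k)) \<Rightarrow> (('i \<Rightarrow> 'k) \<Rightarrow> ('i \<Rightarrow> 'k) \<Rightarrow> ('i \<Rightarrow> 'k)) list
    \<Rightarrow> (('i \<Rightarrow> 'k) \<Rightarrow> ('i \<Rightarrow> 'k)) \<Rightarrow> ('i \<Rightarrow> 'k) set \<Rightarrow> ('i \<Rightarrow> 'k) set \<Rightarrow> ('i \<Rightarrow> 'k) set \<Rightarrow> bool" where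
  "is_decomp pe ops sq L B1 B2 \<longleftrightarrow>
     B1 \<subseteq> L \<and> B2 \<subseteq> L \<and> is_subalg pe ops sq B1 \<and> is_subalg pe ops sq B2
     \<and> B1 \<inter> B2 = {z0} \<and> (\<forall>x\<in>L. \<exists>b1\<in>B1. \<exists>b2\<in>B2. x = vadd b1 b2)
     \<and> loc_nilp pe ops sq B1 \<and> loc_nilp pe ops sq B2"

definition continuum_decomps ::
  "(('i \<Rightarrow> 'k::field) \<Rightarrow> ('i \<Rightarrow> 'k)) \<Rightarrow> (('i \<Rightarrow> 'k) \<Rightarrow> ('i \<Rightarrow> 'k) \<Rightarrow> ('i \<Rightarrow> 'k)) list
    \<Rightarrow> (('i \<Rightarrow> 'k) \<Rightarrow> ('i \<Rightarrow> 'k)) \<Rightarrow> ('i \<Rightarrow> 'k) set \<Rightarrow> bool" where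
  "continuum_decomps pe ops sq L \<longleftrightarrow>
     (\<exists>D. D \<subseteq> {(B1, B2). is_decomp pe ops sq L B1 B2} \<and> (\<exists>f::real \<Rightarrow> _. bij_betw f UNIV D))"

text \<open>Basis of Lambda: x^T for finite T (increasing product). Sign of x^A x^B = sgn * x^(A Un B).\<close>

definition gsgn :: "nat set \<Rightarrow> nat set \<Rightarrow> 'k::field" where
  "gsgn A B = (-1) ^ card {(a, b). a \<in> A \<and> b \<in> B \<and> b < a}"

text \<open>An endomorphism a of Lambda is given by its matrix: a (T,S) is the coefficient of x^S
  in the image of x^T.\<close>

type_synonym 'k endo = "nat set \<times> nat set \<Rightarrow> 'k"

definition ocomp :: "'k::field endo \<Rightarrow> 'k endo \<Rightarrow> 'k endo" where
  "ocomp a b = (\<lambda>(T, S). \<Sum>U\<in>{U. b (T, U) \<noteq> 0}. b (T, U) * a (U, S))"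

definition lmulop :: "nat set \<Rightarrow> 'k::field endo" where
  "lmulop W = (\<lambda>(T, S). if finite T \<and> W \<inter> T = {} \<and> S = W \<union> T then gsgn W T else 0)"

definition dop :: "nat \<Rightarrow> 'k::field endo" where
  "dop i = (\<lambda>(T, S). if finite T \<and> i \<in> T \<and> S = T - {i} then (-1) ^ card {t\<in>T. t < i} else 0)"

definition Wset :: "nat \<Rightarrow> nat \<Rightarrow> nat set" where
  "Wset i k = {i + 3 * n | n. n < k} \<union> {i + 3 * n + 1 | n. n < k}"

text \<open>v_i = sum_k (prod_{n<k} x_(i+3n) x_(i+3n+1)) d_(i+3k); the sum is finite on each x^T.\<close>

definition vop :: "nat \<Rightarrow> 'k::field endo" where
  "vop i = (\<lambda>(T, S). \<Sum>k\<in>{k. i + 3 * k \<in> T}. ocomp (lmulop (Wset i k)) (dop (i + 3 * k)) (T, S))"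

definition pe_op :: "'k::field endo \<Rightarrow> 'k endo" where
  "pe_op a = (\<lambda>(T, S). if even (card T + card S) then a (T, S) else 0)"

text \<open>Supercommutator [a,b] = sum over homogeneous components a_p b_q - (-1)^(pq) b_q a_p,
  which equals ab - ba + 2 b_1 a_1.\<close>

definition bracket_op :: "'k::field endo \<Rightarrow> 'k endo \<Rightarrow> 'k endo" where
  "bracket_op a b = vadd (vsub (ocomp a b) (ocomp b a))
      (vsc 2 (ocomp (vsub b (pe_op b)) (vsub a (pe_op a))))"

definition twist_op :: "'k::field endo \<Rightarrow> 'k endo" where
  "twist_op x = vsub (vsc 2 (pe_op x)) x"

definition Qalg :: "'k::field endo set" where
  "Qalg = generated pe_op [bracket_op] (\<lambda>a. ocomp a a) {vop 0, vop 1, vop 2}"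

definition Aalg :: "'k::field endo set" where
  "Aalg = generated id [ocomp] (\<lambda>_. z0) {vop 0, vop 1, vop 2}"

text \<open>Elements of the completion are coefficient functions on monomials x^alpha y^beta
  (x's increasing, then y's increasing), encoded as (alpha, beta).\<close>

type_synonym 'k hel = "nat set \<times> nat set \<Rightarrow> 'k"

definition hmul_mono :: "nat set \<times> nat set \<Rightarrow> nat set \<times> nat set \<Rightarrow> nat set \<times> nat set \<Rightarrow> 'k::field" where
  "hmul_mono m1 m2 t = (case (m1, m2, t) of ((a1, b1), (a2, b2), (A, B)) \<Rightarrow>
     if a1 \<inter> a2 = {} \<and> b1 \<inter> b2 = {} \<and> A = a1 \<union> a2 \<and> B = b1 \<union> b2
     then (-1) ^ (card b1 * card a2) * gsgn a1 a2 * gsgn b1 b2 else 0)"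

text \<open>Poisson bracket of monomials:
  {f,g} = sum_i (f d/dy_i from the right)(d/dx_i g from the left) + (f d/dx_i right)(d/dy_i g left).\<close>

definition br_mono :: "nat set \<times> nat set \<Rightarrow> nat set \<times> nat set \<Rightarrow> nat set \<times> nat set \<Rightarrow> 'k::field" where
  "br_mono m1 m2 t = (case (m1, m2) of ((a1, b1), (a2, b2)) \<Rightarrow>
     (\<Sum>i\<in>b1 \<inter> a2. (-1) ^ card {b\<in>b1. i < b} * (-1) ^ card {a\<in>a2. a < i}
                     * hmul_mono (a1, b1 - {i}) (a2 - {i}, b2) t)
   + (\<Sum>i\<in>a1 \<inter> b2. (-1) ^ (card {a\<in>a1. i < a} + card b1) * (-1) ^ (card a2 + card {b\<in>b2. b < i})
                     * hmul_mono (a1 - {i}, b1) (a2, b2 - {i}) t))"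

text \<open>Bilinear extension to formal sums (coefficientwise finite on the completion).\<close>

definition bil :: "('m \<Rightarrow> 'm \<Rightarrow> 'm \<Rightarrow> 'k::field) \<Rightarrow> ('m \<Rightarrow> 'k) \<Rightarrow> ('m \<Rightarrow> 'k) \<Rightarrow> 'm \<Rightarrow> 'k" where
  "bil F f g t = (\<Sum>p\<in>{(m1, m2). f m1 * g m2 * F m1 m2 t \<noteq> 0}.
                    f (fst p) * g (snd p) * F (fst p) (snd p) t)"

definition hmul :: "'k::field hel \<Rightarrow> 'k hel \<Rightarrow> 'k hel" where
  "hmul f g = bil hmul_mono f g"

definition hbr :: "'k::field hel \<Rightarrow> 'k hel \<Rightarrow> 'k hel" where
  "hbr f g = bil br_mono f g"

text \<open>A total order on monomials (via an injective code) used for the formal square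
  f^[2] = sum_{m < m'} f_m f_m' {m,m'} of an odd element (m^[2] = 0 for odd monomials).\<close>

definition mcode :: "nat set \<times> nat set \<Rightarrow> nat" where
  "mcode m = (\<Sum>x\<in>fst m. 2 ^ (2 * x)) + (\<Sum>x\<in>snd m. 2 ^ (2 * x + 1))"

definition hsq :: "'k::field hel \<Rightarrow> 'k hel" where
  "hsq f t = (\<Sum>p\<in>{(m1, m2). mcode m1 < mcode m2 \<and> f m1 * f m2 * br_mono m1 m2 t \<noteq> 0}.
               f (fst p) * f (snd p) * br_mono (fst p) (snd p) t)"

definition pe_H :: "'k::field hel \<Rightarrow> 'k hel" where
  "pe_H h = (\<lambda>(a, b). if even (card a + card b) then h (a, b) else 0)"

definition twist_H :: "'k::field hel \<Rightarrow> 'k hel" where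
  "twist_H x = vsub (vsc 2 (pe_H x)) x"

definition Vgen :: "nat \<Rightarrow> 'k::field hel" where
  "Vgen i = (\<lambda>(a, b). if \<exists>k. a = Wset i k \<and> b = {i + 3 * k} then 1 else 0)"

definition hone :: "'k::field hel" where
  "hone = (\<lambda>m. if m = ({}, {}) then 1 else 0)"

definition Palg :: "'k::field hel set" where
  "Palg = generated pe_H [hmul, hbr] hsq {hone, Vgen 0, Vgen 1, Vgen 2}"

definition Po :: "'k::field hel set" where
  "Po = {f \<in> Palg. f ({}, {}) = 0}"

section \<open>The Kantor double J = Kan(P)\<close>

text \<open>An element a + bbar is encoded by z with z (False, m) = a m and z (True, m) = b m.\<close>

type_synonym 'k jel = "bool \<times> nat set \<times> nat set \<Rightarrow> 'k"

definition jpart :: "'k jel \<Rightarrow> bool \<Rightarrow> 'k hel" where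
  "jpart z c = (\<lambda>m. z (c, m))"

definition mkJ :: "'k hel \<Rightarrow> 'k hel \<Rightarrow> 'k jel" where
  "mkJ a b = (\<lambda>(c, m). if c then b m else a m)"

definition jmul :: "'k::field jel \<Rightarrow> 'k jel \<Rightarrow> 'k jel" where
  "jmul z w = mkJ
     (vadd (hmul (jpart z False) (jpart w False)) (hbr (jpart z True) (twist_H (jpart w True))))
     (vadd (hmul (jpart z False) (jpart w True)) (hmul (jpart z True) (twist_H (jpart w False))))"

definition pe_J :: "'k::field jel \<Rightarrow> 'k jel" where
  "pe_J z = mkJ (pe_H (jpart z False)) (vsub (jpart z True) (pe_H (jpart z True)))"

definition Jo :: "'k::field jel set" where
  "Jo = {z. jpart z False \<in> Po \<and> jpart z True \<in> Palg}"

type_synonym 'k kel = "bool \<times> (nat set \<times> nat set) option \<Rightarrow> 'k"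

definition kc :: "'k kel \<Rightarrow> 'k" where "kc z = z (False, None)"
definition kx :: "'k kel \<Rightarrow> 'k endo" where "kx z = (\<lambda>p. z (False, Some p))"
definition kd :: "'k kel \<Rightarrow> 'k" where "kd z = z (True, None)"
definition ky :: "'k kel \<Rightarrow> 'k endo" where "ky z = (\<lambda>p. z (True, Some p))"

text \<open>mkK c x d y stands for c*1 + x + d*1bar + ybar.\<close>

definition mkK :: "'k \<Rightarrow> 'k endo \<Rightarrow> 'k \<Rightarrow> 'k endo \<Rightarrow> 'k kel" where
  "mkK c x d y = (\<lambda>(b, oo). case oo of None \<Rightarrow> (if b then d else c) | Some p \<Rightarrow> (if b then y p else x p))"

definition kmul :: "'k::field kel \<Rightarrow> 'k kel \<Rightarrow> 'k kel" where
  "kmul z w = mkK (kc z * kc w)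
     (vadd (vadd (vsc (kc z) (kx w)) (vsc (kc w) (kx z))) (bracket_op (ky z) (ky w)))
     (kc z * kd w + kc w * kd z)
     (vadd (vadd (vsc (kc z) (ky w)) (vsc (kc w) (ky z)))
           (vadd (vsc (kd w) (kx z)) (vsc (kd z) (twist_op (kx w)))))"

definition pe_K :: "'k::field kel \<Rightarrow> 'k kel" where
  "pe_K z = mkK (kc z) (pe_op (kx z)) 0 (vsub (ky z) (pe_op (ky z)))"

definition Ko :: "'k::field kel set" where
  "Ko = {z. kc z = 0 \<and> kx z \<in> Qalg \<and> ky z \<in> Qalg}"

end

theory Submission
  imports Defs "HOL-Analysis.Analysis"
begin

text \<open>
  Give \<open>v\<^sub>n\<close> the weight \<open>a\<^sub>n\<close>, where \<open>a\<^sub>n\<^sub>+\<^sub>3 = 2 a\<^sub>n + a\<^sub>n\<^sub>+\<^sub>1\<close>; then all five algebras are graded by \<open>\<int>\<^sup>3\<close>. The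
  polynomial \<open>t\<^sup>3 - t - 2\<close> is irreducible, with a real root \<open>lam\<close> and complex roots \<open>mu\<close>, \<open>cnj mu\<close>
  such that \<open>|mu|\<^sup>2 < lam\<close>. Realising \<open>a\<^sub>n\<close> as \<open>(mu\<^sup>n, lam\<^sup>n)\<close>, every nonzero component has a weight \<open>(z, r)\<close>
  with \<open>|z|\<^sup>2 \<le> C r\<close>: all components lie in a paraboloid around the axis \<open>z = 0\<close>. A plane through this
  axis that avoids the nonzero lattice points cuts each algebra into two subalgebras. In a half, a
  product of \<open>n\<close> factors lies at distance at least \<open>n d\<close> from the plane and has \<open>r = O(n)\<close>, so it leaves
  the paraboloid for large \<open>n\<close>: the halves are locally nilpotent. Each algebra contains \<open>\<plusminus>v\<^sub>n\<close> for all
  \<open>n\<close>, and the arguments of \<open>mu\<^sup>n\<close> are dense because no power of \<open>mu\<close> is real, so different planes give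
  different decompositions.
\<close>


section \<open>The roots of \<open>t\<^sup>3 = t + 2\<close>\<close>

definition lam :: real where
  "lam = (SOME x. 3/2 < x \<and> x < 153/100 \<and> x ^ 3 = x + 2)"

lemma lam_bounds: "3/2 < lam" "lam < 153/100"
  and lam_cubed: "lam ^ 3 = lam + 2"
proof -
  let ?g = "\<lambda>x::real. x ^ 3 - x - 2"
  have "\<exists>x. 3/2 \<le> x \<and> x \<le> 153/100 \<and> ?g x = 0"
    by (rule IVT') (auto intro!: continuous_intros simp: power3_eq_cube)
  then obtain x where root: "3/2 \<le> x" "x \<le> 153/100" "?g x = 0" by blast
  have "?g (3/2) \<noteq> 0" "?g (153/100) \<noteq> 0" by (simp_all add: power3_eq_cube)
  with root(3) have "x \<noteq> 3/2" "x \<noteq> 153/100" by metis+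
  with root have "\<exists>x::real. 3/2 < x \<and> x < 153/100 \<and> x ^ 3 = x + 2"
    by (intro exI[of _ x]) auto
  from someI_ex[OF this] show "3/2 < lam" "lam < 153/100" "lam ^ 3 = lam + 2"
    unfolding lam_def by auto
qed

lemma lam_sq_gt: "9/4 < lam\<^sup>2"
proof -
  have "(3/2)\<^sup>2 < lam\<^sup>2" using lam_bounds by (intro power_strict_mono) auto
  then show ?thesis by (simp add: power2_eq_square)
qed

lemma lam_sq_less: "lam\<^sup>2 < 1 + 877/1000 * lam"
proof -
  have "lam * (lam - 877/1000) < (153/100) * (153/100 - 877/1000)"
    using lam_bounds by (intro mult_strict_mono) auto
  then show ?thesis by (simp add: power2_eq_square algebra_simps)
qed

lemma lam_irrational: "lam \<notin> \<rat>"
proof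
  assume "lam \<in> \<rat>"
  moreover have "algebraic_int lam"
  proof (rule algebraic_int.intros)
    show "poly [:- 2, - 1, 0, 1:] lam = 0"
      using lam_cubed by (simp add: power3_eq_cube algebra_simps)
    show "\<forall>i. coeff [:- 2, - 1, 0, 1:] i \<in> (\<int> :: real set)"
      by (auto simp: coeff_pCons split: nat.splits)
  qed simp
  ultimately have "lam \<in> \<int>" by (intro rational_algebraic_int_is_int)
  then obtain k :: int where "lam = of_int k" by (elim Ints_cases)
  with lam_bounds have "1 < k" "k < 2" by linarith+
  then show False by simp
qed

lemma int_eq_int_times_lam:
  fixes q r :: int
  assumes "of_int q = of_int r * lam"
  shows "q = 0 \<and> r = 0"
proof (cases "r = 0")
  case False
  then have "lam = of_int q / of_int r" using assms by (simp add: field_simps)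
  then have "lam \<in> \<rat>" by (metis Rats_divide Rats_of_int)
  with lam_irrational show ?thesis by blast
qed (use assms in auto)

definition mu :: complex where
  "mu = Complex (- lam / 2) (sqrt (3 * lam\<^sup>2 - 4) / 2)"

lemma Re_mu: "Re mu = - lam / 2" and Im_mu_pos: "0 < Im mu"
  using lam_sq_gt by (auto simp: mu_def)

lemma cmod_mu_sq: "(cmod mu)\<^sup>2 = lam\<^sup>2 - 1"
  using lam_sq_gt by (simp add: cmod_power2 mu_def power_divide field_simps)

lemma mu_cubed: "mu ^ 3 = mu + 2"
proof -
  define L where "L = complex_of_real lam"
  have "(Im mu)\<^sup>2 = (3 * lam\<^sup>2 - 4) / 4"
    using lam_sq_gt by (simp add: mu_def power_divide)
  then have "mu\<^sup>2 + L * mu + (L\<^sup>2 - 1) = 0"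
    by (simp add: L_def complex_eq_iff Re_mu power2_eq_square field_simps)
  moreover have "L ^ 3 = L + 2"
    unfolding L_def of_real_power[symmetric] lam_cubed by simp
  moreover have "mu ^ 3 - mu - 2 = (mu - L) * (mu\<^sup>2 + L * mu + (L\<^sup>2 - 1)) + (L ^ 3 - L - 2)"
    by (simp add: algebra_simps power2_eq_square power3_eq_cube)
  ultimately show ?thesis by (simp add: algebra_simps)
qed

lemma Im_mu_quadratic:
  "Im (of_int p + of_int q * mu + of_int r * mu\<^sup>2) = Im mu * (of_int q - of_int r * lam)"
  by (simp add: power2_eq_square Re_mu algebra_simps)

lemma mu_quadratic_real_iff:
  "Im (of_int p + of_int q * mu + of_int r * mu\<^sup>2) = 0 \<longleftrightarrow> q = 0 \<and> r = 0"
  unfolding Im_mu_quadratic using Im_mu_pos int_eq_int_times_lam[of q r] by auto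

lemma mu_quadratic_eq_0_iff:
  "of_int p + of_int q * mu + of_int r * mu\<^sup>2 = 0 \<longleftrightarrow> p = 0 \<and> q = 0 \<and> r = 0"
proof
  assume zero: "of_int p + of_int q * mu + of_int r * mu\<^sup>2 = 0"
  then have "q = 0 \<and> r = 0" using mu_quadratic_real_iff[of p q r] by simp
  with zero show "p = 0 \<and> q = 0 \<and> r = 0" by simp
qed simp

lemma cubic_root_power_expansion:
  obtains a b c :: int
  where "\<And>x::'a::comm_ring_1. x ^ 3 = x + 2 \<Longrightarrow> x ^ m = of_int a + of_int b * x + of_int c * x\<^sup>2"
proof -
  have "\<exists>a b c :: int. \<forall>x::'a. x ^ 3 = x + 2 \<longrightarrow> x ^ m = of_int a + of_int b * x + of_int c * x\<^sup>2"
  proof (induction m)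
    case 0
    show ?case by (intro exI[of _ 1] exI[of _ 0]) simp
  next
    case (Suc m)
    then obtain a b c :: int
      where IH: "\<And>x::'a. x ^ 3 = x + 2 \<Longrightarrow> x ^ m = of_int a + of_int b * x + of_int c * x\<^sup>2" by blast
    have "x ^ Suc m = of_int (2 * c) + of_int (a + c) * x + of_int b * x\<^sup>2" if "x ^ 3 = x + 2"
      for x :: 'a
    proof -
      have "x ^ Suc m = of_int a * x + of_int b * x\<^sup>2 + of_int c * x ^ 3"
        by (simp add: IH[OF that] algebra_simps power2_eq_square power3_eq_cube)
      then show ?thesis unfolding that by (simp add: algebra_simps)
    qed
    then show ?case by blast
  qed
  then show ?thesis using that by blast
qed

text \<open>If a power of \<open>mu\<close> were real, it would be an integer, hence equal to the same power of the
  conjugate root \<open>lam\<close>, which has larger modulus.\<close>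

lemma mu_power_not_real:
  assumes "0 < m"
  shows "Im (mu ^ m) \<noteq> 0"
proof
  assume real: "Im (mu ^ m) = 0"
  obtain a b c :: int where expansion:
    "\<And>x::complex. x ^ 3 = x + 2 \<Longrightarrow> x ^ m = of_int a + of_int b * x + of_int c * x\<^sup>2"
    using cubic_root_power_expansion[where 'a = complex] by blast
  have "b = 0 \<and> c = 0"
    using real unfolding expansion[OF mu_cubed] mu_quadratic_real_iff .
  moreover have "complex_of_real lam ^ 3 = of_real lam + 2"
    by (metis lam_cubed of_real_add of_real_numeral of_real_power)
  ultimately have "mu ^ m = of_real lam ^ m"
    using expansion[OF mu_cubed] expansion[of "of_real lam"] by simp
  then have "cmod mu ^ m = lam ^ m"
    using lam_bounds(1) by (metis abs_of_nonneg norm_of_real norm_power le_less less_trans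
        zero_less_divide_iff zero_less_numeral)
  moreover have "cmod mu < lam"
    by (rule power2_less_imp_less) (use cmod_mu_sq lam_bounds in auto)
  then have "cmod mu ^ m < lam ^ m" using assms by (intro power_strict_mono) auto
  ultimately show False by simp
qed


section \<open>Lines through the origin of the complex plane\<close>

definition side :: "real \<Rightarrow> complex \<Rightarrow> real" where
  "side s z = Re z - s * Im z"

lemma side_0 [simp]: "side s 0 = 0"
  by (simp add: side_def)

lemma side_add: "side s (a + b) = side s a + side s b"
  by (simp add: side_def algebra_simps)

lemma side_of_real_mult: "side s (of_real c * z) = c * side s z"
  by (simp add: side_def algebra_simps)

lemma abs_side_le: "\<bar>side s z\<bar> \<le> (1 + \<bar>s\<bar>) * cmod z"
proof -
  have "\<bar>side s z\<bar> \<le> \<bar>Re z\<bar> + \<bar>s\<bar> * \<bar>Im z\<bar>"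
    unfolding side_def by (metis abs_mult abs_triangle_ineq4)
  also have "\<dots> \<le> cmod z + \<bar>s\<bar> * cmod z"
    by (intro add_mono mult_left_mono abs_Re_le_cmod abs_Im_le_cmod) auto
  finally show ?thesis by (simp add: algebra_simps)
qed

lemma power_eq_cis: "z ^ n = of_real (cmod z ^ n) * cis (real n * Arg z)"
proof -
  have "z ^ n = (of_real (cmod z) * cis (Arg z)) ^ n"
    using rcis_cmod_Arg[of z] by (simp add: rcis_def)
  also have "\<dots> = of_real (cmod z ^ n) * cis (real n * Arg z)"
    by (simp add: power_mult_distrib Complex.DeMoivre)
  finally show ?thesis .
qed

lemma Arg_irrational_if_powers_not_real:
  assumes "\<And>m. 0 < m \<Longrightarrow> Im (z ^ m) \<noteq> 0"
  shows "Arg z / (2 * pi) \<notin> \<rat>"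
proof
  assume "Arg z / (2 * pi) \<in> \<rat>"
  then obtain p :: int and q :: nat where "0 < q" "Arg z / (2 * pi) = of_int p / of_nat q"
    by (rule Rats_cases') (metis of_int_of_nat_eq zero_less_imp_eq_int)
  then have "real q * Arg z = 2 * pi * of_int p" by (simp add: field_simps)
  then have "Im (z ^ q) = 0" unfolding power_eq_cis by simp
  with assms \<open>0 < q\<close> show False by blast
qed

lemma cis_multiples_dense:
  assumes irrational: "\<theta> / (2 * pi) \<notin> \<rat>" and "open W" "cis \<phi> \<in> W"
  obtains n where "cis (real n * \<theta>) \<in> W"
proof -
  have "isCont cis \<phi>"
    using continuous_on_cis[OF continuous_on_id, of UNIV]
    by (simp add: continuous_on_eq_continuous_at)
  then have "\<forall>\<^sub>F x in at \<phi>. cis x \<in> W"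
    using assms(2,3) by (auto simp: isCont_def dest: topological_tendstoD)
  then have "\<forall>\<^sub>F x in nhds \<phi>. cis x \<in> W"
    using assms(3) by (simp add: eventually_nhds_conv_at)
  then obtain d where cis_near: "0 < d" "\<And>x. dist x \<phi> < d \<Longrightarrow> cis x \<in> W"
    unfolding eventually_nhds_metric by blast
  have "0 < d / (2 * pi)" using cis_near(1) by simp
  then obtain h k :: int
    where approx: "0 < k" "\<bar>of_int k * (\<theta> / (2 * pi)) - of_int h - \<phi> / (2 * pi)\<bar> < d / (2 * pi)"
    using sequence_of_fractional_parts_is_dense[OF irrational] by metis
  define x where "x = of_int k * \<theta> - of_int h * (2 * pi)"
  define y where "y = of_int k * (\<theta> / (2 * pi)) - of_int h - \<phi> / (2 * pi)"
  have "x - \<phi> = 2 * pi * y" by (simp add: x_def y_def field_simps)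
  moreover have "2 * pi * \<bar>y\<bar> < d"
    using approx(2) unfolding y_def[symmetric] by (simp add: pos_less_divide_eq mult.commute)
  ultimately have "cis x \<in> W"
    by (intro cis_near(2)) (simp add: dist_real_def abs_mult)
  moreover have "cis x = cis (real (nat k) * \<theta>)"
    using approx(1)
    by (simp add: x_def complex_eq_iff cos_diff sin_diff mult.commute[of _ "2 * pi"])
  ultimately show ?thesis using that by metis
qed

lemma powers_separate_lines:
  assumes "\<And>m. 0 < m \<Longrightarrow> Im (z ^ m) \<noteq> 0" "s < s'"
  obtains n where "side s (z ^ n) * side s' (z ^ n) < 0"
proof -
  define W where "W = {w. side s w * side s' w < 0}"
  have scale: "of_real c * w \<in> W \<longleftrightarrow> w \<in> W" if "c > 0" for c w
    using that unfolding W_def mem_Collect_eq side_of_real_mult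
    by (auto simp: mult_less_0_iff zero_less_mult_iff)
  have "open W"
    unfolding W_def side_def by (intro open_Collect_less continuous_intros)
  define w where "w = Complex ((s + s') / 2) 1"
  have "side s w * side s' w = - (((s' - s) / 2)\<^sup>2)"
    by (simp add: w_def side_def power2_eq_square field_simps)
  then have "w \<in> W" using \<open>s < s'\<close> by (simp add: W_def)
  moreover have "w = of_real (cmod w) * cis (Arg w)"
    using rcis_cmod_Arg[of w] by (simp add: rcis_def)
  moreover have "0 < cmod w" by (auto simp: w_def complex_eq_iff)
  ultimately have "cis (Arg w) \<in> W" using scale by metis
  then obtain n where "cis (real n * Arg z) \<in> W"
    using cis_multiples_dense[OF Arg_irrational_if_powers_not_real[OF assms(1)] \<open>open W\<close>] by blast
  moreover have "z \<noteq> 0" using assms(1)[of 1] by auto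
  ultimately have "z ^ n \<in> W" unfolding power_eq_cis[of z n] by (subst scale) auto
  then show ?thesis using that by (simp add: W_def)
qed


section \<open>The cone of weights\<close>

text \<open>The weight of \<open>x\<^sup>A y\<^sup>B\<close> is read off the pair \<open>(A, B)\<close>; the matrix entry of an endomorphism that
  maps \<open>x\<^sup>T\<close> to \<open>x\<^sup>S\<close> is weighted like \<open>(S, T)\<close>.\<close>

definition exponent :: "nat set \<times> nat set \<Rightarrow> nat \<Rightarrow> int" where
  "exponent m i = of_bool (i \<in> snd m) - of_bool (i \<in> fst m)"

definition power_weight :: "'a::comm_ring_1 \<Rightarrow> nat set \<times> nat set \<Rightarrow> 'a" where
  "power_weight x m = (\<Sum>i\<in>snd m. x ^ i) - (\<Sum>i\<in>fst m. x ^ i)"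

definition weight :: "nat set \<times> nat set \<Rightarrow> complex \<times> real" where
  "weight m = (power_weight mu m, power_weight lam m)"

lemma weight_empty [simp]: "weight ({}, {}) = 0"
  by (simp add: weight_def power_weight_def zero_prod_def)

lemma power_weight_eq_sum_exponent:
  fixes x :: "'a::comm_ring_1"
  assumes "fst m \<union> snd m \<subseteq> {..<J}"
  shows "power_weight x m = (\<Sum>i<J. of_int (exponent m i) * x ^ i)"
proof -
  have indicator: "(\<Sum>i\<in>C. x ^ i) = (\<Sum>i<J. of_int (of_bool (i \<in> C)) * x ^ i)" if "C \<subseteq> {..<J}" for C
    by (rule sum.mono_neutral_cong_left) (use that in auto)
  have "power_weight x m = (\<Sum>i<J. of_int (of_bool (i \<in> snd m)) * x ^ i)
      - (\<Sum>i<J. of_int (of_bool (i \<in> fst m)) * x ^ i)"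
    unfolding power_weight_def using assms by (subst (1 2) indicator) auto
  also have "\<dots> = (\<Sum>i<J. of_int (exponent m i) * x ^ i)"
    by (simp only: sum_subtractf[symmetric] exponent_def of_int_diff left_diff_distrib)
  finally show ?thesis .
qed

lemma power_weight_add:
  fixes x :: "'a::comm_ring_1"
  assumes "finite (fst s \<union> snd s)" "finite (fst u \<union> snd u)" "finite (fst t \<union> snd t)"
    and "\<And>i. exponent t i = exponent s i + exponent u i"
  shows "power_weight x t = power_weight x s + power_weight x u"
proof -
  have "finite ((fst s \<union> snd s) \<union> (fst u \<union> snd u) \<union> (fst t \<union> snd t))"
    using assms(1-3) by blast
  then obtain J where "(fst s \<union> snd s) \<union> (fst u \<union> snd u) \<union> (fst t \<union> snd t) \<subseteq> {..<J}"
    using finite_nat_iff_bounded by blast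
  then have "fst s \<union> snd s \<subseteq> {..<J}" "fst u \<union> snd u \<subseteq> {..<J}" "fst t \<union> snd t \<subseteq> {..<J}"
    by simp_all
  then show ?thesis
    by (simp add: power_weight_eq_sum_exponent assms(4) distrib_right sum.distrib)
qed

text \<open>Expand a product of generators by \<open>v\<^sub>i = \<partial>\<^sub>i + x\<^sub>i x\<^sub>i\<^sub>+\<^sub>1 v\<^sub>i\<^sub>+\<^sub>3\<close> and let \<open>n i\<close> be the number
  of times \<open>v\<^sub>i\<close> is met. Then \<open>x\<^sub>i\<close> is removed \<open>n i - n (i + 3)\<close> times and created
  \<open>n (i + 3) + n (i + 2)\<close> times, whatever the order of the factors. (At \<open>i = 0\<close> there is no \<open>v\<^sub>-\<^sub>1\<close>,
  so \<open>n 0\<close> exceeds the count by \<open>n 2\<close>.)\<close>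

definition unfolding_counts :: "nat set \<times> nat set \<Rightarrow> (nat \<Rightarrow> nat) \<Rightarrow> bool" where
  "unfolding_counts m n \<longleftrightarrow> (\<exists>N. \<forall>i\<ge>N. n i = 0)
     \<and> (\<forall>i. int (n i) = 2 * int (n (i + 3)) + int (n (i + 2)) + exponent m i)"

definition weight_cone :: "(nat set \<times> nat set) set" where
  "weight_cone = {m. finite (fst m) \<and> finite (snd m) \<and> (\<exists>n. unfolding_counts m n)}"

lemma unfolding_counts_add:
  assumes "unfolding_counts s n" "unfolding_counts u n'"
    and "\<And>i. exponent t i = exponent s i + exponent u i"
  shows "unfolding_counts t (\<lambda>i. n i + n' i)"
  unfolding unfolding_counts_def
proof (intro conjI allI)
  obtain N N' where "\<forall>i\<ge>N. n i = 0" "\<forall>i\<ge>N'. n' i = 0"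
    using assms(1,2) unfolding unfolding_counts_def by blast
  then show "\<exists>N. \<forall>i\<ge>N. n i + n' i = 0" by (intro exI[of _ "max N N'"]) auto
  fix i
  have "int (n i) = 2 * int (n (i + 3)) + int (n (i + 2)) + exponent s i"
    "int (n' i) = 2 * int (n' (i + 3)) + int (n' (i + 2)) + exponent u i"
    using assms(1,2) unfolding unfolding_counts_def by blast+
  then show "int (n i + n' i)
      = 2 * int (n (i + 3) + n' (i + 3)) + int (n (i + 2) + n' (i + 2)) + exponent t i"
    by (simp add: assms(3))
qed

lemma empty_in_weight_cone: "({}, {}) \<in> weight_cone"
proof -
  have "unfolding_counts ({}, {}) (\<lambda>_. 0)" by (simp add: unfolding_counts_def exponent_def)
  then show ?thesis by (auto simp: weight_cone_def)
qed

lemma weight_cone_add: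
  assumes "s \<in> weight_cone" "u \<in> weight_cone" "finite (fst t)" "finite (snd t)"
    and "\<And>i. exponent t i = exponent s i + exponent u i"
  shows "t \<in> weight_cone" and "weight t = weight s + weight u"
proof -
  show "t \<in> weight_cone"
    using assms unfolding_counts_add[OF _ _ assms(5)] unfolding weight_cone_def by blast
  show "weight t = weight s + weight u"
    using assms(1-4) power_weight_add[OF _ _ _ assms(5), where x = mu]
      power_weight_add[OF _ _ _ assms(5), where x = lam]
    by (simp add: weight_def weight_cone_def)
qed

lemma weight_coneI_counts_from:
  assumes "finite (fst m)" "finite (snd m)"
    and "\<forall>i\<ge>N. n i = 0"
    and "\<forall>i\<ge>j. int (n i) = 2 * int (n (i + 3)) + int (n (i + 2)) + exponent m i"
    and "\<forall>i<j. exponent m i = 0"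
  shows "m \<in> weight_cone"
  using assms(3-5)
proof (induction j arbitrary: n N)
  case 0
  then have "unfolding_counts m n" unfolding unfolding_counts_def by blast
  then show ?case using assms(1,2) unfolding weight_cone_def by blast
next
  case (Suc j)
  define n' where "n' = n(j := 2 * n (j + 3) + n (j + 2))"
  show ?case
  proof (rule Suc.IH)
    show "\<forall>i\<ge>max N (Suc j). n' i = 0" using Suc.prems(1) by (simp add: n'_def)
    show "\<forall>i\<ge>j. int (n' i) = 2 * int (n' (i + 3)) + int (n' (i + 2)) + exponent m i"
    proof (intro allI impI)
      fix i assume "j \<le> i"
      then show "int (n' i) = 2 * int (n' (i + 3)) + int (n' (i + 2)) + exponent m i"
        using mp[OF spec[OF Suc.prems(2)], of i] Suc.prems(3)
        by (cases "i = j") (simp_all add: n'_def)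
    qed
    show "\<forall>i<j. exponent m i = 0" using Suc.prems(3) by simp
  qed
qed

definition tail_weight :: "'a::comm_ring_1 \<Rightarrow> (nat \<Rightarrow> nat) \<Rightarrow> nat \<Rightarrow> 'a" where
  "tail_weight x n j = of_nat (n j) + x * of_nat (n (j + 1)) + (x\<^sup>2 - 1) * of_nat (n (j + 2))"

lemma tail_weight_step:
  fixes x :: "'a::comm_ring_1"
  assumes "x ^ 3 = x + 2" "unfolding_counts m n"
  shows "tail_weight x n j = of_int (exponent m j) + x * tail_weight x n (j + 1)"
proof -
  have "int (n j) = 2 * int (n (j + 3)) + int (n (j + 2)) + exponent m j"
    using assms(2) unfolding unfolding_counts_def by blast
  from arg_cong[OF this, of "of_int :: int \<Rightarrow> 'a"]
  have recurrence: "of_nat (n j)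
      = 2 * of_nat (n (j + 3)) + of_nat (n (j + 2)) + (of_int (exponent m j) :: 'a)"
    by simp
  have shift: "j + 1 + 1 = j + 2" "j + 1 + 2 = j + 3" by simp_all
  have "x * tail_weight x n (j + 1)
      = x * of_nat (n (j + 1)) + x\<^sup>2 * of_nat (n (j + 2)) + (x ^ 3 - x) * of_nat (n (j + 3))"
    unfolding tail_weight_def shift by (simp add: algebra_simps power2_eq_square power3_eq_cube)
  also have "x ^ 3 - x = 2" using assms(1) by simp
  finally show ?thesis unfolding tail_weight_def recurrence by (simp add: algebra_simps)
qed

lemma power_weight_eq_tail_weight:
  fixes x :: "'a::comm_ring_1"
  assumes "x ^ 3 = x + 2" "unfolding_counts m n" "finite (fst m)" "finite (snd m)"
  shows "power_weight x m = tail_weight x n 0"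
proof -
  obtain N where counts_zero: "\<forall>i\<ge>N. n i = 0" using assms(2) unfolding unfolding_counts_def by blast
  have "finite (fst m \<union> snd m)" using assms(3,4) by simp
  then obtain M where bounded: "fst m \<union> snd m \<subseteq> {..<M}"
    using finite_nat_iff_bounded by blast
  define J where "J = max N M"
  have "tail_weight x n 0 = (\<Sum>i<J. of_int (exponent m i) * x ^ i) + x ^ J * tail_weight x n J" for J
  proof (induction J)
    case (Suc J)
    then show ?case
      by (simp add: tail_weight_step[OF assms(1,2), of J] algebra_simps)
  qed simp
  moreover have "tail_weight x n J = 0" using counts_zero by (simp add: tail_weight_def J_def)
  moreover have "power_weight x m = (\<Sum>i<J. of_int (exponent m i) * x ^ i)"
    by (rule power_weight_eq_sum_exponent) (use bounded J_def in auto)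
  ultimately show ?thesis by (metis add.right_neutral mult_zero_right)
qed

lemma weight_coneE:
  assumes "m \<in> weight_cone"
  obtains n where "unfolding_counts m n" "weight m = (tail_weight mu n 0, tail_weight lam n 0)"
proof -
  obtain n where "unfolding_counts m n" and finite: "finite (fst m)" "finite (snd m)"
    using assms unfolding weight_cone_def by blast
  then show ?thesis
    using that power_weight_eq_tail_weight[OF mu_cubed _ finite]
      power_weight_eq_tail_weight[OF lam_cubed _ finite] by (simp add: weight_def)
qed

lemma tail_weight_lam_nonneg: "0 \<le> tail_weight lam n j"
  using lam_bounds lam_sq_gt unfolding tail_weight_def
  by (intro add_nonneg_nonneg mult_nonneg_nonneg) auto

lemma cmod_mu_le: "cmod mu \<le> 2 * lam"
proof (rule power2_le_imp_le)
  show "(cmod mu)\<^sup>2 \<le> (2 * lam)\<^sup>2"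
    using lam_sq_gt by (simp add: cmod_mu_sq power_mult_distrib)
qed (use lam_bounds in simp)

lemma cmod_mu_sq_minus_1_le: "cmod (mu\<^sup>2 - 1) \<le> 2 * (lam\<^sup>2 - 1)"
proof -
  have "cmod (mu\<^sup>2 - 1) \<le> (cmod mu)\<^sup>2 + 1"
    by (metis norm_one norm_power norm_triangle_ineq4)
  then show ?thesis unfolding cmod_mu_sq using lam_sq_gt by simp
qed

lemma cmod_tail_weight_mu_le: "cmod (tail_weight mu n j) \<le> 2 * tail_weight lam n j"
proof -
  have "cmod (tail_weight mu n j)
      \<le> real (n j) + cmod mu * real (n (j + 1)) + cmod (mu\<^sup>2 - 1) * real (n (j + 2))"
    using norm_triangle_ineq[of "of_nat (n j) + mu * of_nat (n (j + 1))"
        "(mu\<^sup>2 - 1) * of_nat (n (j + 2))"]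
      norm_triangle_ineq[of "of_nat (n j) :: complex" "mu * of_nat (n (j + 1))"]
    unfolding tail_weight_def by (simp only: norm_mult norm_of_nat)
  also have "\<dots> \<le> 2 * real (n j) + (2 * lam) * real (n (j + 1))
      + (2 * (lam\<^sup>2 - 1)) * real (n (j + 2))"
    by (intro add_mono mult_right_mono cmod_mu_le cmod_mu_sq_minus_1_le) auto
  also have "\<dots> = 2 * tail_weight lam n j" by (simp add: tail_weight_def algebra_simps)
  finally show ?thesis .
qed

text \<open>Each step of the recursion contracts by the factor \<open>|mu|\<^sup>2 / lam < 1\<close>, which absorbs the error
  terms once \<open>r\<close> is large; for small \<open>r\<close> the linear bound is enough.\<close>

lemma paraboloid_step:
  fixes y z r r' :: real
  assumes z_bounds: "0 \<le> z" "z \<le> cmod mu * y + 1" "z \<le> 2 * r" and y_bounds: "0 \<le> y" "y\<^sup>2 \<le> 130 * r'"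
    and r_bounds: "lam * r' \<le> r + 1" "0 \<le> r"
  shows "z\<^sup>2 \<le> 130 * r"
proof (cases "r \<le> 30")
  case True
  have "z\<^sup>2 \<le> (2 * r)\<^sup>2" using z_bounds by (intro power_mono) auto
  also have "\<dots> = (4 * r) * r" by (simp add: power2_eq_square)
  also have "\<dots> \<le> (4 * r) * 30" using True r_bounds by (intro mult_left_mono) auto
  also have "\<dots> \<le> 130 * r" using r_bounds by simp
  finally show ?thesis .
next
  case False
  define a where "a = cmod mu * y"
  have "0 \<le> r'" using y_bounds(2) zero_le_power2[of y] by linarith
  have "a\<^sup>2 = (lam\<^sup>2 - 1) * y\<^sup>2" by (simp add: a_def power_mult_distrib cmod_mu_sq)
  also have "\<dots> \<le> (877/1000 * lam) * (130 * r')"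
    using lam_sq_gt lam_sq_less y_bounds \<open>0 \<le> r'\<close> by (intro mult_mono) auto
  also have "\<dots> = 877/1000 * 130 * (lam * r')" by simp
  also have "\<dots> \<le> 877/1000 * 130 * (r + 1)" using r_bounds by (intro mult_left_mono) auto
  finally have a_sq_le: "a\<^sup>2 \<le> 877/1000 * 130 * (r + 1)" .
  have "z\<^sup>2 \<le> (a + 1)\<^sup>2" using z_bounds(1,2) by (intro power_mono) (auto simp: a_def)
  also have "\<dots> \<le> 11/10 * a\<^sup>2 + 11"
    using zero_le_power2[of "a / 10 - 1"] by (simp add: power2_eq_square algebra_simps)
  also have "\<dots> \<le> 130 * r" using a_sq_le False by simp
  finally show ?thesis .
qed

definition paraboloid :: "(complex \<times> real) set" where
  "paraboloid = {(z, r). (cmod z)\<^sup>2 \<le> 130 * r}"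

lemma paraboloid_nonneg:
  assumes "w \<in> paraboloid"
  shows "0 \<le> snd w"
proof -
  have "0 \<le> (cmod (fst w))\<^sup>2" by simp
  also have "\<dots> \<le> 130 * snd w" using assms by (auto simp: paraboloid_def)
  finally show ?thesis by simp
qed

lemma zero_in_paraboloid: "0 \<in> paraboloid"
  by (simp add: paraboloid_def zero_prod_def)

lemma tail_weight_in_paraboloid:
  assumes counts: "unfolding_counts m n"
  shows "(tail_weight mu n 0, tail_weight lam n 0) \<in> paraboloid"
proof -
  obtain N where counts_zero: "\<forall>i\<ge>N. n i = 0" using counts unfolding unfolding_counts_def by blast
  have "0 \<le> N" by simp
  then have "(cmod (tail_weight mu n 0))\<^sup>2 \<le> 130 * tail_weight lam n 0"
  proof (induction rule: inc_induct)
    case base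
    show ?case using counts_zero by (simp add: tail_weight_def)
  next
    case (step j)
    have exponent_le: "\<bar>exponent m j\<bar> \<le> 1" by (simp add: exponent_def)
    have "cmod (tail_weight mu n j)
        \<le> cmod (of_int (exponent m j)) + cmod mu * cmod (tail_weight mu n (Suc j))"
      unfolding tail_weight_step[OF mu_cubed counts, of j]
      by (metis Suc_eq_plus1 norm_mult norm_triangle_ineq)
    moreover have "cmod (of_int (exponent m j)) \<le> 1" using exponent_le by simp
    ultimately have mu_step:
      "cmod (tail_weight mu n j) \<le> cmod mu * cmod (tail_weight mu n (Suc j)) + 1"
      by linarith
    have "\<bar>real_of_int (exponent m j)\<bar> \<le> 1" using exponent_le by linarith
    then have lam_step: "lam * tail_weight lam n (Suc j) \<le> tail_weight lam n j + 1"
      using tail_weight_step[OF lam_cubed counts, of j] by simp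
    show ?case
      by (rule paraboloid_step[OF norm_ge_zero mu_step cmod_tail_weight_mu_le norm_ge_zero
            step.IH lam_step tail_weight_lam_nonneg])
  qed
  then show ?thesis by (simp add: paraboloid_def)
qed

lemma weight_cone_paraboloid: "m \<in> weight_cone \<Longrightarrow> weight m \<in> paraboloid"
  by (metis weight_coneE tail_weight_in_paraboloid)

definition mu_lattice :: "complex set" where
  "mu_lattice = range (\<lambda>(p :: int, q :: int, r :: int). of_int p + of_int q * mu + of_int r * mu\<^sup>2)"

lemma countable_mu_lattice: "countable mu_lattice"
  unfolding mu_lattice_def by (intro countable_image countableI_type)

lemma weight_cone_mu_lattice:
  assumes "m \<in> weight_cone"
  shows "fst (weight m) \<in> mu_lattice" and "fst (weight m) = 0 \<Longrightarrow> snd (weight m) = 0"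
proof -
  obtain n where weight_eq: "weight m = (tail_weight mu n 0, tail_weight lam n 0)"
    using assms by (rule weight_coneE)
  have fst_weight_eq: "fst (weight m)
      = of_int (int (n 0) - int (n 2)) + of_int (int (n 1)) * mu + of_int (int (n 2)) * mu\<^sup>2"
    by (simp add: weight_eq tail_weight_def algebra_simps numeral_2_eq_2[symmetric])
  then show "fst (weight m) \<in> mu_lattice" unfolding mu_lattice_def
    by (intro image_eqI[where x = "(int (n 0) - int (n 2), int (n 1), int (n 2))"]) simp_all
  assume "fst (weight m) = 0"
  then have "n 0 = 0" "n 1 = 0" "n 2 = 0" unfolding fst_weight_eq mu_quadratic_eq_0_iff by simp_all
  then show "snd (weight m) = 0" by (simp add: weight_eq tail_weight_def numeral_2_eq_2[symmetric])
qed

definition positive_cone :: "(nat set \<times> nat set) set" where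
  "positive_cone = {m \<in> weight_cone. 0 < snd (weight m)}"

lemma positive_coneD:
  assumes "m \<in> positive_cone"
  shows "finite (fst m)" "finite (snd m)" "m \<in> weight_cone" "0 < snd (weight m)" "m \<noteq> ({}, {})"
  using assms by (auto simp: positive_cone_def weight_cone_def)

lemma positive_cone_add:
  assumes "s \<in> positive_cone" "u \<in> positive_cone" "finite (fst t)" "finite (snd t)"
    and "\<And>i. exponent t i = exponent s i + exponent u i"
  shows "t \<in> positive_cone" and "weight t = weight s + weight u"
  using assms(1,2) weight_cone_add[OF _ _ assms(3-5)] by (auto simp: positive_cone_def)

definition generic_slopes :: "real set" where
  "generic_slopes = - ((\<lambda>z. Re z / Im z) ` mu_lattice)"

lemma generic_slope_side_nonzero:
  assumes "s \<in> generic_slopes" "z \<in> mu_lattice" "z \<noteq> 0"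
  shows "side s z \<noteq> 0"
proof
  assume zero: "side s z = 0"
  show False
  proof (cases "Im z = 0")
    case False
    then have "s = Re z / Im z" using zero by (simp add: side_def field_simps)
    with assms(1,2) show ?thesis unfolding generic_slopes_def by blast
  qed (use zero assms(3) in \<open>simp add: side_def complex_eq_iff\<close>)
qed

lemma positive_cone_side_nonzero:
  assumes "m \<in> positive_cone" "s \<in> generic_slopes"
  shows "side s (fst (weight m)) \<noteq> 0"
  using generic_slope_side_nonzero[OF assms(2)] weight_cone_mu_lattice[of m] assms(1)
  by (auto simp: positive_cone_def)

lemma lepoll_Diff_countable:
  assumes "uncountable A" "countable C"
  shows "A \<lesssim> A - C"
proof -
  have "infinite A" using assms(1) countable_finite by metis
  then have "(card_of (A \<times> A), card_of A) \<in> ordIso" by (rule card_of_Times_same_infinite)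
  then obtain g where bij: "bij_betw g (A \<times> A) A" unfolding card_of_ordIso[symmetric] ..
  define D where "D = {p \<in> A \<times> A. g p \<in> C}"
  have "inj_on g D" by (rule inj_on_subset[OF bij_betw_imp_inj_on[OF bij]]) (auto simp: D_def)
  moreover have "countable (g ` D)"
    by (rule countable_subset[OF _ assms(2)]) (auto simp: D_def)
  ultimately have "countable D" by (rule countable_image_inj_on[rotated])
  then have "countable (fst ` D)" by simp
  then have "\<not> A \<subseteq> fst ` D" using assms(1) countable_subset by blast
  then obtain a where a_notin: "a \<in> A" "a \<notin> fst ` D" by blast
  have "inj_on (\<lambda>b. g (a, b)) A"
  proof (rule inj_onI)
    fix b c assume "b \<in> A" "c \<in> A" "g (a, b) = g (a, c)"
    then have "(a, b) = (a, c)" using inj_onD[OF bij_betw_imp_inj_on[OF bij]] a_notin(1) by blast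
    then show "b = c" by simp
  qed
  moreover have "g (a, b) \<in> A - C" if "b \<in> A" for b
  proof
    show "g (a, b) \<in> A" using bij_betw_apply[OF bij] a_notin(1) that by blast
    show "g (a, b) \<notin> C"
    proof
      assume "g (a, b) \<in> C"
      then have "(a, b) \<in> D" using a_notin(1) that by (simp add: D_def)
      then show False using a_notin(2) by force
    qed
  qed
  then have "(\<lambda>b. g (a, b)) ` A \<subseteq> A - C" by blast
  ultimately show ?thesis unfolding lepoll_def by blast
qed

lemma reals_lepoll_generic_slopes: "(UNIV :: real set) \<lesssim> generic_slopes"
  using lepoll_Diff_countable[OF uncountable_UNIV_real countable_image[OF countable_mu_lattice]]
  by (simp add: generic_slopes_def Compl_eq_Diff_UNIV)


section \<open>Supports and subalgebras\<close>

lemma vadd_z0 [simp]: "vadd a z0 = a" "vadd z0 a = a"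
  by (auto simp: vadd_def z0_def)

lemma vsub_conv_vadd: "vsub a b = vadd a (vsc (- 1) b)"
  by (simp add: vsub_def vadd_def vsc_def)

definition supp :: "('i \<Rightarrow> 'k::zero) \<Rightarrow> 'i set" where
  "supp a = {t. a t \<noteq> 0}"

lemma in_supp_iff: "t \<in> supp a \<longleftrightarrow> a t \<noteq> 0"
  by (simp add: supp_def)

lemma supp_z0 [simp]: "supp z0 = {}"
  by (simp add: supp_def z0_def)

lemma supp_eq_empty_iff [simp]: "supp a = {} \<longleftrightarrow> a = z0"
  by (auto simp: supp_def z0_def)

lemma supp_vadd: "supp (vadd a b) \<subseteq> supp a \<union> supp b"
  by (auto simp: supp_def vadd_def)

lemma in_supp_vaddD: "t \<in> supp (vadd a b) \<Longrightarrow> t \<in> supp a \<or> t \<in> supp b"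
  by (auto simp: supp_def vadd_def)

lemma supp_vsc: "supp (vsc c a) \<subseteq> supp a"
  by (auto simp: supp_def vsc_def)

lemma supp_vsub: "supp (vsub a b) \<subseteq> supp a \<union> supp b"
  by (auto simp: supp_def vsub_def)

definition proj :: "'i set \<Rightarrow> ('i \<Rightarrow> 'k::zero) \<Rightarrow> 'i \<Rightarrow> 'k" where
  "proj I a = (\<lambda>t. if t \<in> I then a t else 0)"

lemma supp_proj: "supp (proj I a) = supp a \<inter> I"
  by (auto simp: supp_def proj_def)

lemma proj_vadd: "proj I (vadd a b) = vadd (proj I a) (proj I b)"
  by (auto simp: proj_def vadd_def)

lemma proj_cong: "(\<And>t. t \<in> supp a \<Longrightarrow> t \<in> I \<longleftrightarrow> t \<in> J) \<Longrightarrow> proj I a = proj J a"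
  by (auto simp: proj_def in_supp_iff fun_eq_iff)

lemma proj_eq_self: "supp a \<subseteq> I \<Longrightarrow> proj I a = a"
  and proj_eq_z0: "supp a \<inter> I = {} \<Longrightarrow> proj I a = z0"
  by (auto simp: proj_def z0_def in_supp_iff fun_eq_iff disjoint_iff)

lemma is_subalgI:
  assumes "z0 \<in> S" "\<And>a b. a \<in> S \<Longrightarrow> b \<in> S \<Longrightarrow> vadd a b \<in> S" "\<And>c a. a \<in> S \<Longrightarrow> vsc c a \<in> S"
    and "\<And>a. a \<in> S \<Longrightarrow> pe a \<in> S" "\<And>f a b. f \<in> set ops \<Longrightarrow> a \<in> S \<Longrightarrow> b \<in> S \<Longrightarrow> f a b \<in> S"
    and "\<And>a. a \<in> S \<Longrightarrow> pe a = z0 \<Longrightarrow> sq a \<in> S"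
  shows "is_subalg pe ops sq S"
  using assms by (simp add: is_subalg_def lin_sub_def)

context
  fixes pe :: "('i \<Rightarrow> 'k::field) \<Rightarrow> 'i \<Rightarrow> 'k" and ops sq S
  assumes subalg: "is_subalg pe ops sq S"
begin

lemma is_subalg_z0: "z0 \<in> S"
  and is_subalg_vadd: "a \<in> S \<Longrightarrow> b \<in> S \<Longrightarrow> vadd a b \<in> S"
  and is_subalg_vsc: "a \<in> S \<Longrightarrow> vsc c a \<in> S"
  and is_subalg_pe: "a \<in> S \<Longrightarrow> pe a \<in> S"
  and is_subalg_op: "f \<in> set ops \<Longrightarrow> a \<in> S \<Longrightarrow> b \<in> S \<Longrightarrow> f a b \<in> S"
  and is_subalg_sq: "a \<in> S \<Longrightarrow> pe a = z0 \<Longrightarrow> sq a \<in> S"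
  using subalg by (simp_all add: is_subalg_def lin_sub_def)

lemma is_subalg_vsub: "a \<in> S \<Longrightarrow> b \<in> S \<Longrightarrow> vsub a b \<in> S"
  unfolding vsub_conv_vadd by (intro is_subalg_vadd is_subalg_vsc)

end

lemma is_subalg_generated: "is_subalg pe ops sq (generated pe ops sq X)"
  unfolding generated_def
  by (rule is_subalgI)
    (auto intro: is_subalg_z0 is_subalg_vadd is_subalg_vsc is_subalg_pe is_subalg_op is_subalg_sq)

lemma generated_superset: "X \<subseteq> generated pe ops sq X"
  by (auto simp: generated_def)

lemma generated_least: "is_subalg pe ops sq S \<Longrightarrow> X \<subseteq> S \<Longrightarrow> generated pe ops sq X \<subseteq> S"
  by (auto simp: generated_def)

definition product_supported ::
  "'i set \<Rightarrow> ('i \<Rightarrow> 'i \<Rightarrow> 'i \<Rightarrow> bool) \<Rightarrow> ('i \<Rightarrow> 'k::zero) \<Rightarrow> ('i \<Rightarrow> 'k) \<Rightarrow> ('i \<Rightarrow> 'k) \<Rightarrow> bool" where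
  "product_supported G R a b c \<longleftrightarrow> (supp a \<subseteq> G \<longrightarrow> supp b \<subseteq> G \<longrightarrow>
     (\<forall>t\<in>supp c. t \<in> G \<and> (\<exists>s\<in>supp a. \<exists>u\<in>supp b. R t s u)))"

definition operations_supported ::
  "'i set \<Rightarrow> ('i \<Rightarrow> 'i \<Rightarrow> 'i \<Rightarrow> bool) \<Rightarrow> (('i \<Rightarrow> 'k::field) \<Rightarrow> ('i \<Rightarrow> 'k) \<Rightarrow> 'i \<Rightarrow> 'k) list
    \<Rightarrow> (('i \<Rightarrow> 'k) \<Rightarrow> 'i \<Rightarrow> 'k) \<Rightarrow> bool" where
  "operations_supported G R ops sq \<longleftrightarrow>
     (\<forall>f\<in>set ops. \<forall>a b. product_supported G R a b (f a b)) \<and> (\<forall>a. product_supported G R a a (sq a))"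

lemma product_supportedI:
  assumes "\<And>t. supp a \<subseteq> G \<Longrightarrow> supp b \<subseteq> G \<Longrightarrow> t \<in> supp c
    \<Longrightarrow> t \<in> G \<and> (\<exists>s\<in>supp a. \<exists>u\<in>supp b. R t s u)"
  shows "product_supported G R a b c"
  using assms unfolding product_supported_def by blast

lemma product_supportedE:
  assumes "product_supported G R a b c" "supp a \<subseteq> G" "supp b \<subseteq> G" "t \<in> supp c"
  obtains s u where "t \<in> G" "s \<in> supp a" "u \<in> supp b" "R t s u"
  using assms unfolding product_supported_def by blast

lemma product_supported_in_carrier:
  assumes "product_supported G R a b c" "supp a \<subseteq> G" "supp b \<subseteq> G"
  shows "supp c \<subseteq> G"
  using assms unfolding product_supported_def by blast

lemma product_supported_z0: "product_supported G R a b z0"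
  by (simp add: product_supported_def)

lemma product_supported_mono:
  assumes "product_supported G R a b c" "\<And>t s u. R t s u \<Longrightarrow> R' t s u"
  shows "product_supported G R' a b c"
  using assms unfolding product_supported_def by blast

lemma product_supported_subset:
  assumes "product_supported G R a b c" "supp a \<subseteq> supp a'" "supp b \<subseteq> supp b'"
  shows "product_supported G R a' b' c"
  using assms unfolding product_supported_def by blast

lemma product_supported_swap:
  assumes "product_supported G R b a c" "\<And>t s u. R t s u \<Longrightarrow> R t u s"
  shows "product_supported G R a b c"
  using assms unfolding product_supported_def by blast

lemma product_supported_vadd:
  assumes "product_supported G R a b c" "product_supported G R a b c'"
  shows "product_supported G R a b (vadd c c')"
  using assms supp_vadd[of c c'] unfolding product_supported_def by blast

lemma product_supported_vsc:
  assumes "product_supported G R a b c"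
  shows "product_supported G R a b (vsc x c)"
  using assms supp_vsc[of x c] unfolding product_supported_def by blast

lemma operations_supportedI:
  assumes "\<And>f a b. f \<in> set ops \<Longrightarrow> product_supported G R a b (f a b)"
    and "\<And>a. product_supported G R a a (sq a)"
  shows "operations_supported G R ops sq"
  using assms by (simp add: operations_supported_def)

lemma operations_supported_op:
  assumes "operations_supported G R ops sq" "f \<in> set ops"
  shows "product_supported G R a b (f a b)"
  using assms by (simp add: operations_supported_def)

lemma operations_supported_sq:
  assumes "operations_supported G R ops sq"
  shows "product_supported G R a a (sq a)"
  using assms by (simp add: operations_supported_def)

lemma operations_supported_mono:
  assumes "operations_supported G R ops sq" "\<And>t s u. R t s u \<Longrightarrow> R' t s u"
  shows "operations_supported G R' ops sq"
  using assms unfolding operations_supported_def by (blast intro: product_supported_mono)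

lemma is_subalg_supported_in:
  assumes subalg: "is_subalg pe ops sq L"
    and supp: "\<And>a. a \<in> L \<Longrightarrow> supp a \<subseteq> G" "\<And>a. supp (pe a) \<subseteq> supp a"
    and ops: "operations_supported G (\<lambda>t s u. s \<in> I \<longrightarrow> u \<in> I \<longrightarrow> t \<in> I) ops sq"
  shows "is_subalg pe ops sq {a \<in> L. supp a \<subseteq> I}" (is "is_subalg _ _ _ ?B")
proof (rule is_subalgI)
  have closed: "supp c \<subseteq> I"
    if "product_supported G (\<lambda>t s u. s \<in> I \<longrightarrow> u \<in> I \<longrightarrow> t \<in> I) a b c" "a \<in> ?B" "b \<in> ?B" for a b c
    using that supp(1) by (blast elim: product_supportedE)
  show "z0 \<in> ?B" using is_subalg_z0[OF subalg] by simp
  show "vadd a b \<in> ?B" if "a \<in> ?B" "b \<in> ?B" for a b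
    using that is_subalg_vadd[OF subalg] supp_vadd[of a b] by blast
  show "vsc c a \<in> ?B" if "a \<in> ?B" for c a
    using that is_subalg_vsc[OF subalg] supp_vsc[of c a] by blast
  show "pe a \<in> ?B" if "a \<in> ?B" for a
    using that is_subalg_pe[OF subalg] supp(2)[of a] by blast
  show "f a b \<in> ?B" if "f \<in> set ops" "a \<in> ?B" "b \<in> ?B" for f a b
    using closed[OF operations_supported_op[OF ops that(1)] that(2,3)]
      is_subalg_op[OF subalg that(1)] that(2,3)
    by blast
  show "sq a \<in> ?B" if "a \<in> ?B" "pe a = z0" for a
    using closed[OF operations_supported_sq[OF ops] that(1,1)] is_subalg_sq[OF subalg] that by blast
qed


section \<open>Nilpotency from superadditive weights\<close>

lemma product_supported_bounds:
  fixes om r :: "'i \<Rightarrow> real"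
  assumes "product_supported G (\<lambda>t s u. om s + om u \<le> om t \<and> r t \<le> r s + r u) a b c"
    and "supp a \<subseteq> {t \<in> G. real m * d \<le> om t \<and> r t \<le> real m * R}"
    and "supp b \<subseteq> {t \<in> G. real n * d \<le> om t \<and> r t \<le> real n * R}"
  shows "supp c \<subseteq> {t \<in> G. real (m + n) * d \<le> om t \<and> r t \<le> real (m + n) * R}"
proof
  fix t assume t_supp: "t \<in> supp c"
  have supp: "supp a \<subseteq> G" "supp b \<subseteq> G" using assms(2,3) by auto
  obtain s u where "t \<in> G" and factors: "s \<in> supp a" "u \<in> supp b"
    and sum: "om s + om u \<le> om t \<and> r t \<le> r s + r u"
    by (rule product_supportedE[OF assms(1) supp t_supp])
  have "real m * d \<le> om s" "r s \<le> real m * R" "real n * d \<le> om u" "r u \<le> real n * R"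
    using subsetD[OF assms(2) factors(1)] subsetD[OF assms(3) factors(2)] by simp_all
  then show "t \<in> {t \<in> G. real (m + n) * d \<le> om t \<and> r t \<le> real (m + n) * R}"
    using \<open>t \<in> G\<close> sum by (simp add: distrib_right)
qed

lemma mons_supp_bounds:
  fixes om r :: "'i \<Rightarrow> real"
  assumes "(x, n, p) \<in> mons pe ops sq X"
    and ops: "operations_supported G (\<lambda>t s u. om s + om u \<le> om t \<and> r t \<le> r s + r u) ops sq"
    and generators: "\<And>x. x \<in> X \<Longrightarrow> supp x \<subseteq> {t \<in> G. d \<le> om t \<and> r t \<le> R}"
  shows "supp x \<subseteq> {t \<in> G. real n * d \<le> om t \<and> r t \<le> real n * R}"
  using assms(1)
proof (induction rule: mons.induct)
  case (mgen x p)
  then show ?case using generators by simp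
next
  case (mop a m p b n q f)
  show ?case
    by (rule product_supported_bounds[OF operations_supported_op[OF ops mop.hyps(3)] mop.IH])
next
  case (msq a m)
  show ?case unfolding mult_2
    by (rule product_supported_bounds[OF operations_supported_sq[OF ops] msq.IH msq.IH])
qed

lemma mons_eventually_z0:
  fixes om r :: "'i \<Rightarrow> real"
  assumes ops: "operations_supported G (\<lambda>t s u. om s + om u \<le> om t \<and> r t \<le> r s + r u) ops sq"
    and generators: "\<And>x. x \<in> X \<Longrightarrow> supp x \<subseteq> {t \<in> G. d \<le> om t \<and> r t \<le> R}"
    and "0 < d" "0 \<le> k" and bound: "\<And>t. t \<in> G \<Longrightarrow> 0 \<le> om t \<Longrightarrow> (om t)\<^sup>2 \<le> k * r t"
  shows "\<exists>N. \<forall>w n p. (w, n, p) \<in> mons pe ops sq X \<and> N \<le> n \<longrightarrow> w = z0"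
proof (intro exI allI impI, elim conjE)
  fix w n p
  assume w_mons: "(w, n, p) \<in> mons pe ops sq X" and n_large: "nat \<lceil>k * R / d\<^sup>2\<rceil> + 1 \<le> n"
  show "w = z0"
  proof (rule ccontr)
    assume "w \<noteq> z0"
    then obtain t where "t \<in> supp w" using supp_eq_empty_iff by blast
    then have t_bounds: "t \<in> G" "real n * d \<le> om t" "r t \<le> real n * R"
      using mons_supp_bounds[OF w_mons ops generators] by auto
    have "0 \<le> real n * d" using \<open>0 < d\<close> by simp
    then have "(real n * d)\<^sup>2 \<le> (om t)\<^sup>2" using t_bounds by (intro power_mono)
    also have "\<dots> \<le> k * r t" using t_bounds \<open>0 \<le> real n * d\<close> by (intro bound) auto
    also have "\<dots> \<le> k * (real n * R)" using t_bounds(3) \<open>0 \<le> k\<close> by (rule mult_left_mono)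
    finally have "real n * (real n * d\<^sup>2) \<le> real n * (k * R)"
      by (simp add: power2_eq_square mult_ac)
    moreover have "0 < real n" using n_large by simp
    ultimately have "real n * d\<^sup>2 \<le> k * R" by (rule mult_left_le_imp_le)
    then have "real n \<le> k * R / d\<^sup>2" using \<open>0 < d\<close> by (simp add: pos_le_divide_eq)
    also have "\<dots> \<le> real (nat \<lceil>k * R / d\<^sup>2\<rceil>)" by (rule of_nat_ceiling)
    also have "\<dots> < real n" using n_large by simp
    finally show False by simp
  qed
qed


section \<open>Decompositions along lines\<close>

lemma is_decomp_supported_in:
  assumes subalg_L: "is_subalg pe ops sq L"
    and split: "I \<inter> J = {}" "\<And>a. a \<in> L \<Longrightarrow> supp a \<subseteq> I \<union> J"
    and proj_closed: "\<And>a. a \<in> L \<Longrightarrow> proj I a \<in> L"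
    and subalg_parts: "is_subalg pe ops sq {a \<in> L. supp a \<subseteq> I}"
      "is_subalg pe ops sq {a \<in> L. supp a \<subseteq> J}"
    and nilp: "loc_nilp pe ops sq {a \<in> L. supp a \<subseteq> I}" "loc_nilp pe ops sq {a \<in> L. supp a \<subseteq> J}"
  shows "is_decomp pe ops sq L {a \<in> L. supp a \<subseteq> I} {a \<in> L. supp a \<subseteq> J}"
  unfolding is_decomp_def
proof (intro conjI subalg_parts nilp ballI)
  have "a = z0" if "supp a \<subseteq> I" "supp a \<subseteq> J" for a :: "'a \<Rightarrow> 'b"
    using that split(1) supp_eq_empty_iff by blast
  then show "{a \<in> L. supp a \<subseteq> I} \<inter> {a \<in> L. supp a \<subseteq> J} = {z0}"
    using is_subalg_z0[OF subalg_L] by auto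
next
  fix a assume a_in: "a \<in> L"
  have "vsub a (proj I a) = proj J a"
    using split(1) split(2)[OF a_in] by (auto simp: vsub_def proj_def in_supp_iff fun_eq_iff)
  then have "proj J a \<in> L" using is_subalg_vsub[OF subalg_L a_in proj_closed[OF a_in]] by simp
  moreover have "a = vadd (proj I a) (proj J a)"
    using split(1) split(2)[OF a_in] by (auto simp: vadd_def proj_def in_supp_iff fun_eq_iff)
  moreover have "supp (proj I a) \<subseteq> I" "supp (proj J a) \<subseteq> J" by (simp_all add: supp_proj)
  ultimately show "\<exists>b1\<in>{a \<in> L. supp a \<subseteq> I}. \<exists>b2\<in>{a \<in> L. supp a \<subseteq> J}. a = vadd b1 b2"
    using proj_closed[OF a_in] by blast
qed auto

lemma continuum_decompsI:
  assumes "\<And>s. s \<in> A \<Longrightarrow> is_decomp pe ops sq L (B1 s) (B2 s)"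
    and "inj_on B1 A" "(UNIV :: real set) \<lesssim> A"
  shows "continuum_decomps pe ops sq L"
proof -
  obtain h :: "real \<Rightarrow> _" where h_inj: "inj h" "range h \<subseteq> A"
    using assms(3) unfolding lepoll_def by blast
  define f where "f x = (B1 (h x), B2 (h x))" for x
  have "inj f"
    using h_inj assms(2) by (auto simp: f_def inj_on_def image_subset_iff)
  then have "bij_betw f UNIV (range f)" by (rule inj_on_imp_bij_betw)
  moreover have "range f \<subseteq> {(B1, B2). is_decomp pe ops sq L B1 B2}"
    using assms(1) h_inj(2) by (auto simp: f_def)
  ultimately show ?thesis unfolding continuum_decomps_def by blast
qed

lemma finite_positive_lower_bound:
  fixes S :: "real set"
  assumes "finite S" "\<And>x. x \<in> S \<Longrightarrow> 0 < x"
  obtains d where "0 < d" "\<And>x. x \<in> S \<Longrightarrow> d \<le> x"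
proof
  have "Min (insert 1 S) \<in> insert 1 S" using assms(1) by (intro Min_in) auto
  then show "0 < Min (insert 1 S)" using assms(2) by auto
  show "Min (insert 1 S) \<le> x" if "x \<in> S" for x using assms(1) that by (intro Min_le) auto
qed

lemma bounded_linear_side: "bounded_linear (side s)"
proof (rule bounded_linear_intro)
  show "norm (side s z) \<le> norm z * (1 + \<bar>s\<bar>)" for z
    using abs_side_le[of s z] by (simp add: mult.commute)
qed (simp_all add: side_def algebra_simps)

definition weight_additive :: "('i \<Rightarrow> 'g::plus) \<Rightarrow> 'i \<Rightarrow> 'i \<Rightarrow> 'i \<Rightarrow> bool" where
  "weight_additive w t s u \<longleftrightarrow> w t = w s + w u"

text \<open>The set \<open>U\<close> singles out the index of \<open>1\<close>-bar in a double. It has weight \<open>0\<close>, but its product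
  with a barred element vanishes.\<close>

definition double_additive :: "('i \<Rightarrow> bool) \<Rightarrow> 'i set \<Rightarrow> ('i \<Rightarrow> 'g::plus) \<Rightarrow> 'i \<Rightarrow> 'i \<Rightarrow> 'i \<Rightarrow> bool" where
  "double_additive bar U w t s u \<longleftrightarrow>
     weight_additive w t s u \<and> bar t = (bar s \<noteq> bar u) \<and> (bar t \<or> s \<notin> U \<and> u \<notin> U)"

lemma double_additive_trivial:
  "weight_additive w t s u \<Longrightarrow> double_additive (\<lambda>_. False) {} w t s u"
  by (simp add: double_additive_def)

locale paraboloid_algebra =
  fixes pe :: "('i \<Rightarrow> 'k::field) \<Rightarrow> 'i \<Rightarrow> 'k" and ops sq L
    and G :: "'i set" and bar :: "'i \<Rightarrow> bool" and U :: "'i set" and w :: "'i \<Rightarrow> complex \<times> real"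
  assumes subalg: "is_subalg pe ops sq L"
    and supp_pe: "supp (pe a) \<subseteq> supp a"
    and operations: "operations_supported G (double_additive bar U w) ops sq"
    and unit_index: "t \<in> U \<Longrightarrow> bar t \<and> w t = 0"
    and supp_L: "a \<in> L \<Longrightarrow> supp a \<subseteq> G"
    and finite_weights: "a \<in> L \<Longrightarrow> finite (w ` supp a)"
    and weight_in_paraboloid: "t \<in> G \<Longrightarrow> w t \<in> paraboloid"
    and side_nonzero: "a \<in> L \<Longrightarrow> t \<in> supp a \<Longrightarrow> t \<notin> U \<Longrightarrow> s \<in> generic_slopes \<Longrightarrow> side s (fst (w t)) \<noteq> 0"
    and proj_upper: "a \<in> L \<Longrightarrow> s \<in> generic_slopes \<Longrightarrow> proj {t. 0 < side s (fst (w t)) \<or> t \<in> U} a \<in> L"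
    and mu_power_element: "\<exists>e\<in>L. e \<noteq> z0 \<and> (\<forall>t\<in>supp e. t \<notin> U \<and> fst (w t) = mu ^ n)"
begin

text \<open>Shifting the weights by \<open>- 3 * d\<close> (unbarred), \<open>- 2 * d\<close> (barred) and \<open>+ d\<close> (\<open>1\<close>-bar) makes all
  weights in a half positive and keeps superadditivity.\<close>

definition shifted :: "(complex \<Rightarrow> real) \<Rightarrow> real \<Rightarrow> 'i \<Rightarrow> real" where
  "shifted \<phi> d t = (if t \<in> U then d else \<phi> (fst (w t)) - (if bar t then 2 * d else 3 * d))"

context
  fixes \<phi> :: "complex \<Rightarrow> real"
  assumes linear: "bounded_linear \<phi>"
begin

interpretation \<phi>: bounded_linear \<phi> by (rule linear)

lemma shifted_superadditive:
  assumes "0 < d" and additive: "double_additive bar U w t s u"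
  shows "shifted \<phi> d s + shifted \<phi> d u \<le> shifted \<phi> d t"
proof -
  have sum: "\<phi> (fst (w t)) = \<phi> (fst (w s)) + \<phi> (fst (w u))"
    using additive by (simp add: double_additive_def weight_additive_def \<phi>.add)
  have unbarred: "shifted \<phi> d v = \<phi> (fst (w v)) - 3 * d" if "\<not> bar v" for v
    using that unit_index by (auto simp: shifted_def)
  have barred: "\<phi> (fst (w v)) - 2 * d \<le> shifted \<phi> d v" "shifted \<phi> d v \<le> \<phi> (fst (w v)) + d"
    if "bar v" for v
    using that unit_index[of v] \<open>0 < d\<close> by (auto simp: shifted_def \<phi>.zero)
  have not_unit: "shifted \<phi> d v = \<phi> (fst (w v)) - 2 * d" if "bar v" "v \<notin> U" for v
    using that by (simp add: shifted_def)
  consider (no_bars) "\<not> bar t" "\<not> bar s" "\<not> bar u"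
    | (two_bars) "\<not> bar t" "bar s" "bar u" "s \<notin> U" "u \<notin> U"
    | (left_bar) "bar t" "bar s" "\<not> bar u" | (right_bar) "bar t" "\<not> bar s" "bar u"
    using additive unfolding double_additive_def by blast
  then show ?thesis
  proof cases
    case no_bars
    then show ?thesis using sum \<open>0 < d\<close> by (simp add: unbarred)
  next
    case two_bars
    then show ?thesis using sum \<open>0 < d\<close> by (simp add: unbarred not_unit)
  next
    case left_bar
    then show ?thesis using sum barred(1)[of t] barred(2)[of s] unbarred[of u] by linarith
  next
    case right_bar
    then show ?thesis using sum barred(1)[of t] barred(2)[of u] unbarred[of s] by linarith
  qed
qed

lemma shifted_sq_le:
  assumes "0 < d" "t \<in> G" and nonneg: "0 \<le> shifted \<phi> d t"
  shows "(shifted \<phi> d t)\<^sup>2 \<le> ((onorm \<phi>)\<^sup>2 * 130 + d\<^sup>2) * (snd (w t) + 1)"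
proof -
  let ?k = "(onorm \<phi>)\<^sup>2 * 130 + d\<^sup>2"
  have r_nonneg: "0 \<le> snd (w t)" by (rule paraboloid_nonneg[OF weight_in_paraboloid[OF \<open>t \<in> G\<close>]])
  show ?thesis
  proof (cases "t \<in> U")
    case True
    then show ?thesis by (simp add: shifted_def unit_index zero_prod_def)
  next
    case False
    have "shifted \<phi> d t \<le> \<phi> (fst (w t))" using False \<open>0 < d\<close> by (simp add: shifted_def)
    also have "\<dots> \<le> onorm \<phi> * cmod (fst (w t))" using onorm[OF linear, of "fst (w t)"] by simp
    finally have "(shifted \<phi> d t)\<^sup>2 \<le> (onorm \<phi> * cmod (fst (w t)))\<^sup>2" using nonneg
      by (intro power_mono)
    also have "\<dots> = (onorm \<phi>)\<^sup>2 * (cmod (fst (w t)))\<^sup>2" by (rule power_mult_distrib)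
    also have "\<dots> \<le> (onorm \<phi>)\<^sup>2 * (130 * snd (w t))"
      using weight_in_paraboloid[OF \<open>t \<in> G\<close>] by (intro mult_left_mono) (auto simp: paraboloid_def)
    also have "\<dots> = ((onorm \<phi>)\<^sup>2 * 130) * snd (w t)" by simp
    also have "\<dots> \<le> ?k * (snd (w t) + 1)" using r_nonneg by (intro mult_mono) auto
    finally show ?thesis .
  qed
qed

lemma shifted_bounds:
  assumes "finite X" "X \<subseteq> L" and pos: "\<And>x t. x \<in> X \<Longrightarrow> t \<in> supp x \<Longrightarrow> 0 < \<phi> (fst (w t)) \<or> t \<in> U"
  obtains d R where "0 < d" "\<And>x. x \<in> X \<Longrightarrow> supp x \<subseteq> {t \<in> G. d \<le> shifted \<phi> d t \<and> snd (w t) + 1 \<le> R}"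
proof -
  have finite_weights_X: "finite (\<Union>x\<in>X. w ` supp x)" using assms(1,2) finite_weights by blast
  let ?S = "{y \<in> (\<lambda>v. \<phi> (fst v)) ` (\<Union>x\<in>X. w ` supp x). 0 < y}"
  have "finite ?S" using finite_weights_X by simp
  then obtain d where d_lower: "0 < d" "\<And>y. y \<in> ?S \<Longrightarrow> d \<le> y"
    using finite_positive_lower_bound[of ?S] by blast
  have "bdd_above ((\<lambda>v. snd v + 1) ` (\<Union>x\<in>X. w ` supp x))" using finite_weights_X by simp
  then obtain R where R_upper: "\<forall>y\<in>(\<lambda>v. snd v + 1) ` (\<Union>x\<in>X. w ` supp x). y \<le> R"
    unfolding bdd_above_def ..
  have "0 < d / 4" using d_lower(1) by simp
  then show ?thesis
  proof (rule that)
    fix x assume x_in: "x \<in> X"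
    show "supp x \<subseteq> {t \<in> G. d / 4 \<le> shifted \<phi> (d / 4) t \<and> snd (w t) + 1 \<le> R}"
    proof (intro subsetI CollectI conjI)
      fix t assume t_supp: "t \<in> supp x"
      show "t \<in> G" using supp_L x_in t_supp assms(2) by blast
      show "snd (w t) + 1 \<le> R" using R_upper x_in t_supp by simp
      show "d / 4 \<le> shifted \<phi> (d / 4) t"
      proof (cases "t \<in> U")
        case False
        then have "0 < \<phi> (fst (w t))" using pos[OF x_in t_supp] by blast
        then have "d \<le> \<phi> (fst (w t))" using x_in t_supp by (intro d_lower(2)) auto
        then show ?thesis using False d_lower(1) by (simp add: shifted_def)
      qed (simp add: shifted_def)
    qed
  qed
qed

lemma loc_nilp_if_positive:
  assumes "B \<subseteq> L" and pos: "\<And>a t. a \<in> B \<Longrightarrow> t \<in> supp a \<Longrightarrow> 0 < \<phi> (fst (w t)) \<or> t \<in> U"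
  shows "loc_nilp pe ops sq B"
  unfolding loc_nilp_def
proof (intro allI impI, elim conjE)
  fix X assume X_sub: "finite X" "X \<subseteq> B"
  obtain d R where d_pos: "0 < d"
    and X_bounds: "\<And>x. x \<in> X \<Longrightarrow> supp x \<subseteq> {t \<in> G. d \<le> shifted \<phi> d t \<and> snd (w t) + 1 \<le> R}"
    using shifted_bounds[of X] X_sub assms by blast
  show "\<exists>N. \<forall>w n p. (w, n, p) \<in> mons pe ops sq X \<and> N \<le> n \<longrightarrow> w = z0"
  proof (rule mons_eventually_z0[OF _ _ d_pos])
    show "operations_supported G (\<lambda>t s u. shifted \<phi> d s + shifted \<phi> d u \<le> shifted \<phi> d t
        \<and> snd (w t) + 1 \<le> (snd (w s) + 1) + (snd (w u) + 1)) ops sq"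
    proof (rule operations_supported_mono[OF operations], intro conjI)
      fix t s u assume additive: "double_additive bar U w t s u"
      then show "shifted \<phi> d s + shifted \<phi> d u \<le> shifted \<phi> d t"
        by (rule shifted_superadditive[OF d_pos])
      from additive show "snd (w t) + 1 \<le> (snd (w s) + 1) + (snd (w u) + 1)"
        by (simp add: double_additive_def weight_additive_def)
    qed
    show "0 \<le> (onorm \<phi>)\<^sup>2 * 130 + d\<^sup>2" by simp
  qed (use X_bounds shifted_sq_le[OF d_pos] in blast)+
qed

end

definition upper :: "real \<Rightarrow> 'i set" where
  "upper s = {t. 0 < side s (fst (w t)) \<or> t \<in> U}"

definition lower :: "real \<Rightarrow> 'i set" where
  "lower s = {t. side s (fst (w t)) < 0}"

lemma upper_closed:
  assumes "double_additive bar U w t s' u"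
  shows "s' \<in> upper s \<longrightarrow> u \<in> upper s \<longrightarrow> t \<in> upper s"
proof -
  have sum: "side s (fst (w t)) = side s (fst (w s')) + side s (fst (w u))"
    and not_both: "s' \<notin> U \<or> u \<notin> U"
    using assms unit_index by (auto simp: double_additive_def weight_additive_def side_add)
  have "side s (fst (w v)) = 0" if "v \<in> U" for v using unit_index[OF that] by simp
  with not_both show ?thesis by (auto simp: upper_def sum)
qed

lemma lower_closed:
  assumes "double_additive bar U w t s' u"
  shows "s' \<in> lower s \<longrightarrow> u \<in> lower s \<longrightarrow> t \<in> lower s"
  using assms by (auto simp: double_additive_def weight_additive_def side_add lower_def)

lemma is_decomp_upper_lower:
  assumes "s \<in> generic_slopes"
  shows "is_decomp pe ops sq L {a \<in> L. supp a \<subseteq> upper s} {a \<in> L. supp a \<subseteq> lower s}"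
proof (rule is_decomp_supported_in[OF subalg])
  show "upper s \<inter> lower s = {}"
    using unit_index by (auto simp: upper_def lower_def)
  show "supp a \<subseteq> upper s \<union> lower s" if "a \<in> L" for a
    using side_nonzero[OF that _ _ assms] by (force simp: upper_def lower_def)
  show "proj (upper s) a \<in> L" if "a \<in> L" for a
    unfolding upper_def by (rule proj_upper[OF that assms])
  show "is_subalg pe ops sq {a \<in> L. supp a \<subseteq> upper s}"
    by (rule is_subalg_supported_in[OF subalg supp_L supp_pe
          operations_supported_mono[OF operations upper_closed]])
  show "is_subalg pe ops sq {a \<in> L. supp a \<subseteq> lower s}"
    by (rule is_subalg_supported_in[OF subalg supp_L supp_pe
          operations_supported_mono[OF operations lower_closed]])
  show "loc_nilp pe ops sq {a \<in> L. supp a \<subseteq> upper s}"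
    by (rule loc_nilp_if_positive[OF bounded_linear_side[of s]]) (auto simp: upper_def)
  show "loc_nilp pe ops sq {a \<in> L. supp a \<subseteq> lower s}"
    by (rule loc_nilp_if_positive[OF bounded_linear_minus[OF bounded_linear_side[of s]]])
      (auto simp: lower_def)
qed

lemma upper_halves_distinct:
  assumes "s < s'"
  shows "{a \<in> L. supp a \<subseteq> upper s} \<noteq> {a \<in> L. supp a \<subseteq> upper s'}"
proof
  assume halves_eq: "{a \<in> L. supp a \<subseteq> upper s} = {a \<in> L. supp a \<subseteq> upper s'}"
  obtain n where separated: "side s (mu ^ n) * side s' (mu ^ n) < 0"
    using powers_separate_lines[OF mu_power_not_real \<open>s < s'\<close>] by blast
  obtain e where e_weight: "e \<in> L" "e \<noteq> z0" "\<And>t. t \<in> supp e \<Longrightarrow> t \<notin> U \<and> fst (w t) = mu ^ n"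
    using mu_power_element[of n] by blast
  have in_upper_iff: "supp e \<subseteq> upper s \<longleftrightarrow> 0 < side s (mu ^ n)" for s
  proof -
    obtain t where "t \<in> supp e" using e_weight(2) supp_eq_empty_iff by blast
    then show ?thesis using e_weight(3) by (auto simp: upper_def subset_iff)
  qed
  have "supp e \<subseteq> upper s \<longleftrightarrow> supp e \<subseteq> upper s'" using halves_eq e_weight(1) by blast
  then show False using separated unfolding in_upper_iff by (auto simp: mult_less_0_iff)
qed

theorem continuum_decomps: "continuum_decomps pe ops sq L"
proof (rule continuum_decompsI[OF is_decomp_upper_lower _ reals_lepoll_generic_slopes])
  show "inj_on (\<lambda>s. {a \<in> L. supp a \<subseteq> upper s}) generic_slopes"
    by (rule linorder_inj_onI') (rule upper_halves_distinct)
qed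

end


section \<open>Algebras generated by homogeneous elements\<close>

definition homogeneous :: "('i \<Rightarrow> 'g) \<Rightarrow> ('i \<Rightarrow> 'k::zero) \<Rightarrow> bool" where
  "homogeneous w a \<longleftrightarrow> (\<forall>s\<in>supp a. \<forall>t\<in>supp a. w s = w t)"

lemma homogeneous_z0 [simp]: "homogeneous w z0"
  by (simp add: homogeneous_def)

lemma homogeneous_subset: "homogeneous w a \<Longrightarrow> supp b \<subseteq> supp a \<Longrightarrow> homogeneous w b"
  unfolding homogeneous_def by blast

lemma homogeneous_finite_weights:
  assumes "homogeneous w a"
  shows "finite (w ` supp a)"
proof (cases "supp a = {}")
  case False
  then obtain t where "t \<in> supp a" by blast
  then have "w ` supp a \<subseteq> {w t}" using assms unfolding homogeneous_def by blast
  then show ?thesis by (rule finite_subset) simp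
qed simp

lemma homogeneous_product:
  assumes "product_supported G (weight_additive w) a b c" "supp a \<subseteq> G" "supp b \<subseteq> G"
    and "homogeneous w a" "homogeneous w b"
  shows "homogeneous w c"
  unfolding homogeneous_def
proof (intro ballI)
  fix t t' assume "t \<in> supp c" "t' \<in> supp c"
  then obtain s u s' u' where
    "s \<in> supp a" "u \<in> supp b" "w t = w s + w u" "s' \<in> supp a" "u' \<in> supp b" "w t' = w s' + w u'"
    using product_supportedE[OF assms(1-3)] unfolding weight_additive_def by metis
  then show "w t = w t'" using assms(4,5) unfolding homogeneous_def by metis
qed

locale homogeneous_generators =
  fixes Ev :: "'i set" and pe :: "('i \<Rightarrow> 'k::field) \<Rightarrow> 'i \<Rightarrow> 'k" and ops sq and X L :: "('i \<Rightarrow> 'k) set"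
    and w :: "'i \<Rightarrow> 'g::ab_group_add" and G :: "'i set" and adm :: "('i \<Rightarrow> 'k) \<Rightarrow> bool"
  assumes L_eq: "L = generated pe ops sq X"
    and pe_eq: "pe = proj Ev"
    and adm_z0: "adm z0"
    and adm_vadd: "adm a \<Longrightarrow> adm b \<Longrightarrow> adm (vadd a b)"
    and adm_subset: "adm a \<Longrightarrow> supp b \<subseteq> supp a \<Longrightarrow> adm b"
    and adm_op: "f \<in> set ops \<Longrightarrow> adm a \<Longrightarrow> adm b \<Longrightarrow> adm (f a b)"
    and adm_sq: "adm a \<Longrightarrow> adm (sq a)"
    and adm_supp: "adm a \<Longrightarrow> supp a \<subseteq> G"
    and op_vadd_left:
      "f \<in> set ops \<Longrightarrow> adm a \<Longrightarrow> adm a' \<Longrightarrow> adm b \<Longrightarrow> f (vadd a a') b = vadd (f a b) (f a' b)"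
    and op_vadd_right:
      "f \<in> set ops \<Longrightarrow> adm a \<Longrightarrow> adm b \<Longrightarrow> adm b' \<Longrightarrow> f a (vadd b b') = vadd (f a b) (f a b')"
    and operations: "operations_supported G (weight_additive w) ops sq"
    and sq_vadd: "adm a \<Longrightarrow> adm b \<Longrightarrow> pe a = z0 \<Longrightarrow> pe b = z0 \<Longrightarrow>
      \<exists>c\<in>insert z0 ((\<lambda>f. f a b) ` set ops). sq (vadd a b) = vadd (sq a) (vadd c (sq b))"
    and generators: "x \<in> X \<Longrightarrow> adm x \<and> homogeneous w x"
begin

lemma subalg: "is_subalg pe ops sq L"
  unfolding L_eq by (rule is_subalg_generated)

inductive_set hsums :: "('i \<Rightarrow> 'k) set" where
  homogeneous: "h \<in> L \<Longrightarrow> adm h \<Longrightarrow> homogeneous w h \<Longrightarrow> h \<in> hsums"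
| vadd: "a \<in> hsums \<Longrightarrow> b \<in> hsums \<Longrightarrow> vadd a b \<in> hsums"

lemma hsums_z0: "z0 \<in> hsums"
  by (rule hsums.homogeneous[OF is_subalg_z0[OF subalg] adm_z0 homogeneous_z0])

lemma hsums_in_L: "a \<in> hsums \<Longrightarrow> a \<in> L"
  by (induction rule: hsums.induct) (auto intro: is_subalg_vadd[OF subalg])

lemma hsums_adm: "a \<in> hsums \<Longrightarrow> adm a"
  by (induction rule: hsums.induct) (auto intro: adm_vadd)

lemma hsums_finite_weights: "a \<in> hsums \<Longrightarrow> finite (w ` supp a)"
proof (induction rule: hsums.induct)
  case (vadd a b)
  then have "finite (w ` (supp a \<union> supp b))" by (simp add: image_Un)
  then show ?case by (rule finite_subset[OF image_mono[OF supp_vadd]])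
qed (rule homogeneous_finite_weights)

lemma hsums_image:
  assumes "a \<in> hsums"
    and "\<And>h. h \<in> L \<Longrightarrow> adm h \<Longrightarrow> homogeneous w h \<Longrightarrow> \<phi> h \<in> hsums"
    and "\<And>a b. a \<in> hsums \<Longrightarrow> b \<in> hsums \<Longrightarrow> \<phi> (vadd a b) = vadd (\<phi> a) (\<phi> b)"
  shows "\<phi> a \<in> hsums"
  using assms(1) by (induction rule: hsums.induct) (simp_all add: assms(2,3) hsums.vadd)

lemma hsums_vsc: "a \<in> hsums \<Longrightarrow> vsc c a \<in> hsums"
proof (erule hsums_image)
  show "vsc c h \<in> hsums" if "h \<in> L" "adm h" "homogeneous w h" for h
    using that by (intro hsums.homogeneous is_subalg_vsc[OF subalg] adm_subset[OF _ supp_vsc]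
        homogeneous_subset[OF _ supp_vsc])
qed (simp add: vsc_def vadd_def distrib_left)

lemma supp_pe: "supp (pe a) \<subseteq> supp a"
  by (simp add: pe_eq supp_proj)

lemma hsums_pe: "a \<in> hsums \<Longrightarrow> pe a \<in> hsums"
proof (erule hsums_image)
  show "pe h \<in> hsums" if "h \<in> L" "adm h" "homogeneous w h" for h
    using that by (intro hsums.homogeneous is_subalg_pe[OF subalg] adm_subset[OF _ supp_pe]
        homogeneous_subset[OF _ supp_pe])
qed (simp add: pe_eq proj_vadd)

lemma hsums_op_homogeneous:
  assumes op: "f \<in> set ops" and left: "h \<in> L" "adm h" "homogeneous w h"
    and right: "h' \<in> L" "adm h'" "homogeneous w h'"
  shows "f h h' \<in> hsums"
  using is_subalg_op[OF subalg op left(1) right(1)] adm_op[OF op left(2) right(2)]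
    homogeneous_product[OF operations_supported_op[OF operations op]
      adm_supp[OF left(2)] adm_supp[OF right(2)] left(3) right(3)]
  by (rule hsums.homogeneous)

lemma hsums_op:
  assumes op: "f \<in> set ops" and "a \<in> hsums" "b \<in> hsums"
  shows "f a b \<in> hsums"
  using assms(2)
proof (rule hsums_image[where \<phi> = "\<lambda>a. f a b"])
  show "f h b \<in> hsums" if left: "h \<in> L" "adm h" "homogeneous w h" for h
    using assms(3)
    by (rule hsums_image)
      (auto intro: hsums_op_homogeneous[OF op left] op_vadd_right[OF op left(2)] hsums_adm)
qed (simp add: op_vadd_left op hsums_adm assms(3))

lemma odd_part_eq: "proj (- Ev) a = vsub a (pe a)"
  by (auto simp: pe_eq proj_def vsub_def)

lemma hsums_sq_homogeneous:
  assumes "h \<in> L" "adm h" "homogeneous w h" "pe h = z0"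
  shows "sq h \<in> hsums"
  using is_subalg_sq[OF subalg assms(1,4)] adm_sq[OF assms(2)]
    homogeneous_product[OF operations_supported_sq[OF operations]
      adm_supp[OF assms(2)] adm_supp[OF assms(2)] assms(3,3)]
  by (rule hsums.homogeneous)

lemma pe_odd_part: "pe (proj (- Ev) a) = z0"
  unfolding pe_eq by (rule proj_eq_z0) (auto simp: supp_proj)

lemma hsums_odd_part: "a \<in> hsums \<Longrightarrow> proj (- Ev) a \<in> hsums"
  unfolding odd_part_eq vsub_conv_vadd by (intro hsums.vadd hsums_vsc hsums_pe)

lemma hsums_sq_odd_part: "a \<in> hsums \<Longrightarrow> sq (proj (- Ev) a) \<in> hsums"
proof (induction rule: hsums.induct)
  case (homogeneous h)
  show ?case
  proof (rule hsums_sq_homogeneous[OF _ _ _ pe_odd_part])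
    show "proj (- Ev) h \<in> L"
      using homogeneous(1) unfolding odd_part_eq
      by (intro is_subalg_vsub[OF subalg] is_subalg_pe[OF subalg])
    show "adm (proj (- Ev) h)" using homogeneous(2) by (rule adm_subset) (simp add: supp_proj)
    show "homogeneous w (proj (- Ev) h)"
      using homogeneous(3) by (rule homogeneous_subset) (simp add: supp_proj)
  qed
next
  case (vadd a b)
  let ?a = "proj (- Ev) a" and ?b = "proj (- Ev) b"
  have odd_a: "?a \<in> hsums" and odd_b: "?b \<in> hsums" using vadd.hyps by (simp_all add: hsums_odd_part)
  obtain c where "c \<in> insert z0 ((\<lambda>f. f ?a ?b) ` set ops)"
    and sq_sum: "sq (vadd ?a ?b) = vadd (sq ?a) (vadd c (sq ?b))"
    using sq_vadd[OF hsums_adm[OF odd_a] hsums_adm[OF odd_b] pe_odd_part pe_odd_part] by blast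
  then have "c \<in> hsums" using hsums_z0 hsums_op[OF _ odd_a odd_b] by blast
  then show ?case unfolding proj_vadd sq_sum by (intro hsums.vadd vadd.IH)
qed

lemma is_subalg_hsums: "is_subalg pe ops sq hsums"
proof (rule is_subalgI)
  fix a assume odd_a: "a \<in> hsums" "pe a = z0"
  have "proj (- Ev) a = a" unfolding odd_part_eq odd_a(2) by (simp add: vsub_def z0_def)
  then show "sq a \<in> hsums" using hsums_sq_odd_part[OF odd_a(1)] by simp
qed (rule hsums_z0 hsums.vadd hsums_vsc hsums_pe hsums_op; assumption)+

theorem in_hsums:
  assumes "a \<in> L"
  shows "a \<in> hsums"
proof -
  have "X \<subseteq> L" unfolding L_eq by (rule generated_superset)
  then have "X \<subseteq> hsums" using generators hsums.homogeneous by blast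
  then have "generated pe ops sq X \<subseteq> hsums" by (rule generated_least[OF is_subalg_hsums])
  then show ?thesis using assms L_eq by blast
qed

lemma supp_in_G: "a \<in> L \<Longrightarrow> supp a \<subseteq> G"
  by (rule adm_supp[OF hsums_adm[OF in_hsums]])

lemma finite_weights: "a \<in> L \<Longrightarrow> finite (w ` supp a)"
  by (rule hsums_finite_weights[OF in_hsums])

lemma proj_weights:
  assumes "a \<in> L"
  shows "proj {t. P (w t)} a \<in> L"
proof -
  let ?I = "{t. P (w t)}"
  have "proj ?I a \<in> hsums" using in_hsums[OF assms]
  proof (rule hsums_image[where \<phi> = "proj ?I"])
    fix h assume summand: "h \<in> L" "adm h" "homogeneous w h"
    have "supp h \<subseteq> ?I" if "t \<in> supp h" "P (w t)" for t
      using summand(3) that unfolding homogeneous_def by (metis mem_Collect_eq subsetI)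
    then have "supp h \<subseteq> ?I \<or> supp h \<inter> ?I = {}" by blast
    then have "proj ?I h = h \<or> proj ?I h = z0" using proj_eq_self[of h ?I] proj_eq_z0[of h ?I]
      by blast
    then show "proj ?I h \<in> hsums" using hsums.homogeneous[OF summand] hsums_z0
      by (elim disjE) simp_all
  qed (rule proj_vadd)
  then show ?thesis by (rule hsums_in_L)
qed

end


section \<open>The monomials of \<open>v\<^sub>m\<close>\<close>

lemma mem_Wset: "i \<in> Wset m k \<longleftrightarrow> (\<exists>j<k. i = m + 3 * j) \<or> (\<exists>j<k. i = m + 3 * j + 1)"
  by (auto simp: Wset_def)

lemma Wset_0 [simp]: "Wset m 0 = {}"
  by (simp add: Wset_def)

lemma Wset_Suc: "Wset m (Suc k) = insert m (insert (m + 1) (Wset (m + 3) k))"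
proof (intro set_eqI)
  fix i
  have "(\<exists>j<Suc k. i = m + 3 * j) \<longleftrightarrow> i = m \<or> (\<exists>j<k. i = m + 3 + 3 * j)"
    "(\<exists>j<Suc k. i = m + 3 * j + 1) \<longleftrightarrow> i = m + 1 \<or> (\<exists>j<k. i = m + 3 + 3 * j + 1)"
    by (subst Ex_less_Suc2; auto simp: algebra_simps)+
  then show "i \<in> Wset m (Suc k) \<longleftrightarrow> i \<in> insert m (insert (m + 1) (Wset (m + 3) k))"
    unfolding mem_Wset insert_iff by blast
qed

lemma Wset_ge: "i \<in> Wset m k \<Longrightarrow> m \<le> i"
  and Wset_less: "i \<in> Wset m k \<Longrightarrow> i < m + 3 * k"
  by (auto simp: mem_Wset)

lemma finite_Wset [simp]: "finite (Wset m k)"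
  by (rule finite_subset[of _ "{..<m + 3 * k}"]) (auto dest: Wset_less)

lemma Wset_notin: "m + 3 * k \<notin> Wset m k" "m \<notin> Wset (m + 3) k" "m + 1 \<notin> Wset (m + 3) k"
  by (auto dest: Wset_ge Wset_less)

lemma card_Wset: "card (Wset m k) = 2 * k"
  by (induction k arbitrary: m) (auto simp: Wset_Suc Wset_notin[simplified])

lemma power_weight_Wset:
  fixes x :: "'a::comm_ring_1"
  assumes "x ^ 3 = x + 2"
  shows "power_weight x (Wset m k, {m + 3 * k}) = x ^ m"
proof (induction k arbitrary: m)
  case (Suc k)
  have index_eq: "m + 3 * Suc k = m + 3 + 3 * k" by simp
  have "power_weight x (Wset m (Suc k), {m + 3 * Suc k})
      = power_weight x (Wset (m + 3) k, {m + 3 + 3 * k}) - x ^ m - x ^ (m + 1)"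
    unfolding power_weight_def Wset_Suc index_eq by (simp add: Wset_notin[simplified])
  also have "\<dots> = x ^ m * (x ^ 3 - 1 - x)" unfolding Suc by (simp add: power_add algebra_simps)
  also have "x ^ 3 - 1 - x = 1" using assms by simp
  finally show ?case by simp
qed (simp add: power_weight_def)

lemma weight_Wset: "weight (Wset m k, {m + 3 * k}) = (mu ^ m, lam ^ m)"
  by (simp add: weight_def power_weight_Wset mu_cubed lam_cubed)

lemma ex_le_iff_ex_less_Suc: "(\<exists>j\<le>k. P j) \<longleftrightarrow> P 0 \<or> (\<exists>j<k. P (Suc j))" for k :: nat
  by (metis Suc_leI le0 not0_implies_Suc Suc_le_lessD)

text \<open>Unfolding \<open>v\<^sub>m\<close> down to this monomial meets \<open>v\<^sub>m\<close>, \<open>v\<^sub>m\<^sub>+\<^sub>3\<close>, ..., \<open>v\<^sub>m\<^sub>+\<^sub>3\<^sub>k\<close>.\<close>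

lemma Wset_in_positive_cone: "(Wset m k, {m + 3 * k}) \<in> positive_cone"
proof -
  define n :: "nat \<Rightarrow> nat" where "n i = of_bool (\<exists>j\<le>k. i = m + 3 * j)" for i
  have "(Wset m k, {m + 3 * k}) \<in> weight_cone"
  proof (rule weight_coneI_counts_from)
    show "\<forall>i\<ge>m + 3 * k + 1. n i = 0" by (auto simp: n_def)
    show "\<forall>i<m. exponent (Wset m k, {m + 3 * k}) i = 0" by (auto simp: exponent_def dest: Wset_ge)
    show "\<forall>i\<ge>m. int (n i)
        = 2 * int (n (i + 3)) + int (n (i + 2)) + exponent (Wset m k, {m + 3 * k}) i"
    proof (intro allI impI)
      fix i assume "m \<le> i"
      let ?P = "\<exists>j<k. i = m + 3 * j" and ?Q = "\<exists>j<k. i = m + 3 * j + 1" and ?R = "i = m + 3 * k"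
      have "(\<exists>j\<le>k. i = m + 3 * j) \<longleftrightarrow> ?P \<or> ?R" by (auto simp: le_less)
      moreover have "(\<exists>j\<le>k. i + 3 = m + 3 * j) \<longleftrightarrow> ?P" using \<open>m \<le> i\<close>
        by (simp add: ex_le_iff_ex_less_Suc)
      moreover have "(\<exists>j\<le>k. i + 2 = m + 3 * j) \<longleftrightarrow> ?Q" using \<open>m \<le> i\<close>
        by (simp add: ex_le_iff_ex_less_Suc)
      ultimately have "n i = of_bool (?P \<or> ?R)" "n (i + 3) = of_bool ?P" "n (i + 2) = of_bool ?Q"
        unfolding n_def by simp_all
      moreover have "exponent (Wset m k, {m + 3 * k}) i = of_bool ?R - of_bool (?P \<or> ?Q)"
        by (simp add: exponent_def mem_Wset)
      moreover have "3 * j \<noteq> 3 * l + 1" "3 * l + 1 \<noteq> 3 * j" for j l :: nat by presburger+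
      then have "\<not> (?P \<and> ?Q)" "\<not> (?P \<and> ?R)" "\<not> (?Q \<and> ?R)" by auto
      ultimately show "int (n i)
          = 2 * int (n (i + 3)) + int (n (i + 2)) + exponent (Wset m k, {m + 3 * k}) i"
        by (cases ?P; cases ?Q; cases ?R) simp_all
    qed
  qed simp_all
  moreover have "0 < snd (weight (Wset m k, {m + 3 * k}))"
    using lam_bounds(1) by (simp add: weight_Wset)
  ultimately show ?thesis by (simp add: positive_cone_def)
qed

definition v_rel :: "nat \<Rightarrow> nat set rel" where
  "v_rel m = {(T, S). finite T \<and>
     (\<exists>k. m + 3 * k \<in> T \<and> Wset m k \<inter> (T - {m + 3 * k}) = {} \<and> S = Wset m k \<union> (T - {m + 3 * k}))}"

lemma v_relE:
  assumes "(T, S) \<in> v_rel m"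
  obtains k where "finite T" "m + 3 * k \<in> T" "Wset m k \<inter> (T - {m + 3 * k}) = {}"
    "S = Wset m k \<union> (T - {m + 3 * k})"
  using assms unfolding v_rel_def by blast

lemma v_rel_finite:
  assumes "(T, S) \<in> v_rel m"
  shows "finite T" "finite S"
  using assms unfolding v_rel_def by auto

lemma v_rel_remove: "finite T \<Longrightarrow> m \<in> T \<Longrightarrow> (T, T - {m}) \<in> v_rel m"
  unfolding v_rel_def by (auto intro!: exI[of _ 0])

lemma singleton_empty_in_v_rel: "({m}, {}) \<in> v_rel m"
  using v_rel_remove[of "{m}" m] by simp

lemma v_rel_step:
  assumes "(T, U) \<in> v_rel (m + 3)" "m \<notin> T" "m + 1 \<notin> T"
  shows "(T, insert m (insert (m + 1) U)) \<in> v_rel m"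
proof -
  obtain k
    where term_k: "finite T" "m + 3 + 3 * k \<in> T" "Wset (m + 3) k \<inter> (T - {m + 3 + 3 * k}) = {}"
    "U = Wset (m + 3) k \<union> (T - {m + 3 + 3 * k})" using assms(1) by (rule v_relE)
  have index_eq: "m + 3 + 3 * k = m + 3 * Suc k" by simp
  have "Wset m (Suc k) \<inter> (T - {m + 3 * Suc k}) = {}"
    using term_k(3) assms(2,3) unfolding index_eq Wset_Suc by auto
  moreover have "insert m (insert (m + 1) U) = Wset m (Suc k) \<union> (T - {m + 3 * Suc k})"
    unfolding term_k(4) index_eq Wset_Suc by auto
  ultimately show ?thesis unfolding v_rel_def using term_k(1,2) unfolding index_eq by blast
qed

lemma v_rel_cases [consumes 1, case_names remove step]:
  assumes "(T, S) \<in> v_rel m"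
  obtains "m \<in> T" "S = T - {m}"
    | U where "m \<notin> T" "m + 1 \<notin> T" "(T, U) \<in> v_rel (m + 3)" "S = insert m (insert (m + 1) U)"
proof -
  obtain k where term_k: "finite T" "m + 3 * k \<in> T" "Wset m k \<inter> (T - {m + 3 * k}) = {}"
    "S = Wset m k \<union> (T - {m + 3 * k})" using assms by (rule v_relE)
  show ?thesis
  proof (cases k)
    case 0
    with term_k show ?thesis using that(1) by simp
  next
    case (Suc l)
    have index_eq: "m + 3 * Suc l = m + 3 + 3 * l" by simp
    have notin: "m \<notin> T" "m + 1 \<notin> T" and disj: "Wset (m + 3) l \<inter> (T - {m + 3 + 3 * l}) = {}"
      using term_k(3) unfolding Suc Wset_Suc index_eq by auto
    have "(T, Wset (m + 3) l \<union> (T - {m + 3 + 3 * l})) \<in> v_rel (m + 3)"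
      using term_k(1,2) disj unfolding Suc index_eq v_rel_def by blast
    moreover have "S = insert m (insert (m + 1) (Wset (m + 3) l \<union> (T - {m + 3 + 3 * l})))"
      unfolding term_k(4) Suc Wset_Suc index_eq by auto
    ultimately show ?thesis using that(2) notin by blast
  qed
qed

lemma v_rel_index_unique:
  assumes "m + 3 * k \<in> T" "Wset m k \<inter> (T - {m + 3 * k}) = {}"
    and "m + 3 * l \<in> T" "Wset m l \<inter> (T - {m + 3 * l}) = {}"
  shows "k = l"
proof (rule ccontr)
  assume "k \<noteq> l"
  then have "m + 3 * k \<in> Wset m l \<or> m + 3 * l \<in> Wset m k"
    unfolding mem_Wset by (metis linorder_neqE_nat)
  then show False using assms \<open>k \<noteq> l\<close> by auto
qed

lemma single_valued_v_rel: "single_valued (v_rel m)"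
proof (rule single_valuedI)
  fix T S S' assume "(T, S) \<in> v_rel m" "(T, S') \<in> v_rel m"
  then show "S = S'" using v_rel_index_unique[of m _ T] by (elim v_relE) metis
qed

lemma v_rel_weight:
  assumes "(T, S) \<in> v_rel m"
  shows "(S, T) \<in> positive_cone" "weight (S, T) = (mu ^ m, lam ^ m)"
proof -
  obtain k where term_k: "m + 3 * k \<in> T" "Wset m k \<inter> (T - {m + 3 * k}) = {}"
    "S = Wset m k \<union> (T - {m + 3 * k})" using assms by (rule v_relE)
  have "exponent (S, T) i = exponent (Wset m k, {m + 3 * k}) i + exponent ({}, {}) i" for i
    using term_k Wset_notin(1)[of m k]
    by (cases "i = m + 3 * k"; cases "i \<in> Wset m k") (auto simp: exponent_def)
  moreover have "finite (fst (S, T))" "finite (snd (S, T))"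
    using v_rel_finite[OF assms] by simp_all
  ultimately have "(S, T) \<in> weight_cone"
    "weight (S, T) = weight (Wset m k, {m + 3 * k}) + weight ({}, {})"
    using weight_cone_add[OF positive_coneD(3)[OF Wset_in_positive_cone] empty_in_weight_cone]
    by blast+
  then show "weight (S, T) = (mu ^ m, lam ^ m)" "(S, T) \<in> positive_cone"
    using lam_bounds(1) by (simp_all add: weight_Wset positive_cone_def)
qed

lemma v_rel_odd:
  assumes "(T, S) \<in> v_rel m"
  shows "odd (card T + card S)"
proof -
  obtain k where term_k: "finite T" "m + 3 * k \<in> T" "Wset m k \<inter> (T - {m + 3 * k}) = {}"
    "S = Wset m k \<union> (T - {m + 3 * k})" using assms by (rule v_relE)
  have "card S = 2 * k + card (T - {m + 3 * k})"
    unfolding term_k(4) using term_k(1,3) by (subst card_Un_disjoint) (auto simp: card_Wset)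
  moreover have "card T = Suc (card (T - {m + 3 * k}))" using term_k(1,2) by (rule card.remove)
  ultimately show ?thesis by simp
qed

lemma v_rel_below: "(T, S) \<in> v_rel m \<Longrightarrow> j < m \<Longrightarrow> j \<in> T \<longleftrightarrow> j \<in> S"
  unfolding v_rel_def by (auto dest: Wset_ge)

lemma
  assumes "(T, S) \<in> v_rel m" "j < m"
  shows v_rel_insert_below: "(insert j T, insert j S) \<in> v_rel m"
    and v_rel_delete_below: "(T - {j}, S - {j}) \<in> v_rel m"
proof -
  obtain k where term_k: "finite T" "m + 3 * k \<in> T" "Wset m k \<inter> (T - {m + 3 * k}) = {}"
    "S = Wset m k \<union> (T - {m + 3 * k})" using assms(1) by (rule v_relE)
  have j_notin: "j \<notin> Wset m k" "j \<noteq> m + 3 * k" using assms(2) by (auto dest: Wset_ge)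
  then have "m + 3 * k \<in> insert j T" "Wset m k \<inter> (insert j T - {m + 3 * k}) = {}"
    "insert j S = Wset m k \<union> (insert j T - {m + 3 * k})" using term_k by auto
  then show "(insert j T, insert j S) \<in> v_rel m" unfolding v_rel_def using term_k(1) by blast
  have "m + 3 * k \<in> T - {j}" "Wset m k \<inter> (T - {j} - {m + 3 * k}) = {}"
    "S - {j} = Wset m k \<union> (T - {j} - {m + 3 * k})" using term_k j_notin by auto
  then show "(T - {j}, S - {j}) \<in> v_rel m" unfolding v_rel_def using term_k(1) by blast
qed

text \<open>The composition lemmas below are \<open>v\<^sub>m\<^sup>2 = \<plusminus>x\<^sub>m\<^sub>+\<^sub>1 v\<^sub>m\<^sub>+\<^sub>3\<close> and \<open>[v\<^sub>m\<^sub>+\<^sub>1, v\<^sub>m\<^sup>2] = \<plusminus>v\<^sub>m\<^sub>+\<^sub>3\<close> on the level of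
  supports, so no signs have to be computed.\<close>

lemma v_rel_twice:
  assumes TU: "(T, U) \<in> v_rel m" and US: "(U, S) \<in> v_rel m"
  shows "m + 1 \<notin> T" "\<exists>V. S = insert (m + 1) V \<and> (T, V) \<in> v_rel (m + 3)"
proof -
  have "m + 1 \<notin> T \<and> (\<exists>V. S = insert (m + 1) V \<and> (T, V) \<in> v_rel (m + 3))"
    using TU
  proof (cases rule: v_rel_cases)
    case remove
    with US obtain V
      where second_step: "m + 1 \<notin> U" "(U, V) \<in> v_rel (m + 3)" "S = insert m (insert (m + 1) V)"
      by (cases rule: v_rel_cases) auto
    have "(insert m U, insert m V) \<in> v_rel (m + 3)"
      by (rule v_rel_insert_below[OF second_step(2)]) simp
    moreover have "insert m U = T" using remove by auto
    moreover have "S = insert (m + 1) (insert m V)" unfolding second_step(3)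
      by (rule insert_commute)
    ultimately show ?thesis using second_step(1) by auto
  next
    case (step V)
    have "m \<notin> V" using v_rel_below[OF step(3), of m] step(1) by simp
    moreover have "S = U - {m}" using US step(4) by (cases rule: v_rel_cases) auto
    ultimately have "S = insert (m + 1) V" using step(4) by auto
    with step show ?thesis by blast
  qed
  then show "m + 1 \<notin> T" "\<exists>V. S = insert (m + 1) V \<and> (T, V) \<in> v_rel (m + 3)" by blast+
qed

lemma insert_v_rel_in_comp_self:
  assumes TS: "(T, S) \<in> v_rel (m + 3)" and notin: "m + 1 \<notin> T"
  shows "(T, insert (m + 1) S) \<in> v_rel m O v_rel m"
proof -
  have m_iff: "m \<in> T \<longleftrightarrow> m \<in> S" by (rule v_rel_below[OF TS]) simp
  show ?thesis
  proof (cases "m \<in> T")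
    case True
    have "(T - {m}, S - {m}) \<in> v_rel (m + 3)" by (rule v_rel_delete_below[OF TS]) simp
    then have "(T - {m}, insert m (insert (m + 1) (S - {m}))) \<in> v_rel m"
      using notin by (intro v_rel_step) auto
    moreover have "insert m (insert (m + 1) (S - {m})) = insert (m + 1) S" using True m_iff by auto
    ultimately have "(T - {m}, insert (m + 1) S) \<in> v_rel m" by (simp only:)
    with v_rel_remove[OF v_rel_finite(1)[OF TS] True] show ?thesis by (rule relcompI)
  next
    case False
    let ?U = "insert m (insert (m + 1) S)"
    have "(T, ?U) \<in> v_rel m" using TS False notin by (rule v_rel_step)
    moreover have "(?U, ?U - {m}) \<in> v_rel m" using v_rel_finite(2)[OF TS]
      by (intro v_rel_remove) auto
    moreover have "?U - {m} = insert (m + 1) S" using False m_iff by auto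
    ultimately show ?thesis by (metis relcompI)
  qed
qed

lemma v_rel_comp_self:
  "v_rel m O v_rel m = {(T, insert (m + 1) S) | T S. (T, S) \<in> v_rel (m + 3) \<and> m + 1 \<notin> T}"
proof (intro equalityI subsetI)
  fix p assume "p \<in> v_rel m O v_rel m"
  then obtain T U S where p_eq: "p = (T, S)" and "(T, U) \<in> v_rel m" "(U, S) \<in> v_rel m"
    by (rule relcompE)
  with v_rel_twice[OF this(2,3)]
  show "p \<in> {(T, insert (m + 1) S) | T S. (T, S) \<in> v_rel (m + 3) \<and> m + 1 \<notin> T}" unfolding p_eq
    by blast
next
  fix p assume "p \<in> {(T, insert (m + 1) S) | T S. (T, S) \<in> v_rel (m + 3) \<and> m + 1 \<notin> T}"
  then obtain T S where p_eq: "p = (T, insert (m + 1) S)" and "(T, S) \<in> v_rel (m + 3)" "m + 1 \<notin> T"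
    by blast
  then show "p \<in> v_rel m O v_rel m" unfolding p_eq by (intro insert_v_rel_in_comp_self)
qed

lemma v_rel_comp_self_left:
  "(v_rel m O v_rel m) O v_rel (m + 1) = {(T, S) \<in> v_rel (m + 3). m + 1 \<notin> T}"
proof -
  have remove: "(insert (m + 1) U, S) \<in> v_rel (m + 1) \<longleftrightarrow> S = U"
    if TU: "(T, U) \<in> v_rel (m + 3)" and notin: "m + 1 \<notin> T" for T U S
  proof
    have "m + 1 \<notin> U" using v_rel_below[OF TU, of "m + 1"] notin by simp
    then have delete_insert: "insert (m + 1) U - {m + 1} = U" by auto
    show "S = U" if "(insert (m + 1) U, S) \<in> v_rel (m + 1)"
      using that by (cases rule: v_rel_cases) (use delete_insert in blast)+
    have "(insert (m + 1) U, insert (m + 1) U - {m + 1}) \<in> v_rel (m + 1)"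
      using v_rel_finite(2)[OF TU] by (intro v_rel_remove) auto
    then show "(insert (m + 1) U, S) \<in> v_rel (m + 1)" if "S = U" using that delete_insert by simp
  qed
  have "(T, S) \<in> (v_rel m O v_rel m) O v_rel (m + 1) \<longleftrightarrow> (T, S) \<in> v_rel (m + 3) \<and> m + 1 \<notin> T" for T S
  proof -
    have "(T, S) \<in> (v_rel m O v_rel m) O v_rel (m + 1) \<longleftrightarrow>
        (\<exists>U. (T, U) \<in> v_rel (m + 3) \<and> m + 1 \<notin> T \<and> (insert (m + 1) U, S) \<in> v_rel (m + 1))"
      unfolding v_rel_comp_self unfolding relcomp_unfold by auto
    also have "\<dots> \<longleftrightarrow> (T, S) \<in> v_rel (m + 3) \<and> m + 1 \<notin> T" using remove by metis
    finally show ?thesis .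
  qed
  then show ?thesis by (intro set_eqI) (clarsimp split: prod.split)
qed

lemma v_rel_comp_self_right:
  "v_rel (m + 1) O (v_rel m O v_rel m) = {(T, S) \<in> v_rel (m + 3). m + 1 \<in> T}"
proof (intro equalityI subsetI)
  fix p assume "p \<in> v_rel (m + 1) O (v_rel m O v_rel m)"
  then obtain T V U where p_eq: "p = (T, insert (m + 1) U)" and TV: "(T, V) \<in> v_rel (m + 1)"
    and notin: "m + 1 \<notin> V" and VU: "(V, U) \<in> v_rel (m + 3)"
    unfolding v_rel_comp_self by blast
  have removed: "m + 1 \<in> T \<and> V = T - {m + 1}" using TV notin by (cases rule: v_rel_cases) blast+
  have "(insert (m + 1) V, insert (m + 1) U) \<in> v_rel (m + 3)"
    by (rule v_rel_insert_below[OF VU]) simp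
  moreover have "insert (m + 1) V = T" using removed by auto
  ultimately show "p \<in> {(T, S) \<in> v_rel (m + 3). m + 1 \<in> T}" using removed p_eq by simp
next
  fix p assume "p \<in> {(T, S) \<in> v_rel (m + 3). m + 1 \<in> T}"
  then obtain T S where p_eq: "p = (T, S)" and TS: "(T, S) \<in> v_rel (m + 3)" and removed: "m + 1 \<in> T"
    by blast
  have "(T - {m + 1}, S - {m + 1}) \<in> v_rel (m + 3)" by (rule v_rel_delete_below[OF TS]) simp
  then have "(T - {m + 1}, insert (m + 1) (S - {m + 1})) \<in> v_rel m O v_rel m"
    unfolding v_rel_comp_self by blast
  moreover have "insert (m + 1) (S - {m + 1}) = S" using v_rel_below[OF TS, of "m + 1"] removed
    by auto
  ultimately show "p \<in> v_rel (m + 1) O (v_rel m O v_rel m)"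
    using v_rel_remove[OF v_rel_finite(1)[OF TS] removed] unfolding p_eq by (metis relcompI)
qed


section \<open>Composition of endomorphisms\<close>

lemma supp_ocomp_subset: "supp (ocomp a b) \<subseteq> supp b O supp a"
proof (clarsimp simp: in_supp_iff)
  fix T S assume "ocomp a b (T, S) \<noteq> 0"
  then obtain U where "b (T, U) * a (U, S) \<noteq> 0"
    unfolding ocomp_def prod.case by (meson sum.neutral)
  then show "(T, S) \<in> supp b O supp a" by (auto simp: supp_def)
qed

lemma supp_ocomp:
  assumes "single_valued (supp b)"
  shows "supp (ocomp a b) = supp b O supp a"
proof (intro equalityI[OF supp_ocomp_subset] subsetI; clarify)
  fix T U S assume path: "(T, U) \<in> supp b" "(U, S) \<in> supp a"
  then have "{U. b (T, U) \<noteq> 0} = {U}"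
    using assms by (auto simp: in_supp_iff dest: single_valuedD)
  then show "(T, S) \<in> supp (ocomp a b)" using path by (simp add: ocomp_def in_supp_iff)
qed

lemma supp_vsub_disjoint:
  assumes "supp a \<inter> supp b = {}"
  shows "supp (vsub a b) = supp a \<union> supp b"
proof (intro equalityI[OF supp_vsub] subsetI)
  fix t assume "t \<in> supp a \<union> supp b"
  then have "a t \<noteq> 0 \<and> b t = 0 \<or> a t = 0 \<and> b t \<noteq> 0"
    using assms in_supp_iff[of t a] in_supp_iff[of t b] by blast
  then show "t \<in> supp (vsub a b)" by (auto simp: in_supp_iff vsub_def)
qed

lemma supp_commutator_square:
  assumes supp_a: "supp a = v_rel m" and supp_b: "supp b = v_rel (m + 1)"
  shows "supp (vsub (ocomp b (ocomp a a)) (ocomp (ocomp a a) b)) = v_rel (m + 3)"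
proof -
  have supp_square: "supp (ocomp a a) = v_rel m O v_rel m"
    using supp_ocomp[of a a] single_valued_v_rel by (simp add: supp_a)
  have "single_valued (supp (ocomp a a))"
    unfolding supp_square by (intro single_valued_relcomp single_valued_v_rel)
  then have left: "supp (ocomp b (ocomp a a)) = {(T, S) \<in> v_rel (m + 3). m + 1 \<notin> T}"
    using supp_ocomp[of "ocomp a a" b] unfolding supp_square supp_b v_rel_comp_self_left by blast
  have right: "supp (ocomp (ocomp a a) b) = {(T, S) \<in> v_rel (m + 3). m + 1 \<in> T}"
    using supp_ocomp[of b "ocomp a a"] single_valued_v_rel
    unfolding supp_square supp_b v_rel_comp_self_right by blast
  have "supp (vsub (ocomp b (ocomp a a)) (ocomp (ocomp a a) b))
      = supp (ocomp b (ocomp a a)) \<union> supp (ocomp (ocomp a a) b)"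
    by (rule supp_vsub_disjoint) (auto simp: left right)
  also have "\<dots> = v_rel (m + 3)" unfolding left right by auto
  finally show ?thesis .
qed

lemma ocomp_lmulop_dop_nonzero_iff:
  assumes "j \<in> T"
  shows "ocomp (lmulop W) (dop j) (T, S) \<noteq> (0 :: 'k::field)
    \<longleftrightarrow> finite T \<and> W \<inter> (T - {j}) = {} \<and> S = W \<union> (T - {j})"
proof -
  have "single_valued (supp (dop j :: 'k endo))"
    by (auto simp: single_valued_def in_supp_iff dop_def split: if_splits)
  then have "ocomp (lmulop W) (dop j) (T, S) \<noteq> (0 :: 'k)
      \<longleftrightarrow> (T, S) \<in> supp (dop j :: 'k endo) O supp (lmulop W :: 'k endo)"
    using supp_ocomp[of "dop j :: 'k endo" "lmulop W"] by (simp only: in_supp_iff[symmetric])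
  also have "\<dots> \<longleftrightarrow> finite T \<and> W \<inter> (T - {j}) = {} \<and> S = W \<union> (T - {j})"
    using assms
    by (auto simp: relcomp_unfold in_supp_iff dop_def lmulop_def gsgn_def split: if_splits)
  finally show ?thesis .
qed

lemma supp_vop: "supp (vop m :: 'k::field endo) = v_rel m"
proof (intro set_eqI; clarify)
  fix T S
  let ?term = "\<lambda>k. ocomp (lmulop (Wset m k)) (dop (m + 3 * k)) (T, S) :: 'k"
  have vop_eq_sum: "vop m (T, S) = (\<Sum>k\<in>{k. m + 3 * k \<in> T}. ?term k)" by (simp add: vop_def)
  note term_nonzero = ocomp_lmulop_dop_nonzero_iff[where 'k = 'k]
  show "(T, S) \<in> supp (vop m :: 'k endo) \<longleftrightarrow> (T, S) \<in> v_rel m"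
  proof
    assume "(T, S) \<in> supp (vop m :: 'k endo)"
    then obtain k where "m + 3 * k \<in> T" "?term k \<noteq> 0"
      unfolding in_supp_iff vop_eq_sum by (metis (mono_tags, lifting) mem_Collect_eq sum.neutral)
    then show "(T, S) \<in> v_rel m" using term_nonzero unfolding v_rel_def by blast
  next
    assume "(T, S) \<in> v_rel m"
    then obtain k where term_k: "finite T" "m + 3 * k \<in> T" "Wset m k \<inter> (T - {m + 3 * k}) = {}"
      "S = Wset m k \<union> (T - {m + 3 * k})" by (rule v_relE)
    have finite_terms: "finite {k. m + 3 * k \<in> T}"
      using finite_vimageI[OF term_k(1), of "\<lambda>k. m + 3 * k"] by (simp add: inj_on_def vimage_def)
    have "?term l = 0" if "m + 3 * l \<in> T" "l \<noteq> k" for l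
      using term_nonzero[OF that(1)] v_rel_index_unique[OF term_k(2,3) that(1)] that(2) by blast
    then have "vop m (T, S) = ?term k"
      unfolding vop_eq_sum using finite_terms term_k(2)
      by (subst sum.remove[of _ k]) (auto intro: sum.neutral)
    then show "(T, S) \<in> supp (vop m :: 'k endo)"
      using term_nonzero[OF term_k(2)] term_k unfolding in_supp_iff by simp
  qed
qed

definition row_finite :: "'k::field endo \<Rightarrow> bool" where
  "row_finite a \<longleftrightarrow> (\<forall>T. finite (supp a `` {T}))"

lemma row_finite_z0 [simp]: "row_finite z0"
  by (simp add: row_finite_def)

lemma row_finite_subset: "row_finite a \<Longrightarrow> supp b \<subseteq> supp a \<Longrightarrow> row_finite b"
  unfolding row_finite_def by (meson Image_mono finite_subset order_refl)

lemma row_finite_vadd: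
  assumes "row_finite a" "row_finite b"
  shows "row_finite (vadd a b)"
  unfolding row_finite_def
proof
  fix T
  have "supp (vadd a b) `` {T} \<subseteq> supp a `` {T} \<union> supp b `` {T}" using supp_vadd[of a b] by blast
  then show "finite (supp (vadd a b) `` {T})"
    using assms unfolding row_finite_def by (meson finite_UnI finite_subset)
qed

lemma row_finite_ocomp:
  assumes "row_finite a" "row_finite b"
  shows "row_finite (ocomp a b)"
  unfolding row_finite_def
proof
  fix T
  have "supp (ocomp a b) `` {T} \<subseteq> (\<Union>U\<in>supp b `` {T}. supp a `` {U})"
    using supp_ocomp_subset[of a b] by blast
  moreover have "finite (\<Union>U\<in>supp b `` {T}. supp a `` {U})"
    using assms unfolding row_finite_def by (intro finite_UN_I) auto
  ultimately show "finite (supp (ocomp a b) `` {T})" by (rule finite_subset)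
qed

lemma row_finite_if_single_valued:
  assumes "single_valued (supp a)"
  shows "row_finite a"
  unfolding row_finite_def
proof
  fix T
  show "finite (supp a `` {T})"
  proof (cases "supp a `` {T} = {}")
    case False
    then obtain U where "(T, U) \<in> supp a" by blast
    then have "supp a `` {T} \<subseteq> {U}" using assms by (auto dest: single_valuedD)
    then show ?thesis by (rule finite_subset) simp
  qed simp
qed

lemma ocomp_vadd_left: "ocomp (vadd a a') b = vadd (ocomp a b) (ocomp a' b)"
  by (auto simp: ocomp_def vadd_def fun_eq_iff distrib_left sum.distrib)

lemma ocomp_vadd_right:
  assumes "row_finite b" "row_finite b'"
  shows "ocomp a (vadd b b') = vadd (ocomp a b) (ocomp a b')"
proof (intro ext; clarify)
  fix T S
  define F where "F = supp b `` {T} \<union> supp b' `` {T}"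
  have finite_F: "finite F" using assms by (simp add: F_def row_finite_def)
  have ocomp_eq_sum: "ocomp a c (T, S) = (\<Sum>U\<in>F. c (T, U) * a (U, S))"
    if "supp c \<subseteq> supp b \<union> supp b'" for c
    unfolding ocomp_def prod.case
    by (rule sum.mono_neutral_left) (use finite_F that in \<open>auto simp: F_def supp_def\<close>)
  show "ocomp a (vadd b b') (T, S) = vadd (ocomp a b) (ocomp a b') (T, S)"
    unfolding vadd_def[of "ocomp a b"] ocomp_eq_sum[OF supp_vadd] ocomp_eq_sum[OF Un_upper1]
      ocomp_eq_sum[OF Un_upper2]
    by (simp add: vadd_def distrib_right sum.distrib)
qed

lemma ocomp_z0_left: "ocomp z0 b = z0"
  by (simp add: ocomp_def z0_def fun_eq_iff)

definition even_entries :: "(nat set \<times> nat set) set" where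
  "even_entries = {(T, S). even (card T + card S)}"

lemma pe_op_eq_proj: "pe_op = proj even_entries"
  by (auto simp: pe_op_def proj_def even_entries_def fun_eq_iff)

lemma bracket_op_eq:
  "bracket_op a b = vadd (vadd (ocomp a b) (vsc (- 1) (ocomp b a)))
     (vsc 2 (ocomp (proj (- even_entries) b) (proj (- even_entries) a)))"
proof -
  have "vsub c (pe_op c) = proj (- even_entries) c" for c :: "'a endo"
    by (auto simp: pe_op_eq_proj proj_def vsub_def)
  then show ?thesis by (simp add: bracket_op_def vsub_conv_vadd)
qed

lemma row_finite_proj: "row_finite a \<Longrightarrow> row_finite (proj I a)"
  by (erule row_finite_subset) (simp add: supp_proj)

lemma row_finite_bracket_op: "row_finite a \<Longrightarrow> row_finite b \<Longrightarrow> row_finite (bracket_op a b)"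
  unfolding bracket_op_eq
  by (intro row_finite_vadd row_finite_ocomp row_finite_proj row_finite_subset[OF _ supp_vsc])

lemma bracket_op_vadd_left:
  assumes "row_finite a" "row_finite a'"
  shows "bracket_op (vadd a a') b = vadd (bracket_op a b) (bracket_op a' b)"
  unfolding bracket_op_eq proj_vadd ocomp_vadd_left
    ocomp_vadd_right[OF assms] ocomp_vadd_right[OF assms[THEN row_finite_proj]]
  by (simp add: vadd_def vsc_def fun_eq_iff algebra_simps)

lemma bracket_op_vadd_right:
  assumes "row_finite b" "row_finite b'"
  shows "bracket_op a (vadd b b') = vadd (bracket_op a b) (bracket_op a b')"
  unfolding bracket_op_eq proj_vadd ocomp_vadd_left ocomp_vadd_right[OF assms]
  by (simp add: vadd_def vsc_def fun_eq_iff algebra_simps)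

lemma bracket_op_odd:
  assumes "pe_op a = z0" "pe_op b = z0"
  shows "bracket_op a b = vadd (ocomp a b) (ocomp b a)"
proof -
  have odd: "vsub a (pe_op a) = a" "vsub b (pe_op b) = b" using assms
    by (simp_all add: vsub_def z0_def)
  show ?thesis unfolding bracket_op_def odd by (simp add: vadd_def vsub_def vsc_def fun_eq_iff)
qed

lemma bracket_op_even_right:
  assumes "supp b \<subseteq> even_entries"
  shows "bracket_op a b = vsub (ocomp a b) (ocomp b a)"
proof -
  have "proj (- even_entries) b = z0" by (rule proj_eq_z0) (use assms in auto)
  then show ?thesis
    unfolding bracket_op_eq
    by (simp add: ocomp_z0_left vsub_conv_vadd) (simp add: vadd_def vsc_def z0_def)
qed

lemma ocomp_square_vadd:
  assumes "row_finite a" "row_finite b" "pe_op a = z0" "pe_op b = z0"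
  shows "ocomp (vadd a b) (vadd a b) = vadd (ocomp a a) (vadd (bracket_op a b) (ocomp b b))"
  unfolding bracket_op_odd[OF assms(3,4)] ocomp_vadd_left ocomp_vadd_right[OF assms(1,2)]
  by (simp add: vadd_def fun_eq_iff algebra_simps)


section \<open>The Lie superalgebra and the associative algebra\<close>

definition op_cone :: "(nat set \<times> nat set) set" where
  "op_cone = {(T, S). (S, T) \<in> positive_cone}"

definition op_weight :: "nat set \<times> nat set \<Rightarrow> complex \<times> real" where
  "op_weight t = weight (prod.swap t)"

lemma op_cone_comp:
  assumes "(T, U) \<in> op_cone" "(U, S) \<in> op_cone"
  shows "(T, S) \<in> op_cone" "op_weight (T, S) = op_weight (U, S) + op_weight (T, U)"
proof -
  have in_cone: "(S, U) \<in> positive_cone" "(U, T) \<in> positive_cone" using assms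
    by (simp_all add: op_cone_def)
  have finite_ST: "finite (fst (S, T))" "finite (snd (S, T))"
    using positive_coneD(1,2)[OF in_cone(1)] positive_coneD(1,2)[OF in_cone(2)]
    by simp_all
  have "exponent (S, T) i = exponent (S, U) i + exponent (U, T) i" for i by (simp add: exponent_def)
  from positive_cone_add[OF in_cone finite_ST this]
  show "(T, S) \<in> op_cone" "op_weight (T, S) = op_weight (U, S) + op_weight (T, U)"
    by (simp_all add: op_cone_def op_weight_def)
qed

lemma ocomp_supported: "product_supported op_cone (weight_additive op_weight) a b (ocomp a b)"
proof (rule product_supportedI)
  fix t assume supp: "supp a \<subseteq> op_cone" "supp b \<subseteq> op_cone" and "t \<in> supp (ocomp a b)"
  then obtain T U S where path: "t = (T, S)" "(T, U) \<in> supp b" "(U, S) \<in> supp a"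
    using supp_ocomp_subset[of a b] by blast
  then have "(T, U) \<in> op_cone" "(U, S) \<in> op_cone" using supp by blast+
  from op_cone_comp[OF this]
  show "t \<in> op_cone \<and> (\<exists>s\<in>supp a. \<exists>u\<in>supp b. weight_additive op_weight t s u)"
    using path unfolding weight_additive_def by blast
qed

lemma ocomp_supported_swap: "product_supported op_cone (weight_additive op_weight) a b (ocomp b a)"
  by (rule product_supported_swap[OF ocomp_supported]) (simp add: weight_additive_def add.commute)

lemma bracket_op_supported:
  "product_supported op_cone (weight_additive op_weight) a b (bracket_op a b)"
  unfolding bracket_op_eq
proof (intro product_supported_vadd product_supported_vsc ocomp_supported ocomp_supported_swap)
  show "product_supported op_cone (weight_additive op_weight) a b
      (ocomp (proj (- even_entries) b) (proj (- even_entries) a))"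
    by (rule product_supported_subset[OF ocomp_supported_swap]) (simp_all add: supp_proj)
qed

lemma supp_eq_v_rel_in_op_cone: "supp a = v_rel m \<Longrightarrow> supp a \<subseteq> op_cone"
  using v_rel_weight(1) by (auto simp: op_cone_def)

lemma op_weight_v_rel: "t \<in> v_rel m \<Longrightarrow> op_weight t = (mu ^ m, lam ^ m)"
  using v_rel_weight(2) by (cases t) (simp add: op_weight_def)

lemma three_step_induct [case_names 0 1 2 step]:
  fixes n :: nat
  assumes "P 0" "P 1" "P 2" and step: "\<And>m. P m \<Longrightarrow> P (m + 1) \<Longrightarrow> P (m + 3)"
  shows "P n"
proof (induction n rule: less_induct)
  case (less n)
  show ?case
  proof (cases "n < 3")
    case True
    then have "n = 0 \<or> n = 1 \<or> n = 2" by linarith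
    then show ?thesis using assms(1-3) by blast
  next
    case False
    then have "P (n - 3 + 3)" by (intro step less.IH) simp_all
    with False show ?thesis by simp
  qed
qed

locale v_algebra =
  fixes Ev pe ops sq and L :: "'k::field endo set"
  assumes L_eq: "L = generated pe ops sq {vop 0, vop 1, vop 2}"
    and pe_eq: "pe = proj Ev"
    and row_finite_op: "f \<in> set ops \<Longrightarrow> row_finite a \<Longrightarrow> row_finite b \<Longrightarrow> row_finite (f a b)"
    and row_finite_sq: "row_finite a \<Longrightarrow> row_finite (sq a)"
    and op_vadd_left: "f \<in> set ops \<Longrightarrow> row_finite a \<Longrightarrow> row_finite a' \<Longrightarrow>
      f (vadd a a') b = vadd (f a b) (f a' b)"
    and op_vadd_right: "f \<in> set ops \<Longrightarrow> row_finite b \<Longrightarrow> row_finite b' \<Longrightarrow>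
      f a (vadd b b') = vadd (f a b) (f a b')"
    and weight_additive_operations:
      "operations_supported op_cone (weight_additive op_weight) ops sq"
    and sq_vadd: "row_finite a \<Longrightarrow> row_finite b \<Longrightarrow> pe a = z0 \<Longrightarrow> pe b = z0 \<Longrightarrow>
      \<exists>c\<in>insert z0 ((\<lambda>f. f a b) ` set ops). sq (vadd a b) = vadd (sq a) (vadd c (sq b))"
    and commutator_square: "a \<in> L \<Longrightarrow> b \<in> L \<Longrightarrow> supp a = v_rel m \<Longrightarrow> supp b = v_rel (m + 1) \<Longrightarrow>
      vsub (ocomp b (ocomp a a)) (ocomp (ocomp a a) b) \<in> L"
begin

sublocale hom: homogeneous_generators Ev pe ops sq "{vop 0, vop 1, vop 2}" L op_weight op_cone
  "\<lambda>a. row_finite a \<and> supp a \<subseteq> op_cone"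
proof
  show "row_finite (z0 :: 'k endo) \<and> supp (z0 :: 'k endo) \<subseteq> op_cone" by simp
  fix a b :: "'k endo"
  show "row_finite (vadd a b) \<and> supp (vadd a b) \<subseteq> op_cone"
    if "row_finite a \<and> supp a \<subseteq> op_cone" "row_finite b \<and> supp b \<subseteq> op_cone"
    using that row_finite_vadd[of a b] order_trans[OF supp_vadd[of a b], of op_cone] by simp
  show "row_finite b \<and> supp b \<subseteq> op_cone" if "row_finite a \<and> supp a \<subseteq> op_cone" "supp b \<subseteq> supp a"
    using that row_finite_subset[of a b] order_trans[of "supp b" "supp a" op_cone] by simp
  show "row_finite (f a b) \<and> supp (f a b) \<subseteq> op_cone"
    if "f \<in> set ops" "row_finite a \<and> supp a \<subseteq> op_cone" "row_finite b \<and> supp b \<subseteq> op_cone" for f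
    using that row_finite_op
      product_supported_in_carrier[OF
        operations_supported_op[OF weight_additive_operations that(1)]]
    by simp
  show "row_finite (sq a) \<and> supp (sq a) \<subseteq> op_cone" if "row_finite a \<and> supp a \<subseteq> op_cone"
    using that row_finite_sq
      product_supported_in_carrier[OF operations_supported_sq[OF weight_additive_operations]]
    by simp
  show "(row_finite a \<and> supp a \<subseteq> op_cone) \<and> homogeneous op_weight a"
    if generator: "a \<in> {vop 0, vop 1, vop 2}"
  proof -
    obtain m where "a = vop m" using generator by blast
    then have supp_a: "supp a = v_rel m" by (simp add: supp_vop)
    then have "homogeneous op_weight a" by (simp add: homogeneous_def op_weight_v_rel)
    then show ?thesis
      using supp_a supp_eq_v_rel_in_op_cone[OF supp_a]
        row_finite_if_single_valued[of a] single_valued_v_rel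
      by simp
  qed
qed (fact L_eq pe_eq weight_additive_operations | (rule sq_vadd; simp)
    | simp add: op_vadd_left op_vadd_right)+

lemma ex_supp_eq_v_rel: "\<exists>e\<in>L. supp e = v_rel n"
proof (induction n rule: three_step_induct)
  case 0
  have "vop 0 \<in> L" unfolding L_eq by (rule subsetD[OF generated_superset]) simp
  then show ?case by (intro bexI[of _ "vop 0"] supp_vop)
next
  case 1
  have "vop 1 \<in> L" unfolding L_eq by (rule subsetD[OF generated_superset]) simp
  then show ?case by (intro bexI[of _ "vop 1"] supp_vop)
next
  case 2
  have "vop 2 \<in> L" unfolding L_eq by (rule subsetD[OF generated_superset]) simp
  then show ?case by (intro bexI[of _ "vop 2"] supp_vop)
next
  case (step m)
  then obtain a b where ab_v: "a \<in> L" "b \<in> L" "supp a = v_rel m" "supp b = v_rel (m + 1)" by blast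
  from supp_commutator_square[OF ab_v(3,4)] commutator_square[OF ab_v] show ?case by (rule bexI)
qed

sublocale paraboloid_algebra pe ops sq L op_cone "\<lambda>_. False" "{}" op_weight
proof
  show "operations_supported op_cone (double_additive (\<lambda>_. False) {} op_weight) ops sq"
    by (rule operations_supported_mono[OF weight_additive_operations double_additive_trivial])
  show "proj {t. 0 < side s (fst (op_weight t)) \<or> t \<in> {}} a \<in> L" if "a \<in> L" for a s
    using hom.proj_weights[OF that, of "\<lambda>w. 0 < side s (fst w)"] by simp
  show "op_weight t \<in> paraboloid" if "t \<in> op_cone" for t
    using that weight_cone_paraboloid positive_coneD(3) by (auto simp: op_cone_def op_weight_def)
  show "side s (fst (op_weight t)) \<noteq> 0" if "a \<in> L" "t \<in> supp a" "s \<in> generic_slopes" for a t s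
    using that hom.supp_in_G[of a] positive_cone_side_nonzero[of "prod.swap t" s]
    by (auto simp: op_cone_def op_weight_def)
  show "\<exists>e\<in>L. e \<noteq> z0 \<and> (\<forall>t\<in>supp e. t \<notin> {} \<and> fst (op_weight t) = mu ^ n)" for n
  proof -
    obtain e where e_v: "e \<in> L" "supp e = v_rel n" using ex_supp_eq_v_rel by blast
    then have "e \<noteq> z0" using singleton_empty_in_v_rel[of n] by auto
    then show ?thesis using e_v op_weight_v_rel by auto
  qed
qed (use hom.subalg hom.supp_pe hom.supp_in_G hom.finite_weights in auto)

end

lemma pe_op_odd:
  assumes "supp a = v_rel m"
  shows "pe_op a = z0"
  unfolding pe_op_eq_proj by (rule proj_eq_z0) (auto simp: assms even_entries_def dest: v_rel_odd)

lemma supp_square_even: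
  assumes "supp a = v_rel m"
  shows "supp (ocomp a a) \<subseteq> even_entries"
proof
  fix t assume "t \<in> supp (ocomp a a)"
  then have "t \<in> v_rel m O v_rel m" using supp_ocomp_subset[of a a] unfolding assms
    by (rule subsetD[rotated])
  then obtain T U S where path: "t = (T, S)" "(T, U) \<in> v_rel m" "(U, S) \<in> v_rel m"
    by (rule relcompE)
  have "odd (card T + card U)" "odd (card U + card S)" using path v_rel_odd by blast+
  then show "t \<in> even_entries" by (simp add: path even_entries_def)
qed

interpretation Q: v_algebra even_entries pe_op "[bracket_op]" "\<lambda>a. ocomp a a" Qalg
proof
  show "Qalg = generated pe_op [bracket_op] (\<lambda>a. ocomp a a) {vop 0, vop 1, vop 2}"
    by (rule Qalg_def)
  show "pe_op = proj even_entries" by (rule pe_op_eq_proj)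
  show "operations_supported op_cone (weight_additive op_weight) [bracket_op] (\<lambda>a. ocomp a a)"
    by (rule operations_supportedI) (simp_all add: bracket_op_supported ocomp_supported)
  fix a b :: "'a endo"
  show "\<exists>c\<in>insert z0 ((\<lambda>f. f a b) ` set [bracket_op]).
      ocomp (vadd a b) (vadd a b) = vadd (ocomp a a) (vadd c (ocomp b b))"
    if "row_finite a" "row_finite b" "pe_op a = z0" "pe_op b = z0"
    using ocomp_square_vadd[OF that] by simp
  have subalg: "is_subalg pe_op [bracket_op] (\<lambda>a. ocomp a a) (Qalg :: 'a endo set)"
    unfolding Qalg_def by (rule is_subalg_generated)
  show "vsub (ocomp b (ocomp a a)) (ocomp (ocomp a a) b) \<in> Qalg"
    if a_v: "a \<in> Qalg" "supp a = v_rel m" and b_in: "b \<in> Qalg" for m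
  proof -
    have "ocomp a a \<in> Qalg" by (rule is_subalg_sq[OF subalg a_v(1) pe_op_odd[OF a_v(2)]])
    then have "bracket_op b (ocomp a a) \<in> Qalg" using is_subalg_op[OF subalg _ b_in] by simp
    then show ?thesis unfolding bracket_op_even_right[OF supp_square_even[OF a_v(2)]] .
  qed
qed (simp_all add: row_finite_bracket_op row_finite_ocomp
    bracket_op_vadd_left bracket_op_vadd_right)

interpretation A: v_algebra UNIV id "[ocomp]" "\<lambda>_. z0" Aalg
proof
  show "Aalg = generated id [ocomp] (\<lambda>_. z0) {vop 0, vop 1, vop 2}" by (rule Aalg_def)
  show "id = proj (UNIV :: (nat set \<times> nat set) set)" by (simp add: proj_def fun_eq_iff)
  show "operations_supported op_cone (weight_additive op_weight) [ocomp] (\<lambda>_. z0)"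
    by (rule operations_supportedI) (simp_all add: ocomp_supported product_supported_z0)
  have subalg: "is_subalg id [ocomp] (\<lambda>_. z0) (Aalg :: 'a endo set)"
    unfolding Aalg_def by (rule is_subalg_generated)
  have comp: "ocomp a b \<in> Aalg" if "a \<in> Aalg" "b \<in> Aalg" for a b :: "'a endo"
    using is_subalg_op[OF subalg _ that, of ocomp] by simp
  show "vsub (ocomp b (ocomp a a)) (ocomp (ocomp a a) b) \<in> Aalg" if "a \<in> Aalg" "b \<in> Aalg"
    for a b :: "'a endo"
    using that by (intro is_subalg_vsub[OF subalg] comp)
qed (simp_all add: row_finite_ocomp ocomp_vadd_left ocomp_vadd_right)


section \<open>Products and contractions of monomials\<close>

definition mono_degree :: "nat set \<times> nat set \<Rightarrow> nat" where
  "mono_degree m = card (fst m) + card (snd m)"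

lemma hmul_mono_nonzero_iff:
  "hmul_mono s u t \<noteq> (0 :: 'k::field) \<longleftrightarrow>
     fst s \<inter> fst u = {} \<and> snd s \<inter> snd u = {} \<and> t = (fst s \<union> fst u, snd s \<union> snd u)"
  by (cases s; cases u; cases t) (simp add: hmul_mono_def gsgn_def)

definition contraction :: "nat set \<times> nat set \<Rightarrow> nat set \<times> nat set \<Rightarrow> nat set \<times> nat set \<Rightarrow> bool" where
  "contraction s u t \<longleftrightarrow> (\<exists>i\<in>snd s \<inter> fst u. fst s \<inter> (fst u - {i}) = {} \<and> (snd s - {i}) \<inter> snd u = {}
     \<and> t = (fst s \<union> (fst u - {i}), (snd s - {i}) \<union> snd u))"

definition yx_bracket ::
  "nat set \<times> nat set \<Rightarrow> nat set \<times> nat set \<Rightarrow> nat set \<times> nat set \<Rightarrow> 'k::field" where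
  "yx_bracket s u t = (\<Sum>i\<in>snd s \<inter> fst u. (-1) ^ card {b\<in>snd s. i < b} * (-1) ^ card {a\<in>fst u. a < i}
     * hmul_mono (fst s, snd s - {i}) (fst u - {i}, snd u) t)"

definition xy_bracket ::
  "nat set \<times> nat set \<Rightarrow> nat set \<times> nat set \<Rightarrow> nat set \<times> nat set \<Rightarrow> 'k::field" where
  "xy_bracket s u t = (\<Sum>i\<in>fst s \<inter> snd u.
     (-1) ^ (card {a\<in>fst s. i < a} + card (snd s)) * (-1) ^ (card (fst u) + card {b\<in>snd u. b < i})
     * hmul_mono (fst s - {i}, snd s) (fst u, snd u - {i}) t)"

lemma br_mono_eq: "br_mono s u t = yx_bracket s u t + xy_bracket s u t"
  by (simp add: br_mono_def yx_bracket_def xy_bracket_def split: prod.split)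

lemma yx_bracket_nonzero_imp_contraction:
  assumes "yx_bracket s u t \<noteq> (0 :: 'k::field)"
  shows "contraction s u t"
proof -
  obtain i where "i \<in> snd s \<inter> fst u"
    "hmul_mono (fst s, snd s - {i}) (fst u - {i}, snd u) t \<noteq> (0 :: 'k)"
    using assms unfolding yx_bracket_def by (metis (no_types, lifting) mult_zero_right sum.neutral)
  then show ?thesis unfolding contraction_def hmul_mono_nonzero_iff by auto
qed

lemma xy_bracket_nonzero_imp_contraction:
  assumes "xy_bracket s u t \<noteq> (0 :: 'k::field)"
  shows "contraction u s t"
proof -
  obtain i where "i \<in> fst s \<inter> snd u"
    "hmul_mono (fst s - {i}, snd s) (fst u, snd u - {i}) t \<noteq> (0 :: 'k)"
    using assms unfolding xy_bracket_def by (metis (no_types, lifting) mult_zero_right sum.neutral)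
  then show ?thesis unfolding contraction_def hmul_mono_nonzero_iff
    by (auto simp: Int_commute Un_commute)
qed

lemma br_mono_nonzero_imp_contraction:
  assumes "br_mono s u t \<noteq> (0 :: 'k::field)"
  shows "contraction s u t \<or> contraction u s t"
proof -
  have "yx_bracket s u t \<noteq> (0 :: 'k) \<or> xy_bracket s u t \<noteq> (0 :: 'k)"
    using assms unfolding br_mono_eq by auto
  then show ?thesis
    using yx_bracket_nonzero_imp_contraction xy_bracket_nonzero_imp_contraction by blast
qed

lemma br_mono_nonzero_iff_contraction:
  assumes "fst s \<inter> snd u = {}" "snd s \<inter> fst u \<subseteq> {i}"
  shows "br_mono s u t \<noteq> (0 :: 'k::field) \<longleftrightarrow> contraction s u t"
proof
  assume "br_mono s u t \<noteq> (0 :: 'k)"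
  moreover have "xy_bracket s u t = (0 :: 'k)" unfolding xy_bracket_def assms(1) by simp
  ultimately show "contraction s u t"
    using yx_bracket_nonzero_imp_contraction unfolding br_mono_eq by fastforce
next
  assume contr: "contraction s u t"
  then have single: "snd s \<inter> fst u = {i}" using assms(2) unfolding contraction_def by blast
  then have "hmul_mono (fst s, snd s - {i}) (fst u - {i}, snd u) t \<noteq> (0 :: 'k)"
    using contr unfolding contraction_def hmul_mono_nonzero_iff by auto
  then show "br_mono s u t \<noteq> (0 :: 'k)"
    unfolding br_mono_eq yx_bracket_def xy_bracket_def single assms(1) by simp
qed

lemma exponent_hmul_mono:
  assumes "hmul_mono s u t \<noteq> (0 :: 'k::field)"
  shows "exponent t i = exponent s i + exponent u i"
  using assms unfolding hmul_mono_nonzero_iff by (auto simp: exponent_def)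

lemma exponent_contraction:
  assumes "contraction s u t"
  shows "exponent t i = exponent s i + exponent u i"
proof -
  obtain j where "j \<in> snd s" "j \<in> fst u" "fst s \<inter> (fst u - {j}) = {}" "(snd s - {j}) \<inter> snd u = {}"
    "t = (fst s \<union> (fst u - {j}), (snd s - {j}) \<union> snd u)"
    using assms unfolding contraction_def by blast
  then show ?thesis by (cases "i = j") (auto simp: exponent_def)
qed

lemma card_eq_Suc_less_greater:
  fixes i :: nat
  assumes "finite S" "i \<in> S"
  shows "card S = Suc (card {x\<in>S. x < i} + card {x\<in>S. i < x})"
    and "card (S - {i}) = card {x\<in>S. x < i} + card {x\<in>S. i < x}"
proof -
  have "S - {i} = {x\<in>S. x < i} \<union> {x\<in>S. i < x}" by auto
  then show card_Diff: "card (S - {i}) = card {x\<in>S. x < i} + card {x\<in>S. i < x}"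
    using assms(1) by (simp add: card_Un_disjoint disjoint_iff)
  show "card S = Suc (card {x\<in>S. x < i} + card {x\<in>S. i < x})"
    using card.remove[OF assms] by (simp add: card_Diff)
qed

lemma gsgn_commute:
  assumes "finite A" "finite B" "A \<inter> B = {}"
  shows "gsgn B A = (- 1) ^ (card A * card B) * (gsgn A B :: 'k::field)"
proof -
  let ?C = "{(a, b). a \<in> A \<and> b \<in> B \<and> b < a}" and ?D = "{(a, b). a \<in> A \<and> b \<in> B \<and> a < b}"
  have finite_C: "finite ?C" by (rule finite_subset[of _ "A \<times> B"]) (use assms in auto)
  have finite_D: "finite ?D" by (rule finite_subset[of _ "A \<times> B"]) (use assms in auto)
  have "card {(b, a). b \<in> B \<and> a \<in> A \<and> a < b} = card (prod.swap ` ?D)"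
    by (rule arg_cong[where f = card]) (auto simp: image_iff)
  also have "\<dots> = card ?D" by (rule card_image) simp
  finally have swap: "card {(b, a). b \<in> B \<and> a \<in> A \<and> a < b} = card ?D" .
  have "A \<times> B = ?C \<union> ?D" using assms(3) by (auto simp: disjoint_iff) (metis nat_neq_iff)
  then have "card A * card B = card (?C \<union> ?D)" by (metis card_cartesian_product)
  also have "\<dots> = card ?C + card ?D" using finite_C finite_D by (intro card_Un_disjoint) auto
  finally show ?thesis unfolding gsgn_def swap by (simp add: minus_one_power_iff)
qed

lemma hmul_mono_supercommute:
  assumes finite: "finite (fst s)" "finite (snd s)" "finite (fst u)" "finite (snd u)"
  shows "hmul_mono s u t = (- 1) ^ (mono_degree s * mono_degree u) * (hmul_mono u s t :: 'k::field)"
proof (cases "fst s \<inter> fst u = {} \<and> snd s \<inter> snd u = {}")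
  case True
  obtain a1 b1 a2 b2 A B where components: "s = (a1, b1)" "u = (a2, b2)" "t = (A, B)"
    by (cases s, cases u, cases t)
  have gsgn_swap: "gsgn a2 a1 = (- 1) ^ (card a1 * card a2) * (gsgn a1 a2 :: 'k)"
    "gsgn b2 b1 = (- 1) ^ (card b1 * card b2) * (gsgn b1 b2 :: 'k)"
    using True finite unfolding components by (auto intro: gsgn_commute)
  have "(- 1) ^ (card b1 * card a2) = ((- 1) ^ ((card a1 + card b1) * (card a2 + card b2))
      * ((- 1) ^ (card b2 * card a1) * (- 1) ^ (card a1 * card a2)
        * (- 1) ^ (card b1 * card b2)) :: 'k)"
    by (auto simp: minus_one_power_iff)
  then show ?thesis using True
    unfolding components hmul_mono_def mono_degree_def prod.case gsgn_swap fst_conv snd_conv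
    by (auto simp: Un_commute Int_commute mult_ac)
next
  case False
  then have "hmul_mono s u t = (0 :: 'k)" "hmul_mono u s t = (0 :: 'k)"
    using hmul_mono_nonzero_iff[where 'k = 'k] by blast+
  then show ?thesis by simp
qed

lemma yx_bracket_swap:
  assumes finite: "finite (fst s)" "finite (snd s)" "finite (fst u)" "finite (snd u)"
  shows "yx_bracket s u t
    = - ((- 1) ^ (mono_degree s * mono_degree u)) * (xy_bracket u s t :: 'k::field)"
  unfolding yx_bracket_def xy_bracket_def sum_distrib_left
proof (rule sum.cong)
  show "snd s \<inter> fst u = fst u \<inter> snd s" by blast
  fix i assume "i \<in> fst u \<inter> snd s"
  then have i_mem: "i \<in> snd s" "i \<in> fst u" by auto
  let ?s = "(fst s, snd s - {i})" and ?u = "(fst u - {i}, snd u)"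
  note card_snd = card_eq_Suc_less_greater[OF finite(2) i_mem(1)]
    and card_fst = card_eq_Suc_less_greater[OF finite(3) i_mem(2)]
  have hmul_swap: "hmul_mono ?s ?u t
      = (- 1) ^ (mono_degree ?s * mono_degree ?u) * (hmul_mono ?u ?s t :: 'k)"
    using finite by (intro hmul_mono_supercommute) auto
  have "(- 1) ^ card {b\<in>snd s. i < b} * (- 1) ^ card {a\<in>fst u. a < i}
      * (- 1) ^ (mono_degree ?s * mono_degree ?u)
      = - ((- 1) ^ (mono_degree s * mono_degree u))
        * ((- 1) ^ (card {a\<in>fst u. i < a} + card (snd u))
        * (- 1) ^ (card (fst s) + card {b\<in>snd s. b < i}) :: 'k)"
    unfolding mono_degree_def fst_conv snd_conv card_fst card_snd
    by (auto simp: minus_one_power_iff)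
  then show "(- 1) ^ card {b\<in>snd s. i < b} * (- 1) ^ card {a\<in>fst u. a < i} * hmul_mono ?s ?u t
      = - ((- 1) ^ (mono_degree s * mono_degree u))
        * ((- 1) ^ (card {a\<in>fst u. i < a} + card (snd u))
        * (- 1) ^ (card (fst s) + card {b\<in>snd s. b < i}) * (hmul_mono ?u ?s t :: 'k))"
    unfolding hmul_swap by (simp add: mult.assoc[symmetric])
qed

lemma br_mono_super_antisym:
  assumes "finite (fst s)" "finite (snd s)" "finite (fst u)" "finite (snd u)"
  shows "br_mono s u t = - ((- 1) ^ (mono_degree s * mono_degree u)) * (br_mono u s t :: 'k::field)"
proof -
  have sign: "- ((- 1) ^ n) * (- ((- 1) ^ n) * x) = x" for n and x :: 'k
    by (simp add: minus_one_power_iff)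
  have "xy_bracket s u t = - ((- 1) ^ (mono_degree s * mono_degree u)) * (yx_bracket u s t :: 'k)"
    unfolding yx_bracket_swap[OF assms(3,4,1,2)] mult.commute[of "mono_degree u"] sign ..
  then show ?thesis
    unfolding br_mono_eq yx_bracket_swap[OF assms] by (simp add: algebra_simps)
qed

lemma br_mono_odd_commute:
  assumes "finite (fst s)" "finite (snd s)" "finite (fst u)" "finite (snd u)"
    and "odd (mono_degree s)" "odd (mono_degree u)"
  shows "br_mono s u t = (br_mono u s t :: 'k::field)"
  unfolding br_mono_super_antisym[OF assms(1-4)] using assms(5,6) by simp

lemma br_mono_odd_self:
  assumes "odd (mono_degree m)"
  shows "br_mono m m t = (0 :: 'k::field)"
proof (rule ccontr)
  assume "br_mono m m t \<noteq> (0 :: 'k)"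
  then have "contraction m m t" using br_mono_nonzero_imp_contraction by blast
  then obtain i where "fst m = {i}" "snd m = {i}" unfolding contraction_def by blast
  with assms show False by (simp add: mono_degree_def)
qed

lemma mcode_eq_set_encode:
  assumes "finite (fst m)" "finite (snd m)"
  shows "mcode m = set_encode ((\<lambda>x. 2 * x) ` fst m \<union> (\<lambda>x. 2 * x + 1) ` snd m)"
proof -
  have "(\<lambda>x. 2 * x) ` fst m \<inter> (\<lambda>x. 2 * x + 1) ` snd m = {}" by (auto, presburger)
  then have "set_encode ((\<lambda>x. 2 * x) ` fst m \<union> (\<lambda>x. 2 * x + 1) ` snd m)
      = (\<Sum>x\<in>(\<lambda>x. 2 * x) ` fst m. 2 ^ x) + (\<Sum>x\<in>(\<lambda>x. 2 * x + 1) ` snd m. 2 ^ x)"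
    unfolding set_encode_def using assms by (intro sum.union_disjoint) auto
  also have "\<dots> = mcode m"
    unfolding mcode_def by (subst (1 2) sum.reindex) (auto simp: inj_on_def)
  finally show ?thesis by simp
qed

lemma mcode_inj:
  assumes "finite (fst m)" "finite (snd m)" "finite (fst m')" "finite (snd m')" "mcode m = mcode m'"
  shows "m = m'"
proof -
  let ?S = "\<lambda>m. (\<lambda>x. 2 * x) ` fst m \<union> (\<lambda>x. 2 * x + 1) ` snd m :: nat set"
  have "?S m = ?S m'"
    using assms set_encode_eq[of "?S m" "?S m'"] by (simp add: mcode_eq_set_encode)
  moreover have "2 * x \<in> ?S m \<longleftrightarrow> x \<in> fst m" "2 * x + 1 \<in> ?S m \<longleftrightarrow> x \<in> snd m" for m x
    by (auto, presburger+)
  ultimately have "x \<in> fst m \<longleftrightarrow> x \<in> fst m'" "x \<in> snd m \<longleftrightarrow> x \<in> snd m'" for x by metis+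
  then show ?thesis by (simp add: prod_eq_iff set_eq_iff)
qed


section \<open>Bilinear extensions to formal sums\<close>

lemma bil_nonzeroE:
  assumes "bil F f g t \<noteq> 0"
  obtains s u where "s \<in> supp f" "u \<in> supp g" "F s u t \<noteq> 0"
proof -
  have "\<exists>p\<in>{(m1, m2). f m1 * g m2 * F m1 m2 t \<noteq> 0}. f (fst p) * g (snd p) * F (fst p) (snd p) t \<noteq> 0"
    using assms unfolding bil_def by (meson sum.neutral)
  then show ?thesis using that by (auto simp: in_supp_iff)
qed

lemma bil_eq_sum:
  assumes "finite P" "\<And>s u. s \<in> supp f \<Longrightarrow> u \<in> supp g \<Longrightarrow> F s u t \<noteq> 0 \<Longrightarrow> (s, u) \<in> P"
  shows "bil F f g t = (\<Sum>p\<in>P. f (fst p) * g (snd p) * F (fst p) (snd p) t)"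
  unfolding bil_def by (rule sum.mono_neutral_left) (use assms in \<open>auto simp: in_supp_iff\<close>)

lemma bil_nonzero_if_unique:
  assumes "s \<in> supp f" "u \<in> supp g" "F s u t \<noteq> 0"
    and "\<And>s' u'. s' \<in> supp f \<Longrightarrow> u' \<in> supp g \<Longrightarrow> F s' u' t \<noteq> 0 \<Longrightarrow> s' = s \<and> u' = u"
  shows "bil F f g t \<noteq> 0"
proof -
  have "bil F f g t = (\<Sum>p\<in>{(s, u)}. f (fst p) * g (snd p) * F (fst p) (snd p) t)"
    by (rule bil_eq_sum) (use assms(4) in auto)
  then show ?thesis using assms(1-3) by (simp add: in_supp_iff)
qed

lemma bil_supported:
  assumes "\<And>s u t. F s u t \<noteq> 0 \<Longrightarrow> s \<in> G \<Longrightarrow> u \<in> G \<Longrightarrow> t \<in> G \<and> R t s u"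
  shows "product_supported G R a b (bil F a b)"
proof (rule product_supportedI)
  fix t assume supp: "supp a \<subseteq> G" "supp b \<subseteq> G" and "t \<in> supp (bil F a b)"
  then obtain s u where factors: "s \<in> supp a" "u \<in> supp b" "F s u t \<noteq> 0"
    by (auto simp: in_supp_iff elim: bil_nonzeroE)
  then have "t \<in> G \<and> R t s u" using assms supp by blast
  with factors show "t \<in> G \<and> (\<exists>s\<in>supp a. \<exists>u\<in>supp b. R t s u)" by blast
qed

lemma
  fixes F :: "'m \<Rightarrow> 'm \<Rightarrow> 'm \<Rightarrow> 'k::field"
  assumes finite: "\<And>t. finite {(s, u). s \<in> G \<and> u \<in> G \<and> F s u t \<noteq> 0}"
  shows bil_vadd_left: "supp a \<subseteq> G \<Longrightarrow> supp a' \<subseteq> G \<Longrightarrow> supp b \<subseteq> G \<Longrightarrow>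
      bil F (vadd a a') b = vadd (bil F a b) (bil F a' b)"
    and bil_vadd_right: "supp a \<subseteq> G \<Longrightarrow> supp b \<subseteq> G \<Longrightarrow> supp b' \<subseteq> G \<Longrightarrow>
      bil F a (vadd b b') = vadd (bil F a b) (bil F a b')"
proof -
  have sum: "bil F f g t
      = (\<Sum>p\<in>{(s, u). s \<in> G \<and> u \<in> G \<and> F s u t \<noteq> 0}. f (fst p) * g (snd p) * F (fst p) (snd p) t)"
    if "supp f \<subseteq> G" "supp g \<subseteq> G" for f g t
    by (rule bil_eq_sum[OF finite]) (use that in auto)
  have vadd: "supp (vadd f g) \<subseteq> G" if "supp f \<subseteq> G" "supp g \<subseteq> G" for f g :: "'m \<Rightarrow> 'k"
    using supp_vadd[of f g] that by blast
  show "bil F (vadd a a') b = vadd (bil F a b) (bil F a' b)"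
    if "supp a \<subseteq> G" "supp a' \<subseteq> G" "supp b \<subseteq> G"
    by (simp add: fun_eq_iff vadd_def[of "bil F a b"] sum vadd that sum.distrib[symmetric])
      (simp add: vadd_def algebra_simps)
  show "bil F a (vadd b b') = vadd (bil F a b) (bil F a b')"
    if "supp a \<subseteq> G" "supp b \<subseteq> G" "supp b' \<subseteq> G"
    by (simp add: fun_eq_iff vadd_def[of "bil F a b"] sum vadd that sum.distrib[symmetric])
      (simp add: vadd_def algebra_simps)
qed

lemma hmul_eq_bil: "hmul = bil hmul_mono" and hbr_eq_bil: "hbr = bil br_mono"
  by (simp_all add: hmul_def hbr_def fun_eq_iff)

lemma hsq_nonzeroE:
  fixes f :: "'k::field hel"
  assumes "hsq f t \<noteq> 0"
  obtains s u where "s \<in> supp f" "u \<in> supp f" "br_mono s u t \<noteq> (0 :: 'k)"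
proof -
  have "\<exists>p\<in>{(m1, m2). mcode m1 < mcode m2 \<and> f m1 * f m2 * br_mono m1 m2 t \<noteq> 0}.
      f (fst p) * f (snd p) * br_mono (fst p) (snd p) t \<noteq> 0"
    using assms unfolding hsq_def by (meson sum.neutral)
  then show ?thesis using that by (auto simp: in_supp_iff)
qed

lemma hsq_nonzero_if_unique:
  fixes f :: "'k::field hel"
  assumes "s \<in> supp f" "u \<in> supp f" "mcode s \<noteq> mcode u"
    and "br_mono s u t \<noteq> (0 :: 'k)" "br_mono u s t \<noteq> (0 :: 'k)"
    and unique: "\<And>s' u'. s' \<in> supp f \<Longrightarrow> u' \<in> supp f \<Longrightarrow> br_mono s' u' t \<noteq> (0 :: 'k) \<Longrightarrow>
      s' = s \<and> u' = u \<or> s' = u \<and> u' = s"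
  shows "hsq f t \<noteq> 0"
proof -
  define p where "p = (if mcode s < mcode u then (s, u) else (u, s))"
  let ?M = "{(m1, m2). mcode m1 < mcode m2 \<and> f m1 * f m2 * br_mono m1 m2 t \<noteq> 0}"
  have p_mem: "p \<in> ?M" using assms(1-5) by (auto simp: p_def in_supp_iff)
  have "x = p" if "x \<in> ?M" for x
    using that unique[of "fst x" "snd x"] by (auto simp: p_def in_supp_iff)
  with p_mem have "?M = {p}" by blast
  then have "hsq f t = f (fst p) * f (snd p) * br_mono (fst p) (snd p) t" by (simp add: hsq_def)
  then show ?thesis using p_mem by auto
qed


section \<open>The Poisson superalgebra\<close>

definition dominated :: "nat set \<times> nat set \<Rightarrow> bool" where
  "dominated t \<longleftrightarrow> (\<forall>i\<in>fst t. \<exists>j\<in>snd t. i < j)"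

definition dominated_cone :: "(nat set \<times> nat set) set" where
  "dominated_cone = {t \<in> insert ({}, {}) positive_cone. dominated t}"

definition factor_indices :: "nat set \<times> nat set \<Rightarrow> nat set" where
  "factor_indices t = fst t \<union> snd t \<union> (\<Union>j\<in>snd t. {..<j})"

lemma dominated_cone_finite: "t \<in> dominated_cone \<Longrightarrow> finite (fst t) \<and> finite (snd t)"
  by (auto simp: dominated_cone_def dest: positive_coneD(1,2))

lemma dominated_cone_in_weight_cone: "t \<in> dominated_cone \<Longrightarrow> t \<in> weight_cone"
  using empty_in_weight_cone positive_coneD(3)[of t] by (auto simp: dominated_cone_def)

lemma dominated_cone_positive_iff:
  assumes "t \<in> dominated_cone"
  shows "0 < snd (weight t) \<longleftrightarrow> t \<noteq> ({}, {})" and "t \<in> positive_cone \<longleftrightarrow> t \<noteq> ({}, {})"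
  using assms by (auto simp: dominated_cone_def dest: positive_coneD(4,5))

lemma dominated_cone_hmul_mono:
  assumes nonzero: "hmul_mono s u t \<noteq> (0 :: 'k::field)"
    and factors: "s \<in> dominated_cone" "u \<in> dominated_cone"
  shows "t \<in> dominated_cone \<and> weight_additive weight t s u"
    and "fst s \<union> snd s \<union> fst u \<union> snd u \<subseteq> factor_indices t"
proof -
  have t_eq: "t = (fst s \<union> fst u, snd s \<union> snd u)" using nonzero unfolding hmul_mono_nonzero_iff
    by blast
  then show "fst s \<union> snd s \<union> fst u \<union> snd u \<subseteq> factor_indices t" by (auto simp: factor_indices_def)
  note in_cone = factors[THEN dominated_cone_in_weight_cone]
  have "finite (fst t)" "finite (snd t)"
    using dominated_cone_finite[OF factors(1)] dominated_cone_finite[OF factors(2)] t_eq by auto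
  then have weight_cone: "t \<in> weight_cone" "weight t = weight s + weight u"
    using weight_cone_add[OF in_cone] exponent_hmul_mono[OF nonzero] by blast+
  have "0 < snd (weight t)" if "t \<noteq> ({}, {})"
  proof -
    have "s \<noteq> ({}, {}) \<or> u \<noteq> ({}, {})" using that t_eq by auto
    then show ?thesis
      using factors[THEN dominated_cone_positive_iff(1)] weight_cone(2)
        in_cone[THEN weight_cone_paraboloid, THEN paraboloid_nonneg] by auto
  qed
  moreover have "dominated t" using factors unfolding t_eq dominated_cone_def dominated_def by auto
  ultimately show "t \<in> dominated_cone \<and> weight_additive weight t s u"
    using weight_cone by (auto simp: dominated_cone_def positive_cone_def weight_additive_def)
qed

lemma dominated_contraction:
  assumes "contraction s u t" "dominated s" "dominated u"
  shows "dominated t" "fst s \<union> snd s \<union> fst u \<union> snd u \<subseteq> factor_indices t"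
proof -
  obtain i where i_mem: "i \<in> snd s" "i \<in> fst u"
    and t_eq: "t = (fst s \<union> (fst u - {i}), (snd s - {i}) \<union> snd u)"
    using assms(1) unfolding contraction_def by blast
  obtain j where j_dominates: "j \<in> snd u" "i < j" using assms(3) i_mem(2) unfolding dominated_def
    by blast
  then show "fst s \<union> snd s \<union> fst u \<union> snd u \<subseteq> factor_indices t"
    unfolding t_eq factor_indices_def by auto
  have "\<exists>l\<in>snd t. k < l" if k_mem: "k \<in> fst s" for k
  proof -
    obtain l where l_above_k: "l \<in> snd s" "k < l" using assms(2) k_mem unfolding dominated_def
      by blast
    then show ?thesis using j_dominates unfolding t_eq by (cases "l = i") (auto intro: less_trans)
  qed
  moreover have "\<exists>l\<in>snd t. k < l" if k_mem: "k \<in> fst u" for k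
    using assms(3) k_mem unfolding t_eq dominated_def by auto
  ultimately show "dominated t" unfolding dominated_def t_eq by auto
qed

lemma dominated_cone_contraction:
  assumes contr: "contraction s u t" and factors: "s \<in> dominated_cone" "u \<in> dominated_cone"
  shows "t \<in> dominated_cone" "weight t = weight s + weight u" "s \<noteq> ({}, {})" "u \<noteq> ({}, {})"
    "fst s \<union> snd s \<union> fst u \<union> snd u \<subseteq> factor_indices t"
proof -
  show nonempty: "s \<noteq> ({}, {})" "u \<noteq> ({}, {})" using contr unfolding contraction_def by auto
  then have positive: "s \<in> positive_cone" "u \<in> positive_cone"
    using dominated_cone_positive_iff(2) factors by blast+
  have dominated: "dominated s" "dominated u" using factors by (simp_all add: dominated_cone_def)
  show "fst s \<union> snd s \<union> fst u \<union> snd u \<subseteq> factor_indices t"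
    by (rule dominated_contraction(2)[OF contr dominated])
  have "finite (fst t)" "finite (snd t)"
    using contr positive_coneD(1,2)[OF positive(1)] positive_coneD(1,2)[OF positive(2)]
    unfolding contraction_def by auto
  from positive_cone_add[OF positive this exponent_contraction[OF contr]]
  show "t \<in> dominated_cone" "weight t = weight s + weight u"
    using dominated_contraction(1)[OF contr dominated] by (simp_all add: dominated_cone_def)
qed

lemma dominated_cone_br_mono:
  assumes "br_mono s u t \<noteq> (0 :: 'k::field)" and factors: "s \<in> dominated_cone" "u \<in> dominated_cone"
  shows "t \<in> dominated_cone \<and> weight_additive weight t s u"
    and "s \<noteq> ({}, {})" "u \<noteq> ({}, {})"
    and "fst s \<union> snd s \<union> fst u \<union> snd u \<subseteq> factor_indices t"
proof -
  consider (left) "contraction s u t" | (right) "contraction u s t"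
    using br_mono_nonzero_imp_contraction[OF assms(1)] by blast
  then have "(t \<in> dominated_cone \<and> weight_additive weight t s u) \<and> s \<noteq> ({}, {}) \<and> u \<noteq> ({}, {})
      \<and> fst s \<union> snd s \<union> fst u \<union> snd u \<subseteq> factor_indices t"
  proof cases
    case left
    from dominated_cone_contraction[OF this factors] show ?thesis by (simp add: weight_additive_def)
  next
    case right
    from dominated_cone_contraction[OF this factors(2,1)] show ?thesis
      by (simp add: weight_additive_def add.commute)
  qed
  then show "t \<in> dominated_cone \<and> weight_additive weight t s u" "s \<noteq> ({}, {})" "u \<noteq> ({}, {})"
    "fst s \<union> snd s \<union> fst u \<union> snd u \<subseteq> factor_indices t" by blast+
qed

lemma finite_factor_pairs:
  assumes "\<And>s u. R s u \<Longrightarrow> s \<in> dominated_cone \<Longrightarrow> u \<in> dominated_cone \<Longrightarrow>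
    t \<in> dominated_cone \<and> fst s \<union> snd s \<union> fst u \<union> snd u \<subseteq> factor_indices t"
  shows "finite {(s, u). s \<in> dominated_cone \<and> u \<in> dominated_cone \<and> R s u}" (is "finite ?P")
proof (cases "t \<in> dominated_cone")
  case True
  let ?Z = "Pow (factor_indices t) \<times> Pow (factor_indices t)"
  have "?P \<subseteq> ?Z \<times> ?Z"
  proof
    fix p assume "p \<in> ?P"
    then obtain s u where "p = (s, u)" "fst s \<union> snd s \<union> fst u \<union> snd u \<subseteq> factor_indices t"
      using assms by blast
    then show "p \<in> ?Z \<times> ?Z" by (cases s; cases u) auto
  qed
  moreover have "finite (factor_indices t)"
    using dominated_cone_finite[OF True] by (simp add: factor_indices_def)
  ultimately show ?thesis by (meson finite_Pow_iff finite_SigmaI finite_subset)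
next
  case False
  then have "?P = {}" using assms by blast
  then show ?thesis by (simp only: finite.emptyI)
qed

lemma finite_hmul_mono_pairs:
  "finite {(s, u). s \<in> dominated_cone \<and> u \<in> dominated_cone \<and> hmul_mono s u t \<noteq> (0 :: 'k::field)}"
  by (rule finite_factor_pairs) (use dominated_cone_hmul_mono in blast)

lemma finite_br_mono_pairs:
  "finite {(s, u). s \<in> dominated_cone \<and> u \<in> dominated_cone \<and> br_mono s u t \<noteq> (0 :: 'k::field)}"
  by (rule finite_factor_pairs) (use dominated_cone_br_mono in blast)

lemma hmul_supported: "product_supported dominated_cone (weight_additive weight) a b (hmul a b)"
  unfolding hmul_eq_bil by (rule bil_supported[OF dominated_cone_hmul_mono(1)])

lemma hbr_supported: "product_supported dominated_cone (weight_additive weight) a b (hbr a b)"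
  unfolding hbr_eq_bil by (rule bil_supported[OF dominated_cone_br_mono(1)])

lemma hsq_supported: "product_supported dominated_cone (weight_additive weight) a a (hsq a)"
proof (rule product_supportedI)
  fix t assume supp: "supp a \<subseteq> dominated_cone" and "t \<in> supp (hsq a)"
  then obtain s u where factors: "s \<in> supp a" "u \<in> supp a" "br_mono s u t \<noteq> (0 :: 'a)"
    by (auto simp: in_supp_iff elim: hsq_nonzeroE)
  then have "t \<in> dominated_cone \<and> weight_additive weight t s u"
    using supp dominated_cone_br_mono(1)[OF factors(3)] by blast
  with factors show "t \<in> dominated_cone \<and> (\<exists>s\<in>supp a. \<exists>u\<in>supp a. weight_additive weight t s u)"
    by blast
qed

definition even_monos :: "(nat set \<times> nat set) set" where
  "even_monos = {m. even (mono_degree m)}"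

lemma pe_H_eq_proj: "pe_H = proj even_monos"
  by (auto simp: pe_H_def proj_def even_monos_def mono_degree_def fun_eq_iff)

lemma supp_odd:
  assumes "pe_H a = z0" "m \<in> supp a"
  shows "m \<notin> even_monos"
proof
  assume "m \<in> even_monos"
  then have "pe_H a m = a m" by (simp add: pe_H_eq_proj proj_def)
  then show False using assms by (simp add: z0_def in_supp_iff)
qed

definition odd_pairs :: "nat set \<times> nat set \<Rightarrow> ((nat set \<times> nat set) \<times> (nat set \<times> nat set)) set" where
  "odd_pairs t = {(s, u). s \<in> dominated_cone \<and> u \<in> dominated_cone \<and>
     (s \<notin> even_monos \<and> u \<notin> even_monos \<and> (contraction s u t \<or> contraction u s t))}"

definition lower_odd_pairs ::
  "nat set \<times> nat set \<Rightarrow> ((nat set \<times> nat set) \<times> (nat set \<times> nat set)) set" where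
  "lower_odd_pairs t = {p \<in> odd_pairs t. mcode (fst p) < mcode (snd p)}"

lemma finite_odd_pairs: "finite (odd_pairs t)"
  unfolding odd_pairs_def
proof (rule finite_factor_pairs)
  fix s u
  assume "s \<notin> even_monos \<and> u \<notin> even_monos \<and> (contraction s u t \<or> contraction u s t)"
    and "s \<in> dominated_cone" "u \<in> dominated_cone"
  then show "t \<in> dominated_cone \<and> fst s \<union> snd s \<union> fst u \<union> snd u \<subseteq> factor_indices t"
    using dominated_cone_contraction[of s u t] dominated_cone_contraction[of u s t] by blast
qed

lemma odd_pairsI:
  assumes "supp a \<subseteq> dominated_cone" "pe_H a = z0" "supp b \<subseteq> dominated_cone" "pe_H b = z0"
    and "s \<in> supp a" "u \<in> supp b" "br_mono s u t \<noteq> (0 :: 'k::field)"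
  shows "(s, u) \<in> odd_pairs t"
proof -
  have "s \<in> dominated_cone" "u \<in> dominated_cone" using assms(1,3,5,6) by (simp_all add: subsetD)
  moreover have "s \<notin> even_monos" "u \<notin> even_monos"
    by (rule supp_odd[OF assms(2,5)], rule supp_odd[OF assms(4,6)])
  moreover have "contraction s u t \<or> contraction u s t"
    by (rule br_mono_nonzero_imp_contraction[OF assms(7)])
  ultimately show ?thesis by (simp add: odd_pairs_def)
qed

lemma hsq_eq_sum_lower:
  fixes f :: "'k::field hel"
  assumes "supp f \<subseteq> dominated_cone" "pe_H f = z0"
  shows "hsq f t = (\<Sum>p\<in>lower_odd_pairs t. f (fst p) * f (snd p) * br_mono (fst p) (snd p) t)"
  unfolding hsq_def
proof (rule sum.mono_neutral_left)
  show "finite (lower_odd_pairs t)" using finite_odd_pairs by (simp add: lower_odd_pairs_def)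
  show "{(m1, m2). mcode m1 < mcode m2 \<and> f m1 * f m2 * br_mono m1 m2 t \<noteq> 0} \<subseteq> lower_odd_pairs t"
  proof clarify
    fix s u assume pair: "mcode s < mcode u" "f s * f u * br_mono s u t \<noteq> 0"
    then have "(s, u) \<in> odd_pairs t"
      by (intro odd_pairsI[OF assms assms, where 'k = 'k]) (simp_all add: in_supp_iff)
    with pair(1) show "(s, u) \<in> lower_odd_pairs t" by (simp add: lower_odd_pairs_def)
  qed
  show "\<forall>p\<in>lower_odd_pairs t - {(m1, m2). mcode m1 < mcode m2 \<and> f m1 * f m2 * br_mono m1 m2 t \<noteq> 0}.
      f (fst p) * f (snd p) * br_mono (fst p) (snd p) t = 0"
    by (auto simp: lower_odd_pairs_def)
qed

lemma odd_pairs_swap: "(s, u) \<in> odd_pairs t \<Longrightarrow> (u, s) \<in> odd_pairs t"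
  unfolding odd_pairs_def by blast

lemma br_mono_odd_pairs_commute:
  assumes "(s, u) \<in> odd_pairs t"
  shows "br_mono s u t = (br_mono u s t :: 'k::field)"
proof -
  have "s \<in> dominated_cone" "u \<in> dominated_cone"
    and odd: "odd (mono_degree s)" "odd (mono_degree u)"
    using assms by (simp_all add: odd_pairs_def even_monos_def)
  then show ?thesis using dominated_cone_finite br_mono_odd_commute[OF _ _ _ _ odd] by blast
qed

lemma hbr_odd_eq_sum_lower:
  fixes a b :: "'k::field hel"
  assumes a_odd: "supp a \<subseteq> dominated_cone" "pe_H a = z0"
    and b_odd: "supp b \<subseteq> dominated_cone" "pe_H b = z0"
  shows "hbr a b t = (\<Sum>p\<in>lower_odd_pairs t.
    (a (fst p) * b (snd p) + a (snd p) * b (fst p)) * br_mono (fst p) (snd p) t)"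
proof -
  let ?br = "\<lambda>p. br_mono (fst p) (snd p) t :: 'k" and ?lower = "lower_odd_pairs t"
  let ?upper = "{p \<in> odd_pairs t. mcode (snd p) < mcode (fst p)}"
  have finite: "finite ?lower" "finite ?upper" using finite_odd_pairs
    by (simp_all add: lower_odd_pairs_def)
  have diagonal: "?br p = 0" if "p \<in> odd_pairs t" "p \<notin> ?lower \<union> ?upper" for p
  proof -
    have "mcode (fst p) = mcode (snd p)" using that by (auto simp: lower_odd_pairs_def)
    moreover have "fst p \<in> dominated_cone" "snd p \<in> dominated_cone"
      and odd: "odd (mono_degree (fst p))"
      using that(1) by (auto simp: odd_pairs_def even_monos_def)
    ultimately have "fst p = snd p" using dominated_cone_finite by (intro mcode_inj) blast+
    then show ?thesis using br_mono_odd_self[OF odd] by simp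
  qed
  have "hbr a b t = (\<Sum>p\<in>odd_pairs t. a (fst p) * b (snd p) * ?br p)"
    unfolding hbr_eq_bil by (rule bil_eq_sum[OF finite_odd_pairs odd_pairsI[OF a_odd b_odd]])
  also have "\<dots> = (\<Sum>p\<in>?lower \<union> ?upper. a (fst p) * b (snd p) * ?br p)"
    using finite_odd_pairs diagonal
    by (intro sum.mono_neutral_right) (auto simp: lower_odd_pairs_def)
  also have "\<dots> = (\<Sum>p\<in>?lower. a (fst p) * b (snd p) * ?br p)
      + (\<Sum>p\<in>?upper. a (fst p) * b (snd p) * ?br p)"
    using finite by (intro sum.union_disjoint) (auto simp: lower_odd_pairs_def)
  also have "(\<Sum>p\<in>?upper. a (fst p) * b (snd p) * ?br p)
      = (\<Sum>p\<in>?lower. a (snd p) * b (fst p) * ?br p)"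
    by (rule sum.reindex_bij_witness[of _ prod.swap prod.swap])
      (auto simp: lower_odd_pairs_def odd_pairs_swap dest: br_mono_odd_pairs_commute[where 'k = 'k])
  finally show ?thesis by (simp only: sum.distrib[symmetric] distrib_right)
qed

lemma hsq_vadd:
  assumes a_odd: "supp a \<subseteq> dominated_cone" "pe_H a = z0"
    and b_odd: "supp b \<subseteq> dominated_cone" "pe_H b = z0"
  shows "hsq (vadd a b) = vadd (hsq a) (vadd (hbr a b) (hsq b))"
proof
  fix t
  have sum_odd: "supp (vadd a b) \<subseteq> dominated_cone" "pe_H (vadd a b) = z0"
    using order_trans[OF supp_vadd, of a b dominated_cone] a_odd b_odd
    by (simp_all add: pe_H_eq_proj proj_vadd)
  show "hsq (vadd a b) t = vadd (hsq a) (vadd (hbr a b) (hsq b)) t"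
    unfolding vadd_def[of "hsq a"] vadd_def[of "hbr a b"] hsq_eq_sum_lower[OF sum_odd]
      hsq_eq_sum_lower[OF a_odd] hsq_eq_sum_lower[OF b_odd]
      hbr_odd_eq_sum_lower[OF a_odd b_odd] sum.distrib[symmetric]
    by (rule sum.cong) (simp_all add: vadd_def algebra_simps)
qed

definition V_mono :: "nat \<Rightarrow> nat \<Rightarrow> nat set \<times> nat set" where
  "V_mono m k = (Wset m k, {m + 3 * k})"

definition xV_mono :: "nat \<Rightarrow> nat \<Rightarrow> nat set \<times> nat set" where
  "xV_mono m k = (insert (m + 1) (Wset (m + 3) k), {m + 3 + 3 * k})"

lemma supp_Vgen: "supp (Vgen m :: 'k::field hel) = range (V_mono m)"
  by (auto simp: supp_def Vgen_def V_mono_def split: if_splits)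

lemma weight_V_mono: "weight (V_mono m k) = (mu ^ m, lam ^ m)"
  unfolding V_mono_def by (rule weight_Wset)

lemma V_mono_in_dominated_cone: "V_mono m k \<in> dominated_cone"
  using Wset_in_positive_cone[of m k] Wset_less
  by (auto simp: V_mono_def dominated_cone_def dominated_def)

lemma V_mono_odd: "V_mono m k \<notin> even_monos"
  by (simp add: V_mono_def even_monos_def mono_degree_def card_Wset)

lemma finite_V_mono: "finite (fst (V_mono m k))" "finite (snd (V_mono m k))"
  by (simp_all add: V_mono_def)

lemma contraction_V_mono:
  "contraction (V_mono m k) (V_mono m l) t \<longleftrightarrow> k = 0 \<and> (\<exists>j. l = Suc j \<and> t = xV_mono m j)"
proof
  assume "contraction (V_mono m k) (V_mono m l) t"
  then have index_mem: "m + 3 * k \<in> Wset m l" and disj: "Wset m k \<inter> (Wset m l - {m + 3 * k}) = {}"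
    and t_eq: "t = (Wset m k \<union> (Wset m l - {m + 3 * k}), {m + 3 * l})"
    unfolding contraction_def V_mono_def by auto
  have "k < l" using Wset_less[OF index_mem] by simp
  then have "Wset m k \<subseteq> Wset m l" by (auto simp: mem_Wset)
  then have "Wset m k = {}" using disj Wset_notin(1)[of m k] by blast
  then have "k = 0" by (cases k) (simp_all add: Wset_Suc)
  moreover obtain j where "l = Suc j" using \<open>k < l\<close> by (cases l) auto
  moreover from this have "t = xV_mono m j"
    using Wset_notin(2,3)[of m j] unfolding t_eq xV_mono_def \<open>k = 0\<close> by (auto simp: Wset_Suc)
  ultimately show "k = 0 \<and> (\<exists>j. l = Suc j \<and> t = xV_mono m j)" by blast
next
  assume "k = 0 \<and> (\<exists>j. l = Suc j \<and> t = xV_mono m j)"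
  then show "contraction (V_mono m k) (V_mono m l) t"
    using Wset_notin(2) by (auto simp: contraction_def V_mono_def xV_mono_def Wset_Suc)
qed

lemma br_mono_V_mono_le:
  assumes "k \<le> l"
  shows "br_mono (V_mono m k) (V_mono m l) t \<noteq> (0 :: 'k::field)
    \<longleftrightarrow> k = 0 \<and> (\<exists>j. l = Suc j \<and> t = xV_mono m j)"
proof -
  have "fst (V_mono m k) \<inter> snd (V_mono m l) = {}"
    using assms by (auto simp: V_mono_def dest: Wset_less)
  moreover have "snd (V_mono m k) \<inter> fst (V_mono m l) \<subseteq> {m + 3 * k}" by (auto simp: V_mono_def)
  ultimately show ?thesis using br_mono_nonzero_iff_contraction contraction_V_mono by metis
qed

lemma br_mono_V_mono:
  "br_mono (V_mono m k) (V_mono m l) t \<noteq> (0 :: 'k::field)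
    \<longleftrightarrow> (\<exists>j. t = xV_mono m j \<and> (k = 0 \<and> l = Suc j \<or> l = 0 \<and> k = Suc j))"
proof (cases "k \<le> l")
  case True
  then show ?thesis using br_mono_V_mono_le[OF True, of m t, where 'k = 'k] by auto
next
  case False
  have "odd (mono_degree (V_mono m i))" for i using V_mono_odd by (simp add: even_monos_def)
  then have "br_mono (V_mono m k) (V_mono m l) t = (br_mono (V_mono m l) (V_mono m k) t :: 'k)"
    by (intro br_mono_odd_commute finite_V_mono)
  then show ?thesis using br_mono_V_mono_le[of l k m t, where 'k = 'k] False by auto
qed

text \<open>As for the operators, the next two lemmas express \<open>V\<^sub>m\<^sup>[\<^sup>2\<^sup>] = \<plusminus>x\<^sub>m\<^sub>+\<^sub>1 V\<^sub>m\<^sub>+\<^sub>3\<close> and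
  \<open>{V\<^sub>m\<^sub>+\<^sub>1, x\<^sub>m\<^sub>+\<^sub>1 V\<^sub>m\<^sub>+\<^sub>3} = \<plusminus>V\<^sub>m\<^sub>+\<^sub>3\<close> on the level of supports.\<close>

lemma supp_hsq_V:
  fixes a :: "'k::field hel"
  assumes supp_a: "supp a = range (V_mono m)"
  shows "supp (hsq a) = range (xV_mono m)"
proof (intro equalityI subsetI)
  fix t assume "t \<in> supp (hsq a)"
  then have "hsq a t \<noteq> 0" by (simp add: in_supp_iff)
  then obtain s u where "s \<in> supp a" "u \<in> supp a" "br_mono s u t \<noteq> (0 :: 'k)" by (rule hsq_nonzeroE)
  then show "t \<in> range (xV_mono m)" unfolding supp_a by (auto simp: br_mono_V_mono)
next
  fix t assume "t \<in> range (xV_mono m)"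
  then obtain j where t_eq: "t = xV_mono m j" by blast
  have "hsq a t \<noteq> 0"
  proof (rule hsq_nonzero_if_unique)
    show "V_mono m 0 \<in> supp a" "V_mono m (Suc j) \<in> supp a" unfolding supp_a by simp_all
    have "V_mono m 0 \<noteq> V_mono m (Suc j)" by (simp add: V_mono_def)
    then show "mcode (V_mono m 0) \<noteq> mcode (V_mono m (Suc j))" using mcode_inj finite_V_mono by blast
    show "br_mono (V_mono m 0) (V_mono m (Suc j)) t \<noteq> (0 :: 'k)"
      "br_mono (V_mono m (Suc j)) (V_mono m 0) t \<noteq> (0 :: 'k)"
      unfolding br_mono_V_mono t_eq by blast+
    fix s u assume "s \<in> supp a" "u \<in> supp a" and bracket: "br_mono s u t \<noteq> (0 :: 'k)"
    then obtain k l where factors_eq: "s = V_mono m k" "u = V_mono m l" unfolding supp_a by blast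
    have index_eq: "xV_mono m j = xV_mono m i \<Longrightarrow> i = j" for i by (simp add: xV_mono_def)
    show "s = V_mono m 0 \<and> u = V_mono m (Suc j) \<or> s = V_mono m (Suc j) \<and> u = V_mono m 0"
      using bracket unfolding factors_eq br_mono_V_mono t_eq by (auto dest: index_eq)
  qed
  then show "t \<in> supp (hsq a)" by (simp add: in_supp_iff)
qed

lemma br_mono_V_mono_xV_mono:
  "br_mono (V_mono (m + 1) k) (xV_mono m l) t \<noteq> (0 :: 'k::field) \<longleftrightarrow> k = 0 \<and> t = V_mono (m + 3) l"
proof -
  have "m + 3 + 3 * l \<noteq> m + 1 + 3 * j" "m + 3 + 3 * l \<noteq> m + 1 + 3 * j + 1" for j by presburger+
  then have "fst (V_mono (m + 1) k) \<inter> snd (xV_mono m l) = {}"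
    by (auto simp: V_mono_def xV_mono_def mem_Wset)
  moreover have "snd (V_mono (m + 1) k) \<inter> fst (xV_mono m l) \<subseteq> {m + 1 + 3 * k}"
    by (auto simp: V_mono_def)
  ultimately have "br_mono (V_mono (m + 1) k) (xV_mono m l) t \<noteq> (0 :: 'k)
      \<longleftrightarrow> contraction (V_mono (m + 1) k) (xV_mono m l) t"
    by (rule br_mono_nonzero_iff_contraction)
  also have "\<dots> \<longleftrightarrow> k = 0 \<and> t = V_mono (m + 3) l"
  proof (cases k)
    case 0
    have "insert (m + 1) (Wset (m + 3) l) - {m + 1} = Wset (m + 3) l" using Wset_notin(3) by auto
    then show ?thesis unfolding contraction_def V_mono_def xV_mono_def 0 by (simp add: add.commute)
  next
    case (Suc j)
    have "m + 1 \<in> Wset (m + 1) k \<inter> (insert (m + 1) (Wset (m + 3) l) - {m + 1 + 3 * k})"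
      unfolding Suc Wset_Suc by simp
    then show ?thesis unfolding contraction_def V_mono_def xV_mono_def using Suc by auto
  qed
  finally show ?thesis .
qed

lemma supp_hbr_V_xV:
  fixes b c :: "'k::field hel"
  assumes supp_b: "supp b = range (V_mono (m + 1))" and supp_c: "supp c = range (xV_mono m)"
  shows "supp (hbr b c) = range (V_mono (m + 3))"
proof (intro equalityI subsetI)
  fix t assume "t \<in> supp (hbr b c)"
  then have "bil br_mono b c t \<noteq> 0" by (simp add: in_supp_iff hbr_eq_bil)
  then obtain s u where "s \<in> supp b" "u \<in> supp c" "br_mono s u t \<noteq> (0 :: 'k)" by (rule bil_nonzeroE)
  then obtain k l where "br_mono (V_mono (m + 1) k) (xV_mono m l) t \<noteq> (0 :: 'k)"
    unfolding supp_b supp_c by blast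
  then show "t \<in> range (V_mono (m + 3))" unfolding br_mono_V_mono_xV_mono by blast
next
  fix t assume "t \<in> range (V_mono (m + 3))"
  then obtain l where t_eq: "t = V_mono (m + 3) l" by blast
  have "bil br_mono b c t \<noteq> 0"
  proof (rule bil_nonzero_if_unique)
    show "V_mono (m + 1) 0 \<in> supp b" "xV_mono m l \<in> supp c" unfolding supp_b supp_c by simp_all
    show "br_mono (V_mono (m + 1) 0) (xV_mono m l) t \<noteq> (0 :: 'k)"
      unfolding br_mono_V_mono_xV_mono t_eq by simp
    fix s u assume "s \<in> supp b" "u \<in> supp c" and bracket: "br_mono s u t \<noteq> (0 :: 'k)"
    then obtain k j where factors_eq: "s = V_mono (m + 1) k" "u = xV_mono m j"
      unfolding supp_b supp_c by blast
    have "k = 0" "V_mono (m + 3) l = V_mono (m + 3) j"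
      using bracket unfolding factors_eq br_mono_V_mono_xV_mono t_eq by blast+
    then show "s = V_mono (m + 1) 0 \<and> u = xV_mono m l" unfolding factors_eq
      by (simp add: V_mono_def)
  qed
  then show "t \<in> supp (hbr b c)" by (simp add: in_supp_iff hbr_eq_bil)
qed

lemma supp_hone: "supp (hone :: 'k::field hel) = {({}, {})}"
  by (auto simp: supp_def hone_def)

lemma empty_in_dominated_cone: "({}, {}) \<in> dominated_cone"
  by (simp add: dominated_cone_def dominated_def)

interpretation P: homogeneous_generators even_monos pe_H "[hmul, hbr]" hsq
  "{hone, Vgen 0, Vgen 1, Vgen 2 :: 'k::field hel}" Palg weight dominated_cone
  "\<lambda>a. supp a \<subseteq> dominated_cone"
proof
  show "Palg = generated pe_H [hmul, hbr] hsq {hone, Vgen 0, Vgen 1, Vgen 2 :: 'k hel}"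
    by (rule Palg_def)
  show "pe_H = proj even_monos" by (rule pe_H_eq_proj)
  show operations:
    "operations_supported dominated_cone (weight_additive weight) [hmul, hbr :: 'k hel \<Rightarrow> _] hsq"
    using hmul_supported hbr_supported hsq_supported by (intro operations_supportedI) auto
  fix a b :: "'k hel"
  show "supp (vadd a b) \<subseteq> dominated_cone" if "supp a \<subseteq> dominated_cone" "supp b \<subseteq> dominated_cone"
    using that supp_vadd[of a b] by blast
  show "supp (f a b) \<subseteq> dominated_cone"
    if "f \<in> set [hmul, hbr]" "supp a \<subseteq> dominated_cone" "supp b \<subseteq> dominated_cone" for f
    by (rule product_supported_in_carrier[OF operations_supported_op[OF operations that(1)]
          that(2,3)])
  show "supp (hsq a) \<subseteq> dominated_cone" if "supp a \<subseteq> dominated_cone"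
    by (rule product_supported_in_carrier[OF hsq_supported that that])
  show "f (vadd a a') b = vadd (f a b) (f a' b)"
    if "f \<in> set [hmul, hbr]"
      "supp a \<subseteq> dominated_cone" "supp a' \<subseteq> dominated_cone" "supp b \<subseteq> dominated_cone" for f a'
    using that bil_vadd_left[OF finite_hmul_mono_pairs] bil_vadd_left[OF finite_br_mono_pairs]
    by (auto simp: hmul_eq_bil hbr_eq_bil)
  show "f a (vadd b b') = vadd (f a b) (f a b')"
    if "f \<in> set [hmul, hbr]"
      "supp a \<subseteq> dominated_cone" "supp b \<subseteq> dominated_cone" "supp b' \<subseteq> dominated_cone" for f b'
    using that bil_vadd_right[OF finite_hmul_mono_pairs] bil_vadd_right[OF finite_br_mono_pairs]
    by (auto simp: hmul_eq_bil hbr_eq_bil)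
  show "\<exists>c\<in>insert z0 ((\<lambda>f. f a b) ` set [hmul, hbr]).
      hsq (vadd a b) = vadd (hsq a) (vadd c (hsq b))"
    if "supp a \<subseteq> dominated_cone" "supp b \<subseteq> dominated_cone" "pe_H a = z0" "pe_H b = z0"
    using hsq_vadd[OF that(1,3,2,4)] by simp
  show "supp x \<subseteq> dominated_cone \<and> homogeneous weight x" if "x \<in> {hone, Vgen 0, Vgen 1, Vgen 2}"
    for x :: "'k hel"
    using that V_mono_in_dominated_cone empty_in_dominated_cone
    by (elim insertE emptyE) (auto simp: homogeneous_def supp_hone supp_Vgen weight_V_mono)
qed auto

lemma Po_eq: "Po = {f \<in> Palg. supp f \<subseteq> {t. 0 < snd (weight t)}}"
proof (intro set_eqI)
  fix f :: "'a hel"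
  have "f ({}, {}) = 0 \<longleftrightarrow> supp f \<subseteq> {t. 0 < snd (weight t)}" if "f \<in> Palg"
  proof -
    have "supp f \<subseteq> {t. 0 < snd (weight t)} \<longleftrightarrow> ({}, {}) \<notin> supp f"
      using P.supp_in_G[OF that] dominated_cone_positive_iff(1) by auto
    then show ?thesis by (simp add: in_supp_iff)
  qed
  then show "f \<in> Po \<longleftrightarrow> f \<in> {f \<in> Palg. supp f \<subseteq> {t. 0 < snd (weight t)}}" by (auto simp: Po_def)
qed

lemma Po_subset_Palg: "Po \<subseteq> Palg"
  by (auto simp: Po_eq)

lemma Po_supp_positive:
  assumes "a \<in> Po" "t \<in> supp a"
  shows "t \<in> positive_cone"
proof -
  have "t \<in> dominated_cone" "0 < snd (weight t)" using assms P.supp_in_G[of a] by (auto simp: Po_eq)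
  then show ?thesis using dominated_cone_positive_iff by blast
qed

lemma is_subalg_Po: "is_subalg pe_H [hmul, hbr] hsq Po"
  unfolding Po_eq
proof (rule is_subalg_supported_in[OF P.subalg P.supp_in_G P.supp_pe])
  show "operations_supported dominated_cone (\<lambda>t s u. s \<in> {t. 0 < snd (weight t)} \<longrightarrow>
      u \<in> {t. 0 < snd (weight t)} \<longrightarrow> t \<in> {t. 0 < snd (weight t)}) [hmul, hbr] hsq"
    by (rule operations_supported_mono[OF P.operations]) (simp add: weight_additive_def)
qed

lemma hbr_Palg_in_Po:
  assumes "a \<in> Palg" "b \<in> Palg"
  shows "hbr a b \<in> Po"
proof -
  have "hbr a b \<in> Palg" using is_subalg_op[OF P.subalg _ assms, of hbr] by simp
  moreover have "hbr a b ({}, {}) = 0"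
  proof (rule ccontr)
    assume "hbr a b ({}, {}) \<noteq> 0"
    then obtain s u where factors: "s \<in> supp a" "u \<in> supp b"
      and bracket: "br_mono s u ({}, {}) \<noteq> (0 :: 'a)"
      unfolding hbr_eq_bil by (rule bil_nonzeroE)
    have in_cone: "s \<in> dominated_cone" "u \<in> dominated_cone" using factors assms P.supp_in_G
      by blast+
    have "weight s + weight u = 0"
      using dominated_cone_br_mono(1)[OF bracket in_cone] by (simp add: weight_additive_def)
    moreover have "0 < snd (weight s)" "0 < snd (weight u)"
      using dominated_cone_br_mono(2,3)[OF bracket in_cone] dominated_cone_positive_iff(1) in_cone
      by blast+
    ultimately show False by (metis add_pos_pos less_irrefl snd_add snd_zero)
  qed
  ultimately show ?thesis by (simp add: Po_def)
qed

lemma proj_weights_Po: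
  assumes "a \<in> Po"
  shows "proj {t. R (weight t)} a \<in> Po"
  using assms P.proj_weights[of a R] by (auto simp: Po_eq supp_proj)

lemma ex_supp_eq_V: "\<exists>e\<in>(Palg :: 'k::field hel set). supp e = range (V_mono n)"
proof (induction n rule: three_step_induct)
  case 0
  have "Vgen 0 \<in> (Palg :: 'k hel set)" unfolding Palg_def
    by (rule subsetD[OF generated_superset]) simp
  then show ?case by (intro bexI[of _ "Vgen 0"] supp_Vgen)
next
  case 1
  have "Vgen 1 \<in> (Palg :: 'k hel set)" unfolding Palg_def
    by (rule subsetD[OF generated_superset]) simp
  then show ?case by (intro bexI[of _ "Vgen 1"] supp_Vgen)
next
  case 2
  have "Vgen 2 \<in> (Palg :: 'k hel set)" unfolding Palg_def
    by (rule subsetD[OF generated_superset]) simp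
  then show ?case by (intro bexI[of _ "Vgen 2"] supp_Vgen)
next
  case (step m)
  then obtain a b :: "'k hel" where a_V: "a \<in> Palg" "supp a = range (V_mono m)"
    and b_V: "b \<in> Palg" "supp b = range (V_mono (m + 1))" by blast
  have "pe_H a = z0" unfolding pe_H_eq_proj by (rule proj_eq_z0) (auto simp: a_V(2) V_mono_odd)
  then have "hsq a \<in> Palg" by (rule is_subalg_sq[OF P.subalg a_V(1)])
  then have "hbr b (hsq a) \<in> Palg" using is_subalg_op[OF P.subalg _ b_V(1), of hbr] by simp
  with supp_hbr_V_xV[OF b_V(2) supp_hsq_V[OF a_V(2)]] show ?case by (rule bexI)
qed

lemma ex_Po_weight_mu_power:
  "\<exists>e\<in>(Po :: 'k::field hel set). e \<noteq> z0 \<and> (\<forall>t\<in>supp e. weight t = (mu ^ n, lam ^ n))"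
proof -
  obtain e :: "'k hel" where e_V: "e \<in> Palg" "supp e = range (V_mono n)" using ex_supp_eq_V by blast
  then have "e \<in> Po" using lam_bounds(1) by (auto simp: Po_eq weight_V_mono)
  moreover have "e \<noteq> z0" using e_V(2) by auto
  ultimately show ?thesis by (intro bexI[of _ e]) (auto simp: e_V(2) weight_V_mono)
qed

interpretation Po: paraboloid_algebra pe_H "[hmul, hbr]" hsq "Po :: 'k::field hel set"
  dominated_cone "\<lambda>_. False" "{}" weight
proof
  show "is_subalg pe_H [hmul, hbr] hsq (Po :: 'k hel set)" by (rule is_subalg_Po)
  show "operations_supported dominated_cone (double_additive (\<lambda>_. False) {} weight)
      [hmul, hbr :: 'k hel \<Rightarrow> _] hsq"
    by (rule operations_supported_mono[OF P.operations double_additive_trivial])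
  show "weight t \<in> paraboloid" if "t \<in> dominated_cone" for t
    by (rule weight_cone_paraboloid[OF dominated_cone_in_weight_cone[OF that]])
  fix a :: "'k hel" and s
  show "supp (pe_H a) \<subseteq> supp a" by (rule P.supp_pe)
  show "supp a \<subseteq> dominated_cone" "finite (weight ` supp a)" if "a \<in> Po"
    using that Po_subset_Palg P.supp_in_G P.finite_weights by blast+
  show "side s (fst (weight t)) \<noteq> 0" if "a \<in> Po" "t \<in> supp a" "s \<in> generic_slopes" for t
    using positive_cone_side_nonzero[OF Po_supp_positive[OF that(1,2)] that(3)] .
  show "proj {t. 0 < side s (fst (weight t)) \<or> t \<in> {}} a \<in> Po" if "a \<in> Po"
    using proj_weights_Po[OF that, of "\<lambda>w. 0 < side s (fst w)"] by simp
  show "\<exists>e\<in>(Po :: 'k hel set). e \<noteq> z0 \<and> (\<forall>t\<in>supp e. t \<notin> {} \<and> fst (weight t) = mu ^ n)" for n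
    using ex_Po_weight_mu_power[of n] by auto
qed simp_all


section \<open>The Jordan superalgebras\<close>

lemma supp_twist: "supp (vsub (vsc c (proj I a)) a) \<subseteq> supp a"
  by (auto simp: supp_def vsub_def vsc_def proj_def)

lemma supp_twist_H: "supp (twist_H a) \<subseteq> supp a"
  unfolding twist_H_def pe_H_eq_proj by (rule supp_twist)

lemma supp_twist_op: "supp (twist_op a) \<subseteq> supp a"
  unfolding twist_op_def pe_op_eq_proj by (rule supp_twist)

lemma in_supp_jpart_iff: "m \<in> supp (jpart z c) \<longleftrightarrow> (c, m) \<in> supp z"
  by (simp add: supp_def jpart_def)

lemma jpart_simps [simp]:
  "jpart (mkJ a b) False = a" "jpart (mkJ a b) True = b" "jpart z0 c = z0"
  "jpart (vadd z w) c = vadd (jpart z c) (jpart w c)" "jpart (vsc k z) c = vsc k (jpart z c)"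
  "jpart (proj I z) c = proj {m. (c, m) \<in> I} (jpart z c)"
  by (auto simp: jpart_def mkJ_def z0_def vadd_def vsc_def proj_def)

definition J_indices :: "(bool \<times> nat set \<times> nat set) set" where
  "J_indices = {t. snd t \<in> dominated_cone}"

abbreviation J_additive :: "bool \<times> nat set \<times> nat set \<Rightarrow> bool \<times> nat set \<times> nat set \<Rightarrow>
    bool \<times> nat set \<times> nat set \<Rightarrow> bool" where
  "J_additive \<equiv> double_additive fst {(True, {}, {})} (\<lambda>t. weight (snd t))"

lemma J_additiveI:
  assumes "weight_additive weight m p q" "i = j \<Longrightarrow> i \<Longrightarrow> p \<noteq> ({}, {}) \<and> q \<noteq> ({}, {})"
  shows "J_additive (i \<noteq> j, m) (i, p) (j, q)"
  using assms by (auto simp: double_additive_def weight_additive_def)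

lemma jpart_product_supported:
  fixes z w :: "'k::field jel"
  assumes "product_supported dominated_cone R a b c"
    and "supp a \<subseteq> supp (jpart z i)" "supp b \<subseteq> supp (jpart w j)"
    and "supp z \<subseteq> J_indices" "supp w \<subseteq> J_indices" "m \<in> supp c"
    and additive: "\<And>p q. R m p q \<Longrightarrow> J_additive (i \<noteq> j, m) (i, p) (j, q)"
  shows "(i \<noteq> j, m) \<in> J_indices \<and> (\<exists>s\<in>supp z. \<exists>u\<in>supp w. J_additive (i \<noteq> j, m) s u)"
proof -
  have "supp (jpart y k) \<subseteq> dominated_cone" if "supp y \<subseteq> J_indices" for y :: "'k jel" and k
    using that by (auto simp: J_indices_def in_supp_jpart_iff)
  then have "supp a \<subseteq> dominated_cone" "supp b \<subseteq> dominated_cone" using assms(2-5) by blast+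
  then obtain p q where "m \<in> dominated_cone" "p \<in> supp a" "q \<in> supp b" "R m p q"
    using product_supportedE[OF assms(1) _ _ assms(6)] by blast
  moreover from this have "(i, p) \<in> supp z" "(j, q) \<in> supp w" "J_additive (i \<noteq> j, m) (i, p) (j, q)"
    using assms(2,3) in_supp_jpart_iff additive by blast+
  moreover from \<open>m \<in> dominated_cone\<close> have "(i \<noteq> j, m) \<in> J_indices" by (simp add: J_indices_def)
  ultimately show ?thesis by blast
qed

lemma hbr_supported_nonconstant:
  "product_supported dominated_cone
    (\<lambda>t s u. weight_additive weight t s u \<and> s \<noteq> ({}, {}) \<and> u \<noteq> ({}, {}))
     a b (hbr a b)"
  unfolding hbr_eq_bil by (rule bil_supported) (use dominated_cone_br_mono in blast)

lemma in_supp_jmulE: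
  assumes "(c, m) \<in> supp (jmul z w)"
  obtains (unbarred) "\<not> c" "m \<in> supp (hmul (jpart z False) (jpart w False))"
    | (bracket) "\<not> c" "m \<in> supp (hbr (jpart z True) (twist_H (jpart w True)))"
    | (right_barred) c "m \<in> supp (hmul (jpart z False) (jpart w True))"
    | (left_barred) c "m \<in> supp (hmul (jpart z True) (twist_H (jpart w False)))"
proof -
  have "m \<in> supp (jpart (jmul z w) c)" using assms by (simp add: in_supp_jpart_iff)
  then show ?thesis
    using that by (cases c) (auto simp: jmul_def dest!: in_supp_vaddD)
qed

lemma jmul_supported: "product_supported J_indices J_additive z w (jmul z w)"
proof (rule product_supportedI)
  fix t :: "bool \<times> nat set \<times> nat set"
  assume in_J: "supp z \<subseteq> J_indices" "supp w \<subseteq> J_indices" and "t \<in> supp (jmul z w)"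
  then obtain c m where t_eq: "t = (c, m)" and supp: "(c, m) \<in> supp (jmul z w)" by (cases t) auto
  note product = jpart_product_supported[OF _ _ _ in_J]
  let ?supported = "\<lambda>c. (c, m) \<in> J_indices \<and> (\<exists>s\<in>supp z. \<exists>u\<in>supp w. J_additive (c, m) s u)"
  from supp show "t \<in> J_indices \<and> (\<exists>s\<in>supp z. \<exists>u\<in>supp w. J_additive t s u)"
  proof (cases rule: in_supp_jmulE)
    case unbarred
    have "?supported (False \<noteq> False)"
      by (rule product[OF hmul_supported order_refl order_refl unbarred(2)],
          rule J_additiveI) simp_all
    then show ?thesis using unbarred(1) by (simp add: t_eq)
  next
    case bracket
    have "?supported (True \<noteq> True)"
      by (rule product[OF hbr_supported_nonconstant order_refl supp_twist_H bracket(2)],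
          rule J_additiveI) simp_all
    then show ?thesis using bracket(1) by (simp add: t_eq)
  next
    case right_barred
    have "?supported (False \<noteq> True)"
      by (rule product[OF hmul_supported order_refl order_refl right_barred(2)],
          rule J_additiveI) simp_all
    then show ?thesis using right_barred(1) by (simp add: t_eq)
  next
    case left_barred
    have "?supported (True \<noteq> False)"
      by (rule product[OF hmul_supported order_refl supp_twist_H left_barred(2)],
          rule J_additiveI) simp_all
    then show ?thesis using left_barred(1) by (simp add: t_eq)
  qed
qed

lemma twist_H_in_Palg: "a \<in> Palg \<Longrightarrow> twist_H a \<in> Palg"
  unfolding twist_H_def
  by (intro is_subalg_vsub[OF P.subalg] is_subalg_vsc[OF P.subalg] is_subalg_pe[OF P.subalg])

lemma hmul_in_Palg: "a \<in> Palg \<Longrightarrow> b \<in> Palg \<Longrightarrow> hmul a b \<in> Palg"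
  using is_subalg_op[OF P.subalg, of hmul] by simp

lemma hmul_in_Po: "a \<in> Po \<Longrightarrow> b \<in> Po \<Longrightarrow> hmul a b \<in> Po"
  using is_subalg_op[OF is_subalg_Po, of hmul] by simp

lemma in_Jo_iff: "z \<in> Jo \<longleftrightarrow> jpart z False \<in> Po \<and> jpart z True \<in> Palg"
  by (simp add: Jo_def)

lemma jpart_Jo_in_Palg: "z \<in> Jo \<Longrightarrow> jpart z c \<in> Palg"
  using Po_subset_Palg by (cases c) (auto simp: in_Jo_iff)

lemma jmul_in_Jo:
  assumes "z \<in> Jo" "w \<in> Jo"
  shows "jmul z w \<in> Jo"
proof -
  have "vadd (hmul (jpart z False) (jpart w False))
      (hbr (jpart z True) (twist_H (jpart w True))) \<in> Po"
    using assms by (intro is_subalg_vadd[OF is_subalg_Po] hmul_in_Po hbr_Palg_in_Po twist_H_in_Palg)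
      (simp_all add: in_Jo_iff)
  moreover have "vadd (hmul (jpart z False) (jpart w True))
      (hmul (jpart z True) (twist_H (jpart w False))) \<in> Palg"
    using assms by (intro is_subalg_vadd[OF P.subalg] hmul_in_Palg twist_H_in_Palg jpart_Jo_in_Palg)
  ultimately show ?thesis by (simp add: in_Jo_iff jmul_def)
qed

lemma is_subalg_Jo: "is_subalg pe_J [jmul] (\<lambda>_. z0) (Jo :: 'k::field jel set)"
proof (rule is_subalgI)
  show "z0 \<in> (Jo :: 'k jel set)"
    by (simp add: in_Jo_iff is_subalg_z0[OF P.subalg] is_subalg_z0[OF is_subalg_Po])
  show "pe_J z \<in> Jo" if "z \<in> Jo" for z :: "'k jel"
    using that
    by (simp add: in_Jo_iff pe_J_def is_subalg_pe[OF P.subalg] is_subalg_pe[OF is_subalg_Po]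
        is_subalg_vsub[OF P.subalg])
qed (simp_all add: in_Jo_iff is_subalg_vadd[OF P.subalg] is_subalg_vadd[OF is_subalg_Po]
    is_subalg_vsc[OF P.subalg] is_subalg_vsc[OF is_subalg_Po] jmul_in_Jo[unfolded in_Jo_iff]
    is_subalg_z0[OF P.subalg] is_subalg_z0[OF is_subalg_Po])

lemma Jo_supp:
  assumes "z \<in> Jo" "t \<in> supp z"
  shows "snd t \<in> dominated_cone" "t \<noteq> (True, {}, {}) \<Longrightarrow> snd t \<in> positive_cone"
proof -
  have t_supp: "snd t \<in> supp (jpart z (fst t))" using assms(2) by (simp add: in_supp_jpart_iff)
  then show dominated: "snd t \<in> dominated_cone" using P.supp_in_G[OF jpart_Jo_in_Palg[OF assms(1)]]
    by blast
  assume nonunit: "t \<noteq> (True, {}, {})"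
  show "snd t \<in> positive_cone"
  proof (cases "fst t")
    case True
    then have "snd t \<noteq> ({}, {})" using nonunit by (cases t) auto
    then show ?thesis using dominated_cone_positive_iff(2)[OF dominated] by blast
  next
    case False
    then show ?thesis using Po_supp_positive[of "jpart z False"] t_supp assms(1)
      by (simp add: in_Jo_iff)
  qed
qed

lemma finite_weights_Jo:
  assumes "z \<in> Jo"
  shows "finite ((\<lambda>t. weight (snd t)) ` supp z)"
proof (rule finite_subset)
  show "(\<lambda>t. weight (snd t)) ` supp z \<subseteq> (\<Union>c. weight ` supp (jpart z c))"
    by (force simp: in_supp_jpart_iff)
  show "finite (\<Union>c. weight ` supp (jpart z c))"
    using P.finite_weights[OF jpart_Jo_in_Palg[OF assms]] by simp
qed

lemma proj_upper_in_Jo: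
  assumes "z \<in> Jo"
  shows "proj {t. 0 < side s (fst (weight (snd t))) \<or> t \<in> {(True, {}, {})}} z \<in> Jo"
    (is "proj ?I z \<in> Jo")
proof -
  have parts: "jpart z False \<in> Po" "jpart z True \<in> Palg" using assms by (simp_all add: in_Jo_iff)
  have "jpart (proj ?I z) False \<in> Po"
    using proj_weights_Po[OF parts(1), of "\<lambda>w. 0 < side s (fst w)"] by simp
  moreover have "jpart (proj ?I z) True
      = proj {m. 0 < side s (fst (weight m)) \<or> weight m = 0} (jpart z True)"
    unfolding jpart_simps
  proof (rule proj_cong)
    fix m assume "m \<in> supp (jpart z True)"
    then have "m \<in> dominated_cone" using P.supp_in_G[OF parts(2)] by blast
    then have "weight m = 0 \<longleftrightarrow> m = ({}, {})" using dominated_cone_positive_iff(1)[of m] by fastforce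
    then show "m \<in> {m. (True, m) \<in> ?I} \<longleftrightarrow> m \<in> {m. 0 < side s (fst (weight m)) \<or> weight m = 0}"
      by auto
  qed
  then have "jpart (proj ?I z) True \<in> Palg"
    using P.proj_weights[OF parts(2), of "\<lambda>w. 0 < side s (fst w) \<or> w = 0"] by simp
  ultimately show ?thesis by (simp add: in_Jo_iff)
qed

lemma ex_Jo_weight_mu_power:
  "\<exists>z\<in>(Jo :: 'k::field jel set). z \<noteq> z0
    \<and> (\<forall>t\<in>supp z. t \<notin> {(True, {}, {})} \<and> fst (weight (snd t)) = mu ^ n)"
proof -
  obtain e :: "'k hel" where e_weight: "e \<in> Po" "e \<noteq> z0" "\<forall>t\<in>supp e. weight t = (mu ^ n, lam ^ n)"
    using ex_Po_weight_mu_power by blast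
  have supp: "t \<in> supp (mkJ e z0) \<longleftrightarrow> \<not> fst t \<and> snd t \<in> supp e" for t
    by (cases t) (simp add: in_supp_iff mkJ_def z0_def)
  have "mkJ e z0 \<in> Jo" using e_weight(1) by (simp add: in_Jo_iff is_subalg_z0[OF P.subalg])
  moreover have "mkJ e z0 \<noteq> z0" using e_weight(2) jpart_simps(1)[of e z0] jpart_simps(3)[of False]
    by metis
  ultimately show ?thesis using e_weight(3) supp by (intro bexI[of _ "mkJ e z0"]) auto
qed

interpretation Jo: paraboloid_algebra pe_J "[jmul]" "\<lambda>_. z0" "Jo :: 'k::field jel set" J_indices fst
  "{(True, {}, {})}" "\<lambda>t. weight (snd t)"
proof
  show "operations_supported J_indices J_additive [jmul] (\<lambda>_. z0 :: 'k jel)"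
    by (rule operations_supportedI) (simp_all add: jmul_supported product_supported_z0)
  show "weight (snd t) \<in> paraboloid" if "t \<in> J_indices" for t
    using that by (simp add: J_indices_def weight_cone_paraboloid dominated_cone_in_weight_cone)
  fix z :: "'k jel" and s
  show "supp (pe_J z) \<subseteq> supp z"
    by (auto simp: supp_def pe_J_def mkJ_def jpart_def vsub_def pe_H_eq_proj proj_def
        split: if_splits)
  show "supp z \<subseteq> J_indices" if "z \<in> Jo"
    using Jo_supp(1)[OF that] by (auto simp: J_indices_def)
  show "side s (fst (weight (snd t))) \<noteq> 0"
    if "z \<in> Jo" "t \<in> supp z" "t \<notin> {(True, {}, {})}" "s \<in> generic_slopes" for t
    using positive_cone_side_nonzero[OF Jo_supp(2)[OF that(1,2)] that(4)] that(3) by simp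
qed (fact is_subalg_Jo | rule finite_weights_Jo proj_upper_in_Jo ex_Jo_weight_mu_power | simp)+

definition K_indices :: "(bool \<times> (nat set \<times> nat set) option) set" where
  "K_indices = {(b, x). case x of None \<Rightarrow> b | Some p \<Rightarrow> p \<in> op_cone}"

definition K_weight :: "bool \<times> (nat set \<times> nat set) option \<Rightarrow> complex \<times> real" where
  "K_weight t = (case snd t of None \<Rightarrow> 0 | Some p \<Rightarrow> op_weight p)"

lemma K_weight_simps [simp]: "K_weight (b, None) = 0" "K_weight (b, Some p) = op_weight p"
  by (simp_all add: K_weight_def)

lemma K_indices_simps [simp]: "(b, None) \<in> K_indices \<longleftrightarrow> b" "(b, Some p) \<in> K_indices \<longleftrightarrow> p \<in> op_cone"
  by (simp_all add: K_indices_def)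

lemma in_supp_K_iff:
  "(False, None) \<in> supp z \<longleftrightarrow> kc z \<noteq> 0" "(True, None) \<in> supp z \<longleftrightarrow> kd z \<noteq> 0"
  "(False, Some p) \<in> supp z \<longleftrightarrow> p \<in> supp (kx z)" "(True, Some p) \<in> supp z \<longleftrightarrow> p \<in> supp (ky z)"
  by (simp_all add: supp_def kc_def kd_def kx_def ky_def)

lemma k_simps [simp]:
  "kc (mkK c x d y) = c" "kx (mkK c x d y) = x" "kd (mkK c x d y) = d" "ky (mkK c x d y) = y"
  "kc z0 = 0" "kx z0 = z0" "ky z0 = z0"
  "kc (vadd z w) = kc z + kc w"
  "kx (vadd z w) = vadd (kx z) (kx w)" "ky (vadd z w) = vadd (ky z) (ky w)"
  "kc (vsc k z) = k * kc z" "kx (vsc k z) = vsc k (kx z)" "ky (vsc k z) = vsc k (ky z)"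
  by (simp_all add: kc_def kx_def kd_def ky_def mkK_def z0_def vadd_def vsc_def)

lemma kmul_without_unit:
  assumes "kc z = 0" "kc w = 0"
  shows "kmul z w = mkK 0 (bracket_op (ky z) (ky w)) 0
    (vadd (vsc (kd w) (kx z)) (vsc (kd z) (twist_op (kx w))))"
  using assms by (simp add: kmul_def vsc_def vadd_def)

lemma K_indices_supp:
  assumes "supp z \<subseteq> K_indices"
  shows "kc z = 0" "supp (kx z) \<subseteq> op_cone" "supp (ky z) \<subseteq> op_cone"
proof -
  have "(False, None) \<notin> supp z" using assms K_indices_simps(1) by blast
  then show "kc z = 0" by (simp add: in_supp_K_iff)
  show "supp (kx z) \<subseteq> op_cone" "supp (ky z) \<subseteq> op_cone"
    using assms in_supp_K_iff(3,4)[of _ z] K_indices_simps(2) by blast+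
qed

lemma in_supp_kmulE:
  assumes "kc z = 0" "kc w = 0" "t \<in> supp (kmul z w)"
  obtains (bracket) p where "t = (False, Some p)" "p \<in> supp (bracket_op (ky z) (ky w))"
    | (left) p where "t = (True, Some p)" "(True, None) \<in> supp w" "p \<in> supp (kx z)"
    | (right) p where "t = (True, Some p)" "(True, None) \<in> supp z" "p \<in> supp (kx w)"
proof -
  note kmul = kmul_without_unit[OF assms(1,2)]
  have scaled: "c \<noteq> 0 \<and> p \<in> supp x" if "p \<in> supp (vsc c x)" for c p and x :: "'a endo"
    using that by (simp add: in_supp_iff vsc_def)
  consider (even) p where "t = (False, Some p)" "p \<in> supp (bracket_op (ky z) (ky w))"
    | (odd) p where "t = (True, Some p)"
      "p \<in> supp (vadd (vsc (kd w) (kx z)) (vsc (kd z) (twist_op (kx w))))"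
    using assms(3) by (cases t; cases "fst t"; cases "snd t") (auto simp: kmul in_supp_K_iff)
  then show ?thesis
  proof cases
    case even
    then show ?thesis by (rule bracket)
  next
    case (odd p)
    from in_supp_vaddD[OF odd(2)] show ?thesis
    proof
      assume "p \<in> supp (vsc (kd w) (kx z))"
      then show ?thesis using left[OF odd(1)] scaled in_supp_K_iff(2) by blast
    next
      assume "p \<in> supp (vsc (kd z) (twist_op (kx w)))"
      then show ?thesis using right[OF odd(1)] scaled in_supp_K_iff(2) supp_twist_op by blast
    qed
  qed
qed

lemma kmul_supported:
  "product_supported K_indices (double_additive fst {(True, None)} K_weight) z w (kmul z w)"
proof (rule product_supportedI)
  fix t assume in_K: "supp z \<subseteq> K_indices" "supp w \<subseteq> K_indices" and "t \<in> supp (kmul z w)"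
  note z_parts = K_indices_supp[OF in_K(1)] and w_parts = K_indices_supp[OF in_K(2)]
  from z_parts(1) w_parts(1) \<open>t \<in> supp (kmul z w)\<close>
  show "t \<in> K_indices \<and> (\<exists>s\<in>supp z. \<exists>u\<in>supp w. double_additive fst {(True, None)} K_weight t s u)"
  proof (cases rule: in_supp_kmulE)
    case (bracket p)
    then obtain q q'
      where "p \<in> op_cone" "q \<in> supp (ky z)" "q' \<in> supp (ky w)" "weight_additive op_weight p q q'"
      using product_supportedE[OF bracket_op_supported z_parts(3) w_parts(3)] by blast
    then show ?thesis
      by (intro conjI bexI[of _ "(True, Some q)"] bexI[of _ "(True, Some q')"])
        (simp_all add: bracket(1) in_supp_K_iff double_additive_def weight_additive_def)
  next
    case (left p)
    then show ?thesis using z_parts(2)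
      by (intro conjI bexI[of _ "(False, Some p)"] bexI[of _ "(True, None)"])
        (auto simp: in_supp_K_iff double_additive_def weight_additive_def)
  next
    case (right p)
    then show ?thesis using w_parts(2)
      by (intro conjI bexI[of _ "(True, None)"] bexI[of _ "(False, Some p)"])
        (auto simp: in_supp_K_iff double_additive_def weight_additive_def)
  qed
qed

lemma in_Ko_iff: "z \<in> Ko \<longleftrightarrow> kc z = 0 \<and> kx z \<in> Qalg \<and> ky z \<in> Qalg"
  by (simp add: Ko_def)

lemma is_subalg_Ko: "is_subalg pe_K [kmul] (\<lambda>_. z0) (Ko :: 'k::field kel set)"
proof (rule is_subalgI)
  note Qalg_closed = is_subalg_z0[OF Q.hom.subalg] is_subalg_vadd[OF Q.hom.subalg]
    is_subalg_vsc[OF Q.hom.subalg] is_subalg_pe[OF Q.hom.subalg] is_subalg_vsub[OF Q.hom.subalg]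
  show "z0 \<in> (Ko :: 'k kel set)" "z0 \<in> (Ko :: 'k kel set)" by (simp_all add: in_Ko_iff Qalg_closed)
  fix z w :: "'k kel" assume z_in: "z \<in> Ko"
  then show "vsc c z \<in> Ko" for c by (simp add: in_Ko_iff Qalg_closed)
  from z_in show "pe_K z \<in> Ko" by (simp add: in_Ko_iff pe_K_def Qalg_closed)
  assume w_in: "w \<in> Ko"
  with z_in show "vadd z w \<in> Ko" by (simp add: in_Ko_iff Qalg_closed)
  have "bracket_op (ky z) (ky w) \<in> Qalg"
    using is_subalg_op[OF Q.hom.subalg, of bracket_op "ky z" "ky w"] z_in w_in
    by (simp add: in_Ko_iff)
  moreover have "twist_op (kx w) \<in> Qalg" using w_in
    by (simp add: twist_op_def in_Ko_iff Qalg_closed)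
  ultimately have "kmul z w \<in> Ko" using z_in w_in
    by (simp add: in_Ko_iff kmul_without_unit Qalg_closed)
  then show "f z w \<in> Ko" if "f \<in> set [kmul]" for f using that by simp
qed

lemma Ko_supp_cases:
  assumes "z \<in> Ko" "t \<in> supp z"
  obtains (unit) "t = (True, None)" | (entry) b p
    where "t = (b, Some p)" "p \<in> supp (kx z) \<union> supp (ky z)"
  using assms by (cases t; cases "fst t"; cases "snd t") (auto simp: in_supp_K_iff in_Ko_iff)

lemma Ko_supp_in_K_indices:
  assumes "z \<in> Ko"
  shows "supp z \<subseteq> K_indices"
proof
  fix t assume "t \<in> supp z"
  with assms show "t \<in> K_indices"
  proof (cases rule: Ko_supp_cases)
    case (entry b p)
    then have "p \<in> op_cone"
      using assms Q.hom.supp_in_G[of "kx z"] Q.hom.supp_in_G[of "ky z"] by (auto simp: in_Ko_iff)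
    then show ?thesis by (simp add: entry)
  qed simp
qed

lemma finite_weights_Ko:
  assumes "z \<in> Ko"
  shows "finite (K_weight ` supp z)"
proof (rule finite_subset)
  show "K_weight ` supp z \<subseteq> insert 0 (op_weight ` supp (kx z) \<union> op_weight ` supp (ky z))"
    using assms by (auto elim: Ko_supp_cases)
  show "finite (insert 0 (op_weight ` supp (kx z) \<union> op_weight ` supp (ky z)))"
    using assms Q.hom.finite_weights[of "kx z"] Q.hom.finite_weights[of "ky z"]
    by (simp add: in_Ko_iff)
qed

lemma proj_upper_in_Ko:
  assumes "z \<in> Ko"
  shows "proj {t. 0 < side s (fst (K_weight t)) \<or> t \<in> {(True, None)}} z \<in> Ko" (is "proj ?I z \<in> Ko")
proof -
  have "kc (proj ?I z) = 0" "kx (proj ?I z) = proj {p. 0 < side s (fst (op_weight p))} (kx z)"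
    "ky (proj ?I z) = proj {p. 0 < side s (fst (op_weight p))} (ky z)"
    using assms by (auto simp: in_Ko_iff kc_def kx_def ky_def proj_def)
  then show ?thesis
    using assms Q.hom.proj_weights[of "kx z" "\<lambda>w. 0 < side s (fst w)"]
      Q.hom.proj_weights[of "ky z" "\<lambda>w. 0 < side s (fst w)"] by (simp add: in_Ko_iff)
qed

lemma ex_Ko_weight_mu_power:
  "\<exists>z\<in>(Ko :: 'k::field kel set). z \<noteq> z0
    \<and> (\<forall>t\<in>supp z. t \<notin> {(True, None)} \<and> fst (K_weight t) = mu ^ n)"
proof -
  obtain e :: "'k endo" where e_v: "e \<in> Qalg" "supp e = v_rel n" using Q.ex_supp_eq_v_rel by blast
  let ?z = "mkK 0 e 0 z0 :: 'k kel"
  have z_in: "?z \<in> Ko" using e_v(1) by (simp add: in_Ko_iff is_subalg_z0[OF Q.hom.subalg])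
  have supp: "\<exists>p. t = (False, Some p) \<and> p \<in> v_rel n" if "t \<in> supp ?z" for t
    using that by (cases t; cases "fst t"; cases "snd t") (auto simp: in_supp_K_iff e_v(2))
  have "(False, Some ({n}, {})) \<in> supp ?z"
    by (simp add: in_supp_K_iff e_v(2) singleton_empty_in_v_rel)
  then have "?z \<noteq> z0" by auto
  moreover have "t \<notin> {(True, None)} \<and> fst (K_weight t) = mu ^ n" if "t \<in> supp ?z" for t
    using supp[OF that] op_weight_v_rel by auto
  ultimately show ?thesis using z_in by blast
qed

interpretation Ko: paraboloid_algebra pe_K "[kmul]" "\<lambda>_. z0" "Ko :: 'k::field kel set" K_indices fst
  "{(True, None)}" K_weight
proof
  show "operations_supported K_indices (double_additive fst {(True, None)} K_weight)
      [kmul] (\<lambda>_. z0 :: 'k kel)"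
    by (rule operations_supportedI) (simp_all add: kmul_supported product_supported_z0)
  show "K_weight t \<in> paraboloid" if "t \<in> K_indices" for t
    using that Q.weight_in_paraboloid by (cases t; cases "snd t") (auto simp: zero_in_paraboloid)
  fix z :: "'k kel" and s
  show "supp (pe_K z) \<subseteq> supp z"
    by (auto simp: supp_def pe_K_def mkK_def kc_def kx_def ky_def vsub_def pe_op_eq_proj proj_def
        split: if_splits option.splits)
  show "side s (fst (K_weight t)) \<noteq> 0"
    if "z \<in> Ko" "t \<in> supp z" "t \<notin> {(True, None)}" "s \<in> generic_slopes" for t
    using that(1,2)
  proof (cases rule: Ko_supp_cases)
    case (entry b p)
    then show ?thesis
      using that(1,4) Q.side_nonzero[of "kx z" p s] Q.side_nonzero[of "ky z" p s]
      by (auto simp: in_Ko_iff)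
  qed (use that(3) in simp)
qed (fact is_subalg_Ko
    | rule Ko_supp_in_K_indices finite_weights_Ko proj_upper_in_Ko ex_Ko_weight_mu_power | simp)+

theorem theorem14p2:
  shows "continuum_decomps pe_op [bracket_op] (\<lambda>a. ocomp a a) (Qalg :: ('k::field) endo set)
       \<and> continuum_decomps id [ocomp] (\<lambda>_. z0) (Aalg :: 'k endo set)
       \<and> continuum_decomps pe_H [hmul, hbr] hsq (Po :: 'k hel set)
       \<and> ((2::'k) \<noteq> 0 \<longrightarrow>
            continuum_decomps pe_J [jmul] (\<lambda>_. z0) (Jo :: 'k jel set)
          \<and> continuum_decomps pe_K [kmul] (\<lambda>_. z0) (Ko :: 'k kel set))"
  by (intro conjI impI Q.continuum_decomps A.continuum_decomps Po.continuum_decomps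
      Jo.continuum_decomps Ko.continuum_decomps)

end
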